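(* Let $n\ge1$, let $V_1,\dots,V_n\subset\mathbb{R}^d$ be linear subspaces of dimensions $k_1,\dots,k_n$, let $s_{V_i}(\theta)$ denote the squared Euclidean distance from $\theta\in\mathbb{R}^d$ to $V_i$, let $0<\alpha_i\le (d-k_i-2)/2$ for $i=1,\dots,n$, and $$f(\theta)=\sum_{a\in\{1,-1\}^d}(s_{V_1}(a\theta))^{-\alpha_1}+\sum_{a\in\{1,-1\}^d}(s_{V_2}(a\theta))^{-\alpha_2}+\cdots+\sum_{a\in\{1,-1\}^d}(s_{V_n}(a\theta))^{-\alpha_n},$$ where $a\theta:=(a_1\theta_1,\dots,a_d\theta_d)$. Then, for the prediction of independent Poisson processes with the same duration (where $\theta_i=\sqrt{\lambda_i}$) or with different durations (where $\theta_i=\sqrt{\lambda_i/\gamma_i}$), the Bayesian predictive distribution based on $\pi_{f,\mathrm J}(\lambda)$ dominates that based on the Jeffreys prior, and is thus nearly minimax.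
   Context: $\mathbb{N}=\{0,1,2,\dots\}$. Model: for unknown $\lambda\in(0,\infty)^d$ and known $r_i,s_i>0$, $x$ and $y$ are independent with $p(x\mid\lambda)=\prod_{i=1}^d (r_i\lambda_i)^{x_i}e^{-r_i\lambda_i}/x_i!$ and $p(y\mid\lambda)=\prod_{i=1}^d (s_i\lambda_i)^{y_i}e^{-s_i\lambda_i}/y_i!$, $x,y\in\mathbb{N}^d$. "Same duration" means $r_1=\dots=r_d=r$ and $s_1=\dots=s_d=s$, and then $\theta_i:=\sqrt{\lambda_i}$; "different durations" means general $r_i,s_i>0$, and then $\theta_i:=\sqrt{\lambda_i/\gamma_i}$ with $\gamma_i:=1/r_i-1/(r_i+s_i)$. For a (possibly improper) prior density $\pi(\lambda)$, the Bayesian predictive distribution is $p_\pi(y\mid x)=\int p(x\mid\lambda)p(y\mid\lambda)\pi(\lambda)\,\mathrm{d}\lambda\big/\int p(x\mid\lambda)\pi(\lambda)\,\mathrm{d}\lambda$. The Jeffreys prior is $\pi_{\mathrm J}(\lambda)\propto\prod_{i=1}^d\lambda_i^{-1/2}$, and $\pi_{f,\mathrm J}(\lambda)\propto f(\theta_1,\dots,\theta_d)\prod_{i=1}^d\lambda_i^{-1/2}$. The Kullback–Leibler (K-L) risk of a predictive distribution $q(y\mid x)$ at $\lambda$ is $\sum_x p(x\mid\lambda)\sum_y p(y\mid\lambda)\log\frac{p(y\mid\lambda)}{q(y\mid x)}$. $q_1$ dominates $q_2$ if the K-L risk of $q_1$ is at most that of $q_2$ at every $\lambda$, with strict inequality for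 some $\lambda$. $q$ is nearly minimax if, for every $\lambda$, its K-L risk is less than $1.04$ times the minimax lower bound $0.5\sum_{i=1}^d\log\bigl((r_i+s_i)/r_i\bigr)$. *)

theory Defs
  imports "HOL-Analysis.Analysis"
begin

definition pos_orthant :: "(real ^ 'd::finite) set" where
  "pos_orthant = {l. \<forall>i. 0 < l $ i}"

text \<open>Joint probability mass of independent Poisson counts with means \<open>t\<^sub>i l\<^sub>i\<close>;
  \<open>p(x | l)\<close> is obtained with \<open>t = r\<close> and \<open>p(y | l)\<close> with \<open>t = s\<close>.\<close>

definition poisson_lik :: "real ^ 'd::finite \<Rightarrow> real ^ 'd \<Rightarrow> ('d \<Rightarrow> nat) \<Rightarrow> real" where
  "poisson_lik t l x = (\<Prod>i\<in>UNIV. (t $ i * l $ i) ^ x i * exp (- (t $ i * l $ i)) / fact (x i))"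

definition bayes_pred ::
  "real ^ 'd::finite \<Rightarrow> real ^ 'd \<Rightarrow> (real ^ 'd \<Rightarrow> real) \<Rightarrow> ('d \<Rightarrow> nat) \<Rightarrow> ('d \<Rightarrow> nat) \<Rightarrow> real" where
  "bayes_pred r s \<pi> x y =
     (LINT l:pos_orthant|lborel. poisson_lik r l x * poisson_lik s l y * \<pi> l) /
     (LINT l:pos_orthant|lborel. poisson_lik r l x * \<pi> l)"

text \<open>Prior densities are determined up to a positive factor, which cancels in
  \<^const>\<open>bayes_pred\<close>; the factor is taken to be 1 below.\<close>

definition jeffreys_prior :: "real ^ 'd::finite \<Rightarrow> real" where
  "jeffreys_prior l = (\<Prod>i\<in>UNIV. (l $ i) powr (- 1 / 2))"

definition prior_fJ ::
  "(real ^ 'd::finite \<Rightarrow> real) \<Rightarrow> (real ^ 'd \<Rightarrow> real ^ 'd) \<Rightarrow> real ^ 'd \<Rightarrow> real" where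
  "prior_fJ f \<theta> l = f (\<theta> l) * jeffreys_prior l"

definition theta_same :: "real ^ 'd::finite \<Rightarrow> real ^ 'd" where
  "theta_same l = (\<chi> i. sqrt (l $ i))"

definition theta_diff :: "real ^ 'd::finite \<Rightarrow> real ^ 'd \<Rightarrow> real ^ 'd \<Rightarrow> real ^ 'd" where
  "theta_diff r s l = (\<chi> i. sqrt (l $ i / (1 / r $ i - 1 / (r $ i + s $ i))))"

text \<open>Extended-real Kullback--Leibler divergence of mass functions. For probability mass
  functions with \<open>q > 0\<close> wherever \<open>p > 0\<close>, the negative part of the series always converges,
  so failure of summability means divergence to \<open>\<infinity>\<close>.\<close>

definition KL_div :: "('a \<Rightarrow> real) \<Rightarrow> ('a \<Rightarrow> real) \<Rightarrow> ereal" where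
  "KL_div p q =
     (if (\<forall>y. 0 < p y \<longrightarrow> 0 < q y) \<and> (\<lambda>y. p y * ln (p y / q y)) summable_on UNIV
      then ereal (\<Sum>\<^sub>\<infinity>y. p y * ln (p y / q y)) else \<infinity>)"

definition KL_risk ::
  "real ^ 'd::finite \<Rightarrow> real ^ 'd \<Rightarrow> (('d \<Rightarrow> nat) \<Rightarrow> ('d \<Rightarrow> nat) \<Rightarrow> real) \<Rightarrow> real ^ 'd \<Rightarrow> ereal" where
  "KL_risk r s q l = (\<Sum>\<^sub>\<infinity>x. ereal (poisson_lik r l x) * KL_div (poisson_lik s l) (q x))"

definition dominates ::
  "real ^ 'd::finite \<Rightarrow> real ^ 'd \<Rightarrow> (('d \<Rightarrow> nat) \<Rightarrow> ('d \<Rightarrow> nat) \<Rightarrow> real) \<Rightarrow>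
   (('d \<Rightarrow> nat) \<Rightarrow> ('d \<Rightarrow> nat) \<Rightarrow> real) \<Rightarrow> bool" where
  "dominates r s q1 q2 \<longleftrightarrow>
     (\<forall>l\<in>pos_orthant. KL_risk r s q1 l \<le> KL_risk r s q2 l) \<and>
     (\<exists>l\<in>pos_orthant. KL_risk r s q1 l < KL_risk r s q2 l)"

definition nearly_minimax ::
  "real ^ 'd::finite \<Rightarrow> real ^ 'd \<Rightarrow> (('d \<Rightarrow> nat) \<Rightarrow> ('d \<Rightarrow> nat) \<Rightarrow> real) \<Rightarrow> bool" where
  "nearly_minimax r s q \<longleftrightarrow>
     (\<forall>l\<in>pos_orthant.
        KL_risk r s q l < ereal (1.04 * (0.5 * (\<Sum>i\<in>UNIV. ln ((r $ i + s $ i) / r $ i)))))"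

definition sq_dist :: "(real ^ 'd::finite) set \<Rightarrow> real ^ 'd \<Rightarrow> real" where
  "sq_dist V \<theta> = (infdist \<theta> V)\<^sup>2"

definition sign_vectors :: "(real ^ 'd::finite) set" where
  "sign_vectors = {a. \<forall>i. a $ i \<in> {1, -1}}"

text \<open>Where \<open>a \<theta>\<close> lies in some \<open>V\<^sub>j\<close> the summand is infinite mathematically, whereas
  \<open>0 powr (- \<alpha>\<^sub>j) = 0\<close>. If every \<open>V\<^sub>j\<close> is a proper subspace, this concerns a null set only and
  does not affect the integrals in \<^const>\<open>bayes_pred\<close>.\<close>

definition shrink_f ::
  "nat \<Rightarrow> (nat \<Rightarrow> (real ^ 'd::finite) set) \<Rightarrow> (nat \<Rightarrow> real) \<Rightarrow> real ^ 'd \<Rightarrow> real" where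
  "shrink_f n V \<alpha> \<theta> =
     (\<Sum>j=1..n. \<Sum>a\<in>sign_vectors. sq_dist (V j) (\<chi> i. a $ i * \<theta> $ i) powr (- \<alpha> j))"

end

(*
  Put \<gamma>_i = 1/r_i - 1/(r_i + s_i) and l_i = \<gamma>_i t_i^2, so that the Jeffreys prior becomes Lebesgue
  measure in t. Let h x and H z be the posterior means of f under the Jeffreys prior, given counts x at
  rate r and z at rate r + s. Then q_f(y|x) / q_J(y|x) = H (x + y) / h x.

  Given z = x + y, x is a binomial thinning of z, and the thinned average of h is the posterior mean,
  given z, of the Gaussian smoothing of f with kernel exp(-|w|^2) (sqgamma_binomial_thinning). Writing
  the powers of the squared distances in f as Gamma integrals of exponentials, the smoothing of f is
  strictly below f almost everywhere (gaussian_smoothing_le), so that E[h x | z] <= H z.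
  With ln u <= u - 1 the risk difference is E[ln (H (x + y)) - ln (h x)] >= 1 - E[h x / H (x + y)] > 0.

  The risk of the Jeffreys rule is a sum of one-dimensional risks
  ln ((r + s) / r) / 2 + (phi ((r + s) l) - phi (r l)) with phi' \<mu> = ln \<mu> - E[ln (X + 1/2)] for X Poisson
  with mean \<mu>, so near minimaxity amounts to \<mu> phi' \<mu> < 0.02. The difference phi' vanishes at infinity
  and exp \<mu> times its derivative is decreasing; an explicit tail estimate settles \<mu> >= 6, and the
  value and the slope at \<mu> = 4 settle \<mu> < 6.
*)
theory Submission
  imports Defs
begin

section \<open>One-dimensional Poisson means\<close>

text \<open>The factor \<gamma>_i in \<theta>_i is what lets one kernel serve all coordinates. In t
  the posterior rates are r_i \<gamma>_i = b_i / (1 + b_i) and (r_i + s_i) \<gamma>_i = b_i with b_i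
  = s_i / r_i. Their reciprocals differ by exactly 1, so passing from z to the thinned counts is
  convolution with exp (- w^2), whatever the durations are. For equal durations \<theta> changes by
  a scalar only, which homogeneity of the distances absorbs. As l_i = \<gamma>_i t_i^2, the signs of
  t are invisible. The sum over sign vectors makes f even in every coordinate, so it can be
  integrated over the whole space, where Gaussians and distances to subspaces fit together.
  Comparing f with one Gaussian average, almost everywhere, takes the place of superharmonicity and
  avoids differentiating f, which is singular near the subspaces. Two obstacles shape the rest.
  \<open>KL_div\<close> and infinite sums take default values on divergent series, so both risks
  must be shown finite, by two-sided exponential bounds on h and H. And the margin is narrow: 1.04 /
  2 = 1/2 + 1/50, which calls for explicit numerical bounds on phi'.\<close>

definition poisson_mean :: "real \<Rightarrow> (nat \<Rightarrow> real) \<Rightarrow> real" where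
  "poisson_mean \<mu> F = exp (- \<mu>) * (\<Sum>k. F k / fact k * \<mu> ^ k)"

text \<open>Exponential growth survives shifts and forward differences without any degree to track,
  and division by k! still makes the power series in \<open>poisson_mean\<close> converge
  everywhere. The base 2 is matched by \<open>two_pow\<close> in the multivariate sums.\<close>

definition tame :: "(nat \<Rightarrow> real) \<Rightarrow> bool" where
  "tame F \<longleftrightarrow> (\<exists>C. \<forall>k. \<bar>F k\<bar> \<le> C * 2 ^ k)"

lemma tameI: "(\<And>k. \<bar>F k\<bar> \<le> C * 2 ^ k) \<Longrightarrow> tame F"
  by (auto simp: tame_def)

lemma tameE:
  assumes "tame F" obtains C where "C \<ge> 0" "\<And>k. \<bar>F k\<bar> \<le> C * 2 ^ k"
proof -
  obtain C where C: "\<And>k. \<bar>F k\<bar> \<le> C * 2 ^ k" using assms by (auto simp: tame_def)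
  have "0 \<le> \<bar>F 0\<bar>" by simp
  also have "\<dots> \<le> C" using C[of 0] by simp
  finally show ?thesis using C that by blast
qed

lemma tame_bounded: "(\<And>k. \<bar>F k\<bar> \<le> C) \<Longrightarrow> tame F"
proof (rule tameI[of _ "\<bar>C\<bar>"])
  fix k assume "\<And>k. \<bar>F k\<bar> \<le> C"
  then have "\<bar>F k\<bar> \<le> \<bar>C\<bar> * 1" by (metis abs_ge_self mult.right_neutral order_trans)
  also have "\<dots> \<le> \<bar>C\<bar> * 2 ^ k" by (intro mult_left_mono) auto
  finally show "\<bar>F k\<bar> \<le> \<bar>C\<bar> * 2 ^ k" .
qed

lemma tame_const: "tame (\<lambda>_. c)"
  by (rule tame_bounded[of _ "\<bar>c\<bar>"]) auto

lemma tame_add: assumes "tame F" "tame G" shows "tame (\<lambda>k. F k + G k)"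
proof -
  obtain C where C: "\<And>k. \<bar>F k\<bar> \<le> C * 2 ^ k" using tameE assms(1) by blast
  obtain D where D: "\<And>k. \<bar>G k\<bar> \<le> D * 2 ^ k" using tameE assms(2) by blast
  show ?thesis
  proof (rule tameI)
    fix k
    have "\<bar>F k + G k\<bar> \<le> \<bar>F k\<bar> + \<bar>G k\<bar>" by (rule abs_triangle_ineq)
    then show "\<bar>F k + G k\<bar> \<le> (C + D) * 2 ^ k" using C[of k] D[of k] by (simp add: algebra_simps)
  qed
qed

lemma tame_cmult: assumes "tame F" shows "tame (\<lambda>k. c * F k)"
proof -
  obtain C where C: "\<And>k. \<bar>F k\<bar> \<le> C * 2 ^ k" using tameE assms(1) by blast
  show ?thesis
  proof (rule tameI)
    fix k
    show "\<bar>c * F k\<bar> \<le> (\<bar>c\<bar> * C) * 2 ^ k"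
      using mult_left_mono[OF C[of k], of "\<bar>c\<bar>"] by (simp add: abs_mult algebra_simps)
  qed
qed

lemma tame_diff: "tame F \<Longrightarrow> tame G \<Longrightarrow> tame (\<lambda>k. F k - G k)"
  using tame_add[of F "\<lambda>k. (-1) * G k"] tame_cmult[of G "-1"] by simp

lemma tame_Suc: assumes "tame F" shows "tame (\<lambda>k. F (Suc k))"
proof -
  obtain C where C: "\<And>k. \<bar>F k\<bar> \<le> C * 2 ^ k" using tameE assms(1) by blast
  show ?thesis
  proof (rule tameI)
    fix k
    show "\<bar>F (Suc k)\<bar> \<le> (2 * C) * 2 ^ k"
      using C[of "Suc k"] by simp
  qed
qed

lemma tame_of_nat: "tame real"
  by (rule tameI[of _ 1]) (simp add: less_imp_le)

lemma tame_summable_abs: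
  assumes "tame F" shows "summable (\<lambda>k. \<bar>F k / fact k * x ^ k\<bar>)"
proof -
  obtain C where C: "\<And>k. \<bar>F k\<bar> \<le> C * 2 ^ k" using tameE assms(1) by blast
  have "summable (\<lambda>k. C * (inverse (fact k) * (2 * \<bar>x\<bar>) ^ k))"
    by (intro summable_mult summable_exp)
  then show ?thesis
  proof (rule summable_comparison_test'[where N = 0])
    fix k :: nat
    have "\<bar>F k\<bar> * (\<bar>x\<bar> ^ k / fact k) \<le> (C * 2 ^ k) * (\<bar>x\<bar> ^ k / fact k)"
      by (intro mult_right_mono C) auto
    then show "norm \<bar>F k / fact k * x ^ k\<bar> \<le> C * (inverse (fact k) * (2 * \<bar>x\<bar>) ^ k)"
      by (simp add: abs_mult power_abs field_simps)
  qed
qed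

lemma tame_summable: "tame F \<Longrightarrow> summable (\<lambda>k. F k / fact k * x ^ k)"
  by (rule summable_rabs_cancel) (rule tame_summable_abs)

lemma poisson_mean_add:
  "tame F \<Longrightarrow> tame G \<Longrightarrow> poisson_mean \<mu> (\<lambda>k. F k + G k) = poisson_mean \<mu> F + poisson_mean \<mu> G"
  unfolding poisson_mean_def distrib_left[symmetric]
  by (subst suminf_add[OF tame_summable tame_summable]) (simp_all add: distrib_right add_divide_distrib)

lemma poisson_mean_cmult:
  "tame F \<Longrightarrow> poisson_mean \<mu> (\<lambda>k. c * F k) = c * poisson_mean \<mu> F"
  unfolding poisson_mean_def
  using suminf_mult[OF tame_summable, of F c \<mu>] by (simp add: mult_ac)

lemma poisson_mean_diff:
  "tame F \<Longrightarrow> tame G \<Longrightarrow> poisson_mean \<mu> (\<lambda>k. F k - G k) = poisson_mean \<mu> F - poisson_mean \<mu> G"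
  using poisson_mean_add[of F "\<lambda>k. (-1) * G k" \<mu>] poisson_mean_cmult[of G \<mu> "-1"] tame_cmult[of G "-1"]
  by simp

lemma exp_suminf: "(\<Sum>k. 1 / fact k * (x::real) ^ k) = exp x"
  by (simp add: exp_def inverse_eq_divide)

lemma poisson_mean_const: "poisson_mean \<mu> (\<lambda>_. c) = c"
proof -
  have "poisson_mean \<mu> (\<lambda>_. c * 1) = c * poisson_mean \<mu> (\<lambda>_. 1)"
    by (rule poisson_mean_cmult[OF tame_const])
  also have "poisson_mean \<mu> (\<lambda>_. 1) = 1"
    unfolding poisson_mean_def exp_suminf by (simp add: exp_minus)
  finally show ?thesis by simp
qed

lemma poisson_mean_mono:
  assumes "\<mu> \<ge> 0" "tame F" "tame G" "\<And>k. F k \<le> G k"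
  shows "poisson_mean \<mu> F \<le> poisson_mean \<mu> G"
  unfolding poisson_mean_def
  by (intro mult_left_mono suminf_le tame_summable assms mult_right_mono divide_right_mono)
    (use assms(1) in auto)

text \<open>Termwise differentiation shifts the coefficients \<open>F k / fact k\<close> to
  \<open>F (Suc k) / fact k\<close>, and the factor \<open>exp (- \<mu>)\<close> subtracts the
  unshifted mean. So derivatives of Poisson means become means of forward differences.\<close>

lemma DERIV_poisson_mean:
  assumes "tame F"
  shows "((\<lambda>\<mu>. poisson_mean \<mu> F) has_real_derivative poisson_mean \<mu> (\<lambda>k. F (Suc k) - F k)) (at \<mu>)"
proof -
  have d: "((\<lambda>x. \<Sum>k. F k / fact k * x ^ k) has_real_derivative
      (\<Sum>k. diffs (\<lambda>k. F k / fact k) k * \<mu> ^ k)) (at \<mu>)"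
    by (rule termdiffs_strong_converges_everywhere) (rule tame_summable[OF assms])
  have "diffs (\<lambda>k. F k / fact k) = (\<lambda>k. F (Suc k) / fact k)"
    by (simp add: diffs_def fun_eq_iff fact_Suc del: of_nat_Suc)
  with d have d': "((\<lambda>x. \<Sum>k. F k / fact k * x ^ k) has_real_derivative
      (\<Sum>k. F (Suc k) / fact k * \<mu> ^ k)) (at \<mu>)" by simp
  have e: "((\<lambda>x. exp (- x)) has_real_derivative - exp (- \<mu>)) (at \<mu>)"
    by (auto intro!: derivative_eq_intros)
  have "((\<lambda>\<mu>. poisson_mean \<mu> F) has_real_derivative
      - exp (- \<mu>) * (\<Sum>k. F k / fact k * \<mu> ^ k) + (\<Sum>k. F (Suc k) / fact k * \<mu> ^ k) * exp (- \<mu>)) (at \<mu>)"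
    unfolding poisson_mean_def by (rule DERIV_mult[OF e d'])
  moreover have "- exp (- \<mu>) * (\<Sum>k. F k / fact k * \<mu> ^ k) + (\<Sum>k. F (Suc k) / fact k * \<mu> ^ k) * exp (- \<mu>) =
      poisson_mean \<mu> (\<lambda>k. F (Suc k) - F k)"
    unfolding poisson_mean_diff[OF tame_Suc[OF assms] assms] poisson_mean_def by (simp only: mult.commute)
  ultimately show ?thesis by (simp only:)
qed

text \<open>The factor 1 / (k + 1) completes k! to (k + 1)!, so the series is that of
  \<open>F\<close> moved by one index. The term at 0 is lost and one power of \<open>\<mu>\<close>
  is divided out.\<close>

lemma poisson_mean_shift:
  assumes "\<mu> > 0" "tame F"
  shows "poisson_mean \<mu> (\<lambda>k. F (Suc k) / real (Suc k)) =
    (poisson_mean \<mu> F - exp (- \<mu>) * F 0) / \<mu>"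
proof -
  have s: "summable (\<lambda>k. F k / fact k * \<mu> ^ k)" by (rule tame_summable[OF assms(2)])
  have s': "summable (\<lambda>k. F (Suc k) / fact (Suc k) * \<mu> ^ Suc k)"
    using s by (subst summable_Suc_iff)
  have "(\<Sum>k. F (Suc k) / fact (Suc k) * \<mu> ^ Suc k) = (\<Sum>k. F k / fact k * \<mu> ^ k) - F 0"
    using suminf_split_head[OF s] by simp
  moreover have "(\<Sum>k. F (Suc k) / fact (Suc k) * \<mu> ^ Suc k) =
      (\<Sum>k. \<mu> * (F (Suc k) / real (Suc k) / fact k * \<mu> ^ k))"
    by (intro suminf_cong) (simp add: field_simps)
  moreover have "\<dots> = \<mu> * (\<Sum>k. F (Suc k) / real (Suc k) / fact k * \<mu> ^ k)"
  proof (rule suminf_mult)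
    have "summable (\<lambda>k. (F (Suc k) / fact (Suc k) * \<mu> ^ Suc k) * (1 / \<mu>))"
      by (rule summable_mult2[OF s'])
    also have "(\<lambda>k. (F (Suc k) / fact (Suc k) * \<mu> ^ Suc k) * (1 / \<mu>)) =
        (\<lambda>k. F (Suc k) / real (Suc k) / fact k * \<mu> ^ k)"
      using assms(1) by (auto simp: field_simps)
    finally show "summable (\<lambda>k. F (Suc k) / real (Suc k) / fact k * \<mu> ^ k)" .
  qed
  ultimately have "\<mu> * (\<Sum>k. F (Suc k) / real (Suc k) / fact k * \<mu> ^ k) = (\<Sum>k. F k / fact k * \<mu> ^ k) - F 0"
    by linarith
  then have "(\<Sum>k. F (Suc k) / real (Suc k) / fact k * \<mu> ^ k) = ((\<Sum>k. F k / fact k * \<mu> ^ k) - F 0) / \<mu>"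
    using assms(1) by (metis nonzero_mult_div_cancel_left less_irrefl)
  then show ?thesis unfolding poisson_mean_def by (simp only: right_diff_distrib times_divide_eq_right)
qed

lemma pochhammer_Suc_ge_1: "1 \<le> pochhammer (real (Suc k)) j"
proof (induction j)
  case (Suc j)
  have "1 * 1 \<le> pochhammer (real (Suc k)) j * (real (Suc k) + real j)"
    by (intro mult_mono Suc) (use Suc in auto)
  then show ?case by (simp add: pochhammer_Suc)
qed simp

lemma tame_inverse_pochhammer: "tame (\<lambda>k. 1 / pochhammer (real (Suc k)) j)"
proof (rule tame_bounded[of _ 1])
  fix k show "\<bar>1 / pochhammer (real (Suc k)) j\<bar> \<le> 1" using pochhammer_Suc_ge_1[of k j] by auto
qed

text \<open>The mean of 1 / ((X + 1) ... (X + j)) is P(X >= j) divided by the j-th power of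
  \<open>\<mu>\<close>. Inverse rising factorials are therefore the right basis for estimating
  Poisson means of inverse powers.\<close>

lemma poisson_mean_inverse_pochhammer:
  assumes "\<mu> > 0"
  shows "poisson_mean \<mu> (\<lambda>k. 1 / pochhammer (real (Suc k)) j) \<le> 1 / \<mu> ^ j"
proof (induction j)
  case 0
  then show ?case by (simp add: poisson_mean_const)
next
  case (Suc j)
  \<comment> \<open>The shift lemma sees only the values of \<open>F\<close> at positive arguments
    in its mean; the value 0 at 0 makes the boundary term vanish.\<close>
  define F where "F k = (if k = 0 then 0 else 1 / pochhammer (real (Suc k)) j)" for k
  have t: "tame F"
  proof (rule tame_bounded[of _ 1])
    fix k show "\<bar>F k\<bar> \<le> 1" using pochhammer_Suc_ge_1[of k j] by (auto simp: F_def)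
  qed
  have "poisson_mean \<mu> (\<lambda>k. 1 / pochhammer (real (Suc k)) (Suc j)) =
      poisson_mean \<mu> (\<lambda>k. F (Suc k) / real (Suc k))"
    by (intro arg_cong[where f = "poisson_mean \<mu>"] ext) (simp add: F_def pochhammer_rec add.commute)
  also have "\<dots> = poisson_mean \<mu> F / \<mu>"
    by (subst poisson_mean_shift[OF assms t]) (simp add: F_def)
  also have "\<dots> \<le> (1 / \<mu> ^ j) / \<mu>"
  proof (rule divide_right_mono)
    have "poisson_mean \<mu> F \<le> poisson_mean \<mu> (\<lambda>k. 1 / pochhammer (real (Suc k)) j)"
    proof (intro poisson_mean_mono t tame_inverse_pochhammer)
      fix k show "F k \<le> 1 / pochhammer (real (Suc k)) j" using pochhammer_Suc_ge_1[of k j] by (auto simp: F_def)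
    qed (use assms in simp)
    with Suc show "poisson_mean \<mu> F \<le> 1 / \<mu> ^ j" by linarith
  qed (use assms in simp)
  finally show ?case by (simp only: power_Suc2 divide_divide_eq_left)
qed

section \<open>The bound on the derivative of the Jeffreys risk\<close>

abbreviation log_half :: "nat \<Rightarrow> real" where "log_half k \<equiv> ln (real k + 1 / 2)"

lemma tame_log_half: "tame log_half"
proof (rule tameI[of _ 1])
  fix k :: nat
  have "1 - 1 / (real k + 1 / 2) \<le> log_half k"
    using ln_ge_iff[of "1 / (real k + 1/2)"] ln_add_one_self_le_self2[of "1 / (real k + 1/2) - 1"]
    by (simp add: ln_div)
  moreover have "1 / (real k + 1 / 2) \<le> 2" by (simp add: field_simps)
  moreover have "log_half k \<le> real k" using ln_le_minus_one[of "real k + 1/2"] by simp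
  moreover have "real k \<le> 2 ^ k" by (simp add: less_imp_le)
  moreover have "(1::real) \<le> 2 ^ k" by simp
  ultimately show "\<bar>log_half k\<bar> \<le> 1 * 2 ^ k" unfolding abs_le_iff by linarith
qed

text \<open>This is phi' of the overview, recognised as the derivative of
  \<open>log_lik_mean\<close> further on.\<close>

definition log_gap :: "real \<Rightarrow> real" where
  "log_gap \<mu> = ln \<mu> - poisson_mean \<mu> log_half"

text \<open>With n = k + 1, this is the error of the midpoint rule for the integral of 1 / x over
  [n - 1/2, n + 1/2]. It is nonnegative by convexity and of order 1 / (12 n^3).\<close>

definition log_err :: "nat \<Rightarrow> real" where
  "log_err k = log_half (Suc k) - log_half k - 1 / real (Suc k)"

text \<open>In ln x = 2 (y + y^3 / 3 + ...) with y = (x - 1) / (x + 1) = 1 / (2 n), the first term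
  is exactly 1 / n. What remains is a positive tail, bounded by a geometric series.\<close>

lemma log_err_bounds: "0 \<le> log_err k" "log_err k \<le> 1 / (3 * real (Suc k) * (4 * (real (Suc k))\<^sup>2 - 1))"
proof -
  define n where "n = real (Suc k)"
  have n: "n \<ge> 1" by (simp add: n_def)
  define x where "x = (2 * n + 1) / (2 * n - 1)"
  have x: "x > 1" using n by (simp add: x_def field_simps)
  have y: "(x - 1) / (x + 1) = 1 / (2 * n)" using n by (simp add: x_def field_simps)
  have "log_half (Suc k) - log_half k = ln x"
  proof -
    have "x = (real (Suc k) + 1 / 2) / (real k + 1 / 2)" using n unfolding x_def n_def by (simp add: field_simps)
    then show ?thesis by (simp add: ln_div)
  qed
  then have e: "log_err k = ln x - 1 / n" by (simp add: log_err_def n_def)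
  have "1 \<le> n\<^sup>2" using n by simp
  then have "4 * n\<^sup>2 - 1 > 0" by linarith
  then have "2 * ((1 / (2 * n)) ^ 3 / (1 - (1 / (2 * n))\<^sup>2) / 3) = 1 / (3 * n * (4 * n\<^sup>2 - 1))"
    using n by (simp add: field_simps power2_eq_square power3_eq_cube)
  then show "0 \<le> log_err k" "log_err k \<le> 1 / (3 * real (Suc k) * (4 * (real (Suc k))\<^sup>2 - 1))"
    using ln_approx_bounds[OF x, of 1] unfolding e n_def[symmetric] y by simp_all
qed

lemma log_err_denominator: "1 / (3 * real (Suc k) * (4 * (real (Suc k))\<^sup>2 - 1)) \<in> {0..1}"
proof -
  have "1 \<le> (real (Suc k))\<^sup>2" by simp
  then have "1 * 1 \<le> 3 * real (Suc k) * (4 * (real (Suc k))\<^sup>2 - 1)"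
    by (intro mult_mono) (linarith | simp)+
  then show ?thesis by (simp del: of_nat_Suc)
qed

lemma tame_log_err: "tame log_err"
proof (rule tame_bounded[of _ 1])
  fix k show "\<bar>log_err k\<bar> \<le> 1"
    using log_err_bounds[of k] log_err_denominator[of k] unfolding atLeastAtMost_iff by linarith
qed

lemma tame_inverse_Suc: "tame (\<lambda>k. 1 / real (Suc k))"
  by (rule tame_bounded[of _ 1]) (auto simp: divide_le_eq_1)

text \<open>The mean of 1 / (X + 1) is (1 - exp (- \<mu>)) / \<mu>, so the derivative 1 / \<mu> of
  the logarithm cancels up to an exponentially small term, and only the mean of
  \<open>log_err\<close> is left to estimate.\<close>

lemma DERIV_log_gap:
  assumes "\<mu> > 0"
  shows "(log_gap has_real_derivative exp (- \<mu>) / \<mu> - poisson_mean \<mu> log_err) (at \<mu>)"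
proof -
  have "poisson_mean \<mu> (\<lambda>k. log_half (Suc k) - log_half k) =
      poisson_mean \<mu> (\<lambda>k. log_err k + 1 / real (Suc k))"
    by (simp add: log_err_def)
  also have "\<dots> = poisson_mean \<mu> log_err + poisson_mean \<mu> (\<lambda>k. 1 / real (Suc k))"
    by (rule poisson_mean_add[OF tame_log_err tame_inverse_Suc])
  also have "poisson_mean \<mu> (\<lambda>k. 1 / real (Suc k)) = (1 - exp (- \<mu>)) / \<mu>"
    using poisson_mean_shift[OF assms tame_const[of 1]] by (simp add: poisson_mean_const)
  finally have "exp (- \<mu>) / \<mu> - poisson_mean \<mu> log_err =
      1 / \<mu> - poisson_mean \<mu> (\<lambda>k. log_half (Suc k) - log_half k)"
    by (simp add: diff_divide_distrib)
  moreover have "((\<lambda>\<mu>. ln \<mu> - poisson_mean \<mu> log_half) has_real_derivative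
      1 / \<mu> - poisson_mean \<mu> (\<lambda>k. log_half (Suc k) - log_half k)) (at \<mu>)"
    by (intro DERIV_diff DERIV_poisson_mean[OF tame_log_half] DERIV_ln_divide assms)
  ultimately show ?thesis by (simp only: log_gap_def[abs_def])
qed

text \<open>A crude bound whose purpose is that \<open>log_gap\<close> has no positive limit at
  infinity. It averages ln (x / \<mu>) >= 1 - \<mu> / x at x = k + 1/2, where 1 / x is bounded by 1
  / (k + 1) + 2 / ((k + 1) (k + 2)). The coefficient 2 is forced by k = 0, where equality
  holds.\<close>

lemma log_gap_le_two_div:
  assumes "\<mu> > 0" shows "log_gap \<mu> \<le> 2 / \<mu>"
proof -
  let ?P = "\<lambda>j k. 1 / pochhammer (real (Suc k)) j"
  let ?G = "\<lambda>k. (ln \<mu> + 1) - \<mu> * (?P 1 k + 2 * ?P 2 k)"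
  have t: "tame (\<lambda>k. ?P 1 k + 2 * ?P 2 k)"
    by (intro tame_add tame_cmult tame_inverse_pochhammer)
  have "poisson_mean \<mu> ?G = (ln \<mu> + 1) - \<mu> * (poisson_mean \<mu> (?P 1) + 2 * poisson_mean \<mu> (?P 2))"
    unfolding poisson_mean_diff[OF tame_const tame_cmult[OF t]] poisson_mean_cmult[OF t]
      poisson_mean_add[OF tame_inverse_pochhammer tame_cmult[OF tame_inverse_pochhammer]]
      poisson_mean_cmult[OF tame_inverse_pochhammer] poisson_mean_const ..
  moreover have "\<mu> * (poisson_mean \<mu> (?P 1) + 2 * poisson_mean \<mu> (?P 2)) \<le> \<mu> * (1 / \<mu> ^ 1 + 2 * (1 / \<mu> ^ 2))"
    by (intro mult_left_mono add_mono poisson_mean_inverse_pochhammer assms) (use assms in auto)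
  moreover have "\<mu> * (1 / \<mu> ^ 1 + 2 * (1 / \<mu> ^ 2)) = 1 + 2 / \<mu>"
    using assms by (simp add: field_simps power2_eq_square)
  moreover have "poisson_mean \<mu> ?G \<le> poisson_mean \<mu> log_half"
  proof (intro poisson_mean_mono tame_log_half tame_diff tame_const tame_cmult[OF t])
    fix k
    have p: "pochhammer (real (Suc k)) 1 = real k + 1" "pochhammer (real (Suc k)) 2 = (real k + 1) * (real k + 2)"
      by (simp_all add: eval_nat_numeral pochhammer_Suc algebra_simps)
    define x where "x = (real k + 1 / 2) / \<mu>"
    have x: "x > 0" using assms by (simp add: x_def)
    have "1 - 1 / x \<le> ln x"
      using ln_le_minus_one[of "1 / x"] x by (simp add: ln_div)
    moreover have "ln x = log_half k - ln \<mu>" unfolding x_def by (subst ln_div) (use assms in auto)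
    moreover have "1 / (real k + 1 / 2) \<le> ?P 1 k + 2 * ?P 2 k"
    proof -
      have "?P 1 k + 2 * ?P 2 k - 1 / (real k + 1 / 2) = (3 * real k / 2) / ((real k + 1) * (real k + 2) * (real k + 1 / 2))"
        unfolding p by (simp add: divide_simps) (simp add: algebra_simps)
      moreover have "0 \<le> (3 * real k / 2) / ((real k + 1) * (real k + 2) * (real k + 1 / 2))" by simp
      ultimately show ?thesis by linarith
    qed
    then have "\<mu> * (1 / (real k + 1 / 2)) \<le> \<mu> * (?P 1 k + 2 * ?P 2 k)"
      using assms by (intro mult_left_mono) auto
    moreover have "1 / x = \<mu> * (1 / (real k + 1 / 2))" by (simp add: x_def)
    ultimately show "?G k \<le> log_half k" by linarith
  qed (use assms in auto)
  ultimately show ?thesis unfolding log_gap_def by linarith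
qed

text \<open>The bound 4 / (n (4 n^2 - 1)) on \<open>12 * log_err k\<close>, with n = k + 1, is
  expanded in inverse rising factorials. The exact coefficients begin 1, 3, 45/4; the third is
  rounded up to 12, and 678 is the value that gives equality at k = 0 while covering the whole
  remainder.\<close>

lemma log_err_pochhammer_bound:
  "12 * log_err k \<le> 1 / pochhammer (real (Suc k)) 3 + 3 * (1 / pochhammer (real (Suc k)) 4)
     + 12 * (1 / pochhammer (real (Suc k)) 5) + 678 * (1 / pochhammer (real (Suc k)) 6)"
proof -
  define n where "n = real (Suc k)"
  define m where "m = real k"
  have nm: "n = m + 1" "m \<ge> 0" by (simp_all add: n_def m_def)
  define q where "q = n * (n + 1) * (n + 2) * (n + 3) * (n + 4) * (n + 5)"
  have p: "pochhammer n 3 = n * (n + 1) * (n + 2)" "pochhammer n 4 = n * (n + 1) * (n + 2) * (n + 3)"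
     "pochhammer n 5 = n * (n + 1) * (n + 2) * (n + 3) * (n + 4)" "pochhammer n 6 = q"
    by (simp_all add: eval_nat_numeral pochhammer_Suc algebra_simps q_def)
  have pos: "4 * n\<^sup>2 - 1 > 0" using nm by (simp add: power2_eq_square algebra_simps add_pos_nonneg)
  have q: "q > 0" using nm by (auto simp: q_def)
  have "4 * ((n + 1) * (n + 2) * (n + 3) * (n + 4) * (n + 5)) \<le>
     (4 * n\<^sup>2 - 1) * ((n + 3) * (n + 4) * (n + 5) + 3 * ((n + 4) * (n + 5)) + 12 * (n + 5) + 678)"
  proof -
    \<comment> \<open>In the variable m = n - 1 every coefficient of the difference is nonnegative.
      The missing constant term is the equality at k = 0.\<close>
    have "(4 * n\<^sup>2 - 1) * ((n + 3) * (n + 4) * (n + 5) + 3 * ((n + 4) * (n + 5)) + 12 * (n + 5) + 678)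
      - 4 * ((n + 1) * (n + 2) * (n + 3) * (n + 4) * (n + 5)) =
      3861 * m + 2526 * m * m + 3 * m * m * m + (0::real)"
      unfolding nm power2_eq_square by (simp add: algebra_simps)
    moreover have "\<dots> \<ge> 0" using nm by (auto intro!: add_nonneg_nonneg mult_nonneg_nonneg)
    ultimately show ?thesis by linarith
  qed
  then have "4 * ((n + 1) * (n + 2) * (n + 3) * (n + 4) * (n + 5)) / ((4 * n\<^sup>2 - 1) * q) \<le>
     (4 * n\<^sup>2 - 1) * ((n + 3) * (n + 4) * (n + 5) + 3 * ((n + 4) * (n + 5)) + 12 * (n + 5) + 678) / ((4 * n\<^sup>2 - 1) * q)"
    using q pos by (intro divide_right_mono) auto
  also have "\<dots> = ((n + 3) * (n + 4) * (n + 5) + 3 * ((n + 4) * (n + 5)) + 12 * (n + 5) + 678) / q"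
    using pos by (intro mult_divide_mult_cancel_left) simp
  also have "\<dots> = 1 / pochhammer n 3 + 3 * (1 / pochhammer n 4) + 12 * (1 / pochhammer n 5) + 678 * (1 / pochhammer n 6)"
  proof -
    have nz: "n + c \<noteq> 0" if "c \<ge> 0" for c using nm that by linarith
    have "(n + 3) * (n + 4) * (n + 5) / q = 1 / pochhammer n 3"
      "(n + 4) * (n + 5) / q = 1 / pochhammer n 4" "(n + 5) / q = 1 / pochhammer n 5"
      unfolding p q_def using nz[of 3] nz[of 4] nz[of 5] by simp_all
    then show ?thesis unfolding p(4) by (simp only: add_divide_distrib times_divide_eq_right[symmetric])
  qed
  finally have *: "4 * ((n + 1) * (n + 2) * (n + 3) * (n + 4) * (n + 5)) / ((4 * n\<^sup>2 - 1) * q) \<le>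
    1 / pochhammer n 3 + 3 * (1 / pochhammer n 4) + 12 * (1 / pochhammer n 5) + 678 * (1 / pochhammer n 6)" .
  define w where "w = (n + 1) * (n + 2) * (n + 3) * (n + 4) * (n + 5)"
  have "w \<noteq> 0" "q = n * w" using nm unfolding w_def q_def by (auto simp: mult.assoc)
  then have "4 * ((n + 1) * (n + 2) * (n + 3) * (n + 4) * (n + 5)) / ((4 * n\<^sup>2 - 1) * q) = 4 / (n * (4 * n\<^sup>2 - 1))"
    unfolding w_def[symmetric] by simp
  moreover have "12 * log_err k \<le> 4 / (n * (4 * n\<^sup>2 - 1))"
    using mult_left_mono[OF log_err_bounds(2)[of k], of 12] unfolding n_def[symmetric] by (simp add: mult.assoc)
  ultimately show ?thesis using * unfolding n_def[symmetric] by linarith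
qed

text \<open>The integral over [\<mu>, infinity) of the bound on the mean of \<open>log_err\<close>
  that the inverse factorial expansion yields.\<close>

definition log_gap_tail :: "real \<Rightarrow> real" where
  "log_gap_tail \<mu> = (1 / (2 * \<mu> ^ 2) + 1 / \<mu> ^ 3 + 3 / \<mu> ^ 4 + 678 / (5 * \<mu> ^ 5)) / 12"

lemma DERIV_log_gap_tail:
  assumes "\<mu> > 0"
  shows "(log_gap_tail has_real_derivative
    - (1 / \<mu> ^ 3 + 3 * (1 / \<mu> ^ 4) + 12 * (1 / \<mu> ^ 5) + 678 * (1 / \<mu> ^ 6)) / 12) (at \<mu>)"
proof -
  have d: "((\<lambda>\<mu>. c / \<mu> ^ Suc n) has_real_derivative - (c * real (Suc n)) * (1 / \<mu> ^ Suc (Suc n))) (at \<mu>)" for c n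
  proof -
    have "((\<lambda>\<mu>. c / \<mu> ^ Suc n) has_real_derivative
        (0 * \<mu> ^ Suc n - c * (real (Suc n) * \<mu> ^ (Suc n - Suc 0))) / (\<mu> ^ Suc n * \<mu> ^ Suc n)) (at \<mu>)"
      by (rule DERIV_divide[OF DERIV_const DERIV_pow]) (use assms in simp)
    also have "(0 * \<mu> ^ Suc n - c * (real (Suc n) * \<mu> ^ (Suc n - Suc 0))) / (\<mu> ^ Suc n * \<mu> ^ Suc n)
        = - (c * real (Suc n)) * (1 / \<mu> ^ Suc (Suc n))"
      using assms by simp
    finally show ?thesis .
  qed
  have eq: "log_gap_tail = (\<lambda>\<mu>. ((1/2) / \<mu> ^ Suc 1 + 1 / \<mu> ^ Suc 2 + 3 / \<mu> ^ Suc 3 + (678/5) / \<mu> ^ Suc 4) / 12)"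
    by (simp add: log_gap_tail_def fun_eq_iff eval_nat_numeral)
  show ?thesis unfolding eq
    by (rule DERIV_cong[OF DERIV_cdivide[OF DERIV_add[OF DERIV_add[OF DERIV_add[OF d d] d] d]]])
      (simp add: eval_nat_numeral)
qed

lemma poisson_mean_log_err_le:
  assumes "\<mu> > 0"
  shows "poisson_mean \<mu> log_err \<le>
    (1 / \<mu> ^ 3 + 3 * (1 / \<mu> ^ 4) + 12 * (1 / \<mu> ^ 5) + 678 * (1 / \<mu> ^ 6)) / 12"
proof -
  let ?P = "\<lambda>j k. 1 / pochhammer (real (Suc k)) j"
  have "12 * poisson_mean \<mu> log_err = poisson_mean \<mu> (\<lambda>k. 12 * log_err k)"
    by (rule poisson_mean_cmult[symmetric]) (rule tame_log_err)
  also have "\<dots> \<le> poisson_mean \<mu> (\<lambda>k. ?P 3 k + 3 * ?P 4 k + 12 * ?P 5 k + 678 * ?P 6 k)"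
    by (intro poisson_mean_mono tame_cmult tame_add tame_log_err tame_inverse_pochhammer
        log_err_pochhammer_bound) (use assms in auto)
  also have "\<dots> = poisson_mean \<mu> (?P 3) + 3 * poisson_mean \<mu> (?P 4) + 12 * poisson_mean \<mu> (?P 5)
      + 678 * poisson_mean \<mu> (?P 6)"
    by (simp only: poisson_mean_add poisson_mean_cmult tame_add tame_cmult tame_inverse_pochhammer)
  also have "\<dots> \<le> 1 / \<mu> ^ 3 + 3 * (1 / \<mu> ^ 4) + 12 * (1 / \<mu> ^ 5) + 678 * (1 / \<mu> ^ 6)"
    by (intro add_mono mult_left_mono poisson_mean_inverse_pochhammer assms) auto
  finally show ?thesis by simp
qed

text \<open>\<open>log_gap - log_gap_tail\<close> has a nonnegative derivative, so a positive value
  would persist for all larger arguments, against the bound 2 / \<mu>.\<close>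

lemma log_gap_le_tail:
  assumes "\<mu> > 0" shows "log_gap \<mu> \<le> log_gap_tail \<mu>"
proof -
  define w where "w x = log_gap x - log_gap_tail x" for x
  have mono: "w \<mu> \<le> w \<nu>" if "\<mu> \<le> \<nu>" for \<nu>
  proof (rule DERIV_nonneg_imp_nondecreasing[OF that])
    fix x assume "\<mu> \<le> x"
    then have x: "x > 0" using assms by simp
    have "(w has_real_derivative exp (- x) / x - poisson_mean x log_err -
       (- (1 / x ^ 3 + 3 * (1 / x ^ 4) + 12 * (1 / x ^ 5) + 678 * (1 / x ^ 6)) / 12)) (at x)"
      unfolding w_def[abs_def] by (intro DERIV_diff DERIV_log_gap DERIV_log_gap_tail x)
    moreover have "0 \<le> exp (- x) / x - poisson_mean x log_err -
       (- (1 / x ^ 3 + 3 * (1 / x ^ 4) + 12 * (1 / x ^ 5) + 678 * (1 / x ^ 6)) / 12)"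
      using poisson_mean_log_err_le[OF x] divide_pos_pos[OF exp_gt_zero[of "- x"] x] by linarith
    ultimately show "\<exists>y. (w has_real_derivative y) (at x) \<and> 0 \<le> y" by blast
  qed
  have "w \<mu> \<le> 0"
  proof (rule ccontr)
    assume "\<not> w \<mu> \<le> 0"
    then have p: "w \<mu> > 0" by simp
    \<comment> \<open>Far enough out that 2 / \<nu> is at most half of
      \<open>w \<mu>\<close>.\<close>
    define \<nu> where "\<nu> = max \<mu> (4 / w \<mu>)"
    have \<nu>: "\<nu> \<ge> \<mu>" "\<nu> \<ge> 4 / w \<mu>" "\<nu> > 0" using assms by (auto simp: \<nu>_def)
    have "log_gap_tail \<nu> \<ge> 0" using \<nu>(3) by (simp add: log_gap_tail_def)
    then have "w \<mu> \<le> 2 / \<nu>" using mono[OF \<nu>(1)] log_gap_le_two_div[OF \<nu>(3)] by (simp add: w_def)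
    then have "w \<mu> * \<nu> \<le> 2" using \<nu>(3) by (simp add: field_simps)
    moreover have "4 \<le> w \<mu> * \<nu>" using \<nu>(2) p by (simp add: field_simps)
    ultimately show False by simp
  qed
  then show ?thesis by (simp add: w_def)
qed

text \<open>\<open>\<mu> * log_gap_tail \<mu>\<close> is a polynomial in 1 / \<mu> with nonnegative
  coefficients, so \<mu> = 6 is the worst case. Its value there is about 0.0191.\<close>

lemma log_gap_large:
  assumes "\<mu> \<ge> 6" shows "\<mu> * log_gap \<mu> < 1 / 50"
proof -
  have "\<mu> * log_gap \<mu> \<le> \<mu> * log_gap_tail \<mu>"
    using assms by (intro mult_left_mono log_gap_le_tail) auto
  also have "\<dots> = (1 / 2 * (1 / \<mu>) ^ 1 + (1 / \<mu>) ^ 2 + 3 * (1 / \<mu>) ^ 3 + 678 / 5 * (1 / \<mu>) ^ 4) / 12"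
    using assms by (simp add: log_gap_tail_def eval_nat_numeral field_simps)
  also have "\<dots> \<le> (1 / 2 * (1 / 6) ^ 1 + (1 / 6) ^ 2 + 3 * (1 / 6) ^ 3 + 678 / 5 * (1 / 6) ^ 4) / 12"
    using assms by (intro divide_right_mono add_mono mult_left_mono power_mono) (auto simp: field_simps)
  also have "\<dots> < 1 / 50" by (simp add: eval_nat_numeral)
  finally show ?thesis .
qed

section \<open>Numerical bounds at \<mu> = 4\<close>

lemma exp_4_le: "exp (4::real) \<le> 54.5983"
proof -
  \<comment> \<open>The remainder is at most exp 1 / 11!, so the Taylor formula becomes a linear
    inequality for exp 1 itself.\<close>
  obtain t :: real where t: "\<bar>t\<bar> \<le> \<bar>1\<bar>" "exp 1 = (\<Sum>m<11. 1 ^ m / fact m) + exp t / fact 11 * 1 ^ 11"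
    using Maclaurin_exp_le[of 1 11] by blast
  have "exp t \<le> exp 1" using t(1) by simp
  then have "exp (1::real) \<le> (\<Sum>m<11. 1 ^ m / fact m) + exp 1 / fact 11"
    using t(2) by (simp add: divide_right_mono)
  then have "exp (1::real) \<le> 2.718282"
    by (simp add: eval_nat_numeral field_simps)
  then have "exp (1::real) ^ 4 \<le> 2.718282 ^ 4" by (intro power_mono) auto
  also have "\<dots> \<le> (54.5983::real)" by (simp add: eval_nat_numeral)
  finally show ?thesis by (simp add: exp_of_nat_mult[symmetric])
qed

text \<open>The first four terms of the series ln x = 2 (y + y^3 / 3 + ...), y = (x - 1) / (x + 1),
  at x = b / a.\<close>

lemma ln_lower:
  assumes "a > 0" "b > a"
  shows "ln b \<ge> ln a + 2 * ((b - a) / (b + a) + ((b - a) / (b + a)) ^ 3 / 3 + ((b - a) / (b + a)) ^ 5 / 5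
    + ((b - a) / (b + a)) ^ 7 / (7::real))"
proof -
  have b: "b / a > 1" using assms by simp
  have y: "(b / a - 1) / (b / a + 1) = (b - a) / (b + a)" 
  proof -
    have "b / a - 1 = (b - a) / a" "b / a + 1 = (b + a) / a"
      using assms by (simp_all add: diff_divide_distrib add_divide_distrib)
    then show ?thesis using assms by simp
  qed
  have "ln (b / a) \<ge> (\<Sum>k<4. 2 * ((b - a) / (b + a)) ^ (2 * k + 1) / of_nat (2 * k + 1))"
    using ln_approx_bounds[OF b, of 4] unfolding y by simp
  moreover have "ln (b / a) = ln b - ln a" using assms by (subst ln_div) auto
  ultimately have *: "(\<Sum>k<4. 2 * ((b - a) / (b + a)) ^ (2 * k + 1) / of_nat (2 * k + 1)) \<le> ln b - ln a" by simp
  have "(\<Sum>k<4. 2 * y ^ (2 * k + 1) / of_nat (2 * k + 1)) = 2 * (y + y ^ 3 / 3 + y ^ 5 / 5 + y ^ 7 / 7)"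
    for y :: real by (simp add: eval_nat_numeral)
  from this[of "(b - a) / (b + a)"] show ?thesis
    using * by linarith
qed

lemma ln_2_bounds: "ln (2::real) \<ge> 0.693146" "ln (2::real) \<le> 0.693148"
  using ln_approx_bounds[of 2 6] by (simp_all add: eval_nat_numeral)

text \<open>Here 54.5983 is the upper bound for exp 4, and 37/150 = 1/4 - 1/300 is exactly what
  \<open>log_gap_4\<close> has to beat. Fifteen terms of the Poisson series at mean 4 suffice, the
  others being positive.\<close>

lemma sum_log_bound:
  "(\<Sum>k<15. 4 ^ k / fact k * log_half (Suc k)) \<ge> 54.5983 * (ln 4 + 37 / 150)"
proof -
  \<comment> \<open>As \<open>log_half (Suc k)\<close> is ln (2 k + 3) - ln 2, logarithms of the odd
    numbers up to 31 occur. Each odd prime is compared with its predecessor, which has only smaller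
    prime factors.\<close>
  have comp: "ln (3::real) \<ge> ln 2 + 0.405463" "ln (5::real) \<ge> 2 * ln 2 + 0.223143"
    "ln (7::real) \<ge> ln 2 + ln 3 + 0.154150" "ln (11::real) \<ge> ln 2 + ln 5 + 0.095310"
    "ln (13::real) \<ge> 2 * ln 2 + ln 3 + 0.080042" "ln (17::real) \<ge> 4 * ln 2 + 0.060624"
    "ln (19::real) \<ge> ln 2 + 2 * ln 3 + 0.054067" "ln (23::real) \<ge> ln 2 + ln 11 + 0.044451"
    "ln (29::real) \<ge> 2 * ln 2 + ln 7 + 0.035091" "ln (31::real) \<ge> ln 2 + ln 3 + ln 5 + 0.032789"
  proof -
    have m: "ln (4::real) = 2 * ln 2" "ln (6::real) = ln 2 + ln 3" "ln (10::real) = ln 2 + ln 5"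
      "ln (12::real) = 2 * ln 2 + ln 3" "ln (16::real) = 4 * ln 2" "ln (18::real) = ln 2 + 2 * ln 3"
      "ln (22::real) = ln 2 + ln 11" "ln (28::real) = 2 * ln 2 + ln 7" "ln (30::real) = ln 2 + ln 3 + ln 5"
      using ln_mult[of 2 "2::real"] ln_mult[of 2 "3::real"] ln_mult[of 2 "5::real"] ln_mult[of 2 "6::real"]
        ln_mult[of 4 "4::real"] ln_mult[of 6 "3::real"] ln_mult[of 2 "11::real"] ln_mult[of 4 "7::real"]
        ln_mult[of 6 "5::real"] by simp_all
    show "ln (3::real) \<ge> ln 2 + 0.405463" using ln_lower[of 2 3] by (simp add: eval_nat_numeral)
    show "ln (5::real) \<ge> 2 * ln 2 + 0.223143" using ln_lower[of 4 5] m by (simp add: eval_nat_numeral)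
    show "ln (7::real) \<ge> ln 2 + ln 3 + 0.154150" using ln_lower[of 6 7] m by (simp add: eval_nat_numeral)
    show "ln (11::real) \<ge> ln 2 + ln 5 + 0.095310" using ln_lower[of 10 11] m by (simp add: eval_nat_numeral)
    show "ln (13::real) \<ge> 2 * ln 2 + ln 3 + 0.080042" using ln_lower[of 12 13] m by (simp add: eval_nat_numeral)
    show "ln (17::real) \<ge> 4 * ln 2 + 0.060624" using ln_lower[of 16 17] m by (simp add: eval_nat_numeral)
    show "ln (19::real) \<ge> ln 2 + 2 * ln 3 + 0.054067" using ln_lower[of 18 19] m by (simp add: eval_nat_numeral)
    show "ln (23::real) \<ge> ln 2 + ln 11 + 0.044451" using ln_lower[of 22 23] m by (simp add: eval_nat_numeral)
    show "ln (29::real) \<ge> 2 * ln 2 + ln 7 + 0.035091" using ln_lower[of 28 29] m by (simp add: eval_nat_numeral)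
    show "ln (31::real) \<ge> ln 2 + ln 3 + ln 5 + 0.032789" using ln_lower[of 30 31] m by (simp add: eval_nat_numeral)
  qed
  have m: "ln (4::real) = 2 * ln 2" "ln (9::real) = 2 * ln 3" "ln (15::real) = ln 3 + ln 5"
    "ln (21::real) = ln 3 + ln 7" "ln (25::real) = 2 * ln 5" "ln (27::real) = 3 * ln 3"
    using ln_mult[of 2 "2::real"] ln_mult[of 3 "3::real"] ln_mult[of 3 "5::real"] ln_mult[of 3 "7::real"]
      ln_mult[of 5 "5::real"] ln_mult[of 3 "9::real"] by simp_all
  have L: "log_half (Suc k) = ln (real (2 * k + 3)) - ln 2" for k
  proof -
    have "real (2 * k + 3) = 2 * (real (Suc k) + 1 / 2)" by simp
    then show ?thesis by (simp only:) (subst ln_mult, auto)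
  qed
  have "(\<Sum>k<15. 4 ^ k / fact k * (ln (real (2 * k + 3)) - ln 2)) \<ge> 54.5983 * (ln 4 + 37 / 150)"
  proof -
    have b: "0.40545 \<le> ln 3 - ln (2::real)"
      "0.91628 \<le> ln 5 - ln (2::real)"
      "1.25275 \<le> ln 7 - ln (2::real)"
      "1.50406 \<le> ln 9 - ln (2::real)"
      "1.70473 \<le> ln 11 - ln (2::real)"
      "1.87179 \<le> ln 13 - ln (2::real)"
      "2.01489 \<le> ln 15 - ln (2::real)"
      "2.14005 \<le> ln 17 - ln (2::real)"
      "2.25127 \<le> ln 19 - ln (2::real)"
      "2.35136 \<le> ln 21 - ln (2::real)"
      "2.44233 \<le> ln 23 - ln (2::real)"
      "2.52571 \<le> ln 25 - ln (2::real)"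
      "2.60267 \<le> ln 27 - ln (2::real)"
      "2.67413 \<le> ln 29 - ln (2::real)"
      "2.74082 \<le> ln 31 - ln (2::real)"
      using comp ln_2_bounds unfolding m by simp_all
    have "(\<Sum>k<15. 4 ^ k / fact k * (ln (real (2 * k + 3)) - ln 2)) =
      1 / 1 * (ln 3 - ln 2) + (4 / 1 * (ln 5 - ln 2) + (16 / 2 * (ln 7 - ln 2) + (64 / 6 * (ln 9 - ln 2) + (256 / 24 * (ln 11 - ln 2) + (1024 / 120 * (ln 13 - ln 2) + (4096 / 720 * (ln 15 - ln 2) + (16384 / 5040 * (ln 17 - ln 2) + (65536 / 40320 * (ln 19 - ln 2) + (262144 / 362880 * (ln 21 - ln 2) + (1048576 / 3628800 * (ln 23 - ln 2) + (4194304 / 39916800 * (ln 25 - ln 2) + (16777216 / 479001600 * (ln 27 - ln 2) + (67108864 / 6227020800 * (ln 29 - ln 2) + (268435456 / 87178291200 * (ln 31 - ln 2)))))))))))))))"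
      by (simp add: eval_nat_numeral diff_divide_distrib right_diff_distrib)
    also have "\<dots> \<ge> 1 / 1 * 0.40545 + (4 / 1 * 0.91628 + (16 / 2 * 1.25275 + (64 / 6 * 1.50406 + (256 / 24 * 1.70473 + (1024 / 120 * 1.87179 + (4096 / 720 * 2.01489 + (16384 / 5040 * 2.14005 + (65536 / 40320 * 2.25127 + (262144 / 362880 * 2.35136 + (1048576 / 3628800 * 2.44233 + (4194304 / 39916800 * 2.52571 + (16777216 / 479001600 * 2.60267 + (67108864 / 6227020800 * 2.67413 + (268435456 / 87178291200 * 2.74082))))))))))))))"
      by (intro add_mono mult_left_mono b) auto
    finally show ?thesis using ln_2_bounds unfolding m by simp
  qed
  then show ?thesis unfolding L .
qed

text \<open>The derivative of \<open>log_gap\<close> with the factor \<open>exp (- \<mu>)\<close>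
  removed. What is left is 1 / \<mu> minus a power series with nonnegative coefficients, hence
  visibly decreasing.\<close>

definition log_gap_slope :: "real \<Rightarrow> real" where
  "log_gap_slope \<mu> = 1 / \<mu> - (\<Sum>k. log_err k / fact k * \<mu> ^ k)"

lemma log_gap_slope_antimono:
  assumes "0 < x" "x \<le> y" shows "log_gap_slope y \<le> log_gap_slope x"
proof -
  have "(\<Sum>k. log_err k / fact k * x ^ k) \<le> (\<Sum>k. log_err k / fact k * y ^ k)"
    using assms
    by (intro suminf_le tame_summable tame_log_err mult_left_mono power_mono divide_nonneg_nonneg log_err_bounds) auto
  moreover have "1 / y \<le> 1 / x" using assms by (simp add: frac_le)
  ultimately show ?thesis by (simp add: log_gap_slope_def)
qed

lemma DERIV_log_gap_slope:
  assumes "\<mu> > 0"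
  shows "(log_gap has_real_derivative exp (- \<mu>) * log_gap_slope \<mu>) (at \<mu>)"
  using DERIV_log_gap[OF assms]
  by (simp add: log_gap_slope_def poisson_mean_def right_diff_distrib)

text \<open>Says that \<open>log_gap\<close> is still nondecreasing at 4. Then the multiple of exp
  (- x) added in the maximisation is nonnegative and may be dropped from an upper bound.\<close>

lemma log_gap_slope_4_nonneg: "log_gap_slope 4 \<ge> 0"
proof -
  \<comment> \<open>The bound on \<open>log_err\<close> at k = 6 is 1 / 4095, which covers all later
    k. Subtracting this constant also from the first six terms leaves a finite sum plus
    \<open>exp 4 / 4095\<close>.\<close>
  have "log_err k \<le> (if k < 6 then 1 / (3 * real (Suc k) * (4 * (real (Suc k))\<^sup>2 - 1)) - 1 / 4095 else 0) + 1 / 4095" for k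
  proof (cases "k < 6")
    case False
    then have k: "real (Suc k) \<ge> 7" by simp
    then have "7\<^sup>2 \<le> (real (Suc k))\<^sup>2" by (intro power_mono) auto
    then have "(3 * 7) * 195 \<le> (3 * real (Suc k)) * (4 * (real (Suc k))\<^sup>2 - 1)"
      using k by (intro mult_mono) auto
    then have "1 / (3 * real (Suc k) * (4 * (real (Suc k))\<^sup>2 - 1)) \<le> 1 / 4095" by (intro divide_left_mono) auto
    then have "log_err k \<le> 1 / 4095" using log_err_bounds(2)[of k] by linarith
    then show ?thesis using False by simp
  qed (use log_err_bounds(2)[of k] in simp)
  then have "(\<Sum>k. log_err k / fact k * 4 ^ k) \<le> (\<Sum>k. ((if k < 6 then 1 / (3 * real (Suc k) * (4 * (real (Suc k))\<^sup>2 - 1)) - 1 / 4095 else 0) + 1 / 4095) / fact k * 4 ^ k)"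
    (is "_ \<le> (\<Sum>k. (?g k + ?c) / fact k * 4 ^ k)")
  proof (intro suminf_le mult_right_mono divide_right_mono tame_summable tame_log_err tame_add tame_const)
    show "tame ?g" 
    proof (rule tame_bounded[of _ 1])
      fix k show "\<bar>?g k\<bar> \<le> 1"
        using log_err_denominator[of k] unfolding atLeastAtMost_iff by (cases "k < 6") (simp_all only: if_True if_False, linarith+)
    qed
  qed auto
  also have "\<dots> = (\<Sum>k<6. ?g k / fact k * 4 ^ k) + ?c * exp 4"
  proof -
    have "(\<lambda>k. ?g k / fact k * 4 ^ k) sums (\<Sum>k<6. ?g k / fact k * 4 ^ k)"
      by (rule sums_finite) auto
    moreover have "(\<lambda>k. ?c * (4 ^ k /\<^sub>R fact k)) sums (?c * exp 4)"
      by (intro sums_mult exp_converges)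
    ultimately have "(\<lambda>k. ?g k / fact k * 4 ^ k + ?c * (4 ^ k /\<^sub>R fact k)) sums
        ((\<Sum>k<6. ?g k / fact k * 4 ^ k) + ?c * exp 4)" by (rule sums_add)
    moreover have "(\<lambda>k. g k / fact k * 4 ^ k + c * (4 ^ k /\<^sub>R fact k)) = (\<lambda>k. (g k + c) / fact k * 4 ^ k)"
      for g :: "nat \<Rightarrow> real" and c
      by (simp add: fun_eq_iff field_simps)
    ultimately show ?thesis by (simp only: sums_iff)
  qed
  also have "\<dots> \<le> (\<Sum>k<6. ?g k / fact k * 4 ^ k) + ?c * 54.5983" using exp_4_le by simp
  also have "\<dots> \<le> 1 / 4" by (simp add: eval_nat_numeral)
  finally show ?thesis by (simp add: log_gap_slope_def)
qed

text \<open>Since \<open>log_half k + log_err k\<close> equals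
  \<open>log_half (Suc k) - 1 / real (Suc k)\<close>, the two series merge. The left side is exactly
  ln 4 + 1/4 minus the mean of \<open>log_half (Suc k)\<close> at 4, so no separate estimate of the
  slope is involved.\<close>

lemma log_gap_4: "log_gap 4 + log_gap_slope 4 * exp (- 4) \<le> 1 / 300"
proof -
  let ?L = "\<Sum>k. log_half (Suc k) / fact k * 4 ^ k"
  have s: "summable (\<lambda>k. log_half k / fact k * 4 ^ k)" "summable (\<lambda>k. log_err k / fact k * 4 ^ k)"
    "summable (\<lambda>k. log_half (Suc k) / fact k * 4 ^ k)" "summable (\<lambda>k. 1 / real (Suc k) / fact k * 4 ^ k)"
    by (rule tame_summable tame_log_half tame_log_err tame_Suc[OF tame_log_half] tame_inverse_Suc)+
  have "(\<Sum>k. log_half k / fact k * 4 ^ k) + (\<Sum>k. log_err k / fact k * 4 ^ k) =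
      (\<Sum>k. log_half (Suc k) / fact k * 4 ^ k - 1 / real (Suc k) / fact k * 4 ^ k)"
    unfolding suminf_add[OF s(1,2)]
    by (intro suminf_cong) (simp add: log_err_def distrib_right diff_divide_distrib add_divide_distrib left_diff_distrib)
  also have "\<dots> = ?L - (\<Sum>k. 1 / real (Suc k) / fact k * 4 ^ k)"
    by (rule suminf_diff[OF s(3,4), symmetric])
  also have "(\<Sum>k. 1 / real (Suc k) / fact k * 4 ^ k) = (exp 4 - 1) / 4"
    using poisson_mean_shift[of 4 "\<lambda>_. 1"] tame_const[of 1]
    by (simp add: poisson_mean_const poisson_mean_def exp_minus field_simps)
  finally have eq: "(\<Sum>k. log_half k / fact k * 4 ^ k) + (\<Sum>k. log_err k / fact k * 4 ^ k) =
      ?L - (exp 4 - 1) / 4" .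
  have "54.5983 * (ln 4 + 37 / 150) \<le> ?L"
  proof (rule order_trans[OF sum_log_bound])
    have "(\<Sum>k<15. log_half (Suc k) / fact k * 4 ^ k) \<le> ?L"
      by (rule sum_le_suminf[OF s(3)]) (auto intro!: mult_nonneg_nonneg divide_nonneg_nonneg ln_ge_zero)
    then show "(\<Sum>k<15. 4 ^ k / fact k * log_half (Suc k)) \<le> ?L"
      by (simp add: mult.commute)
  qed
  moreover have "exp 4 * (ln 4 + 37 / 150) \<le> 54.5983 * (ln 4 + 37 / (150::real))"
    by (intro mult_right_mono exp_4_le add_nonneg_nonneg) auto
  ultimately have "exp 4 * (ln 4 + 37 / 150) \<le> ?L" by linarith
  then have "exp (- 4) * (exp 4 * (ln 4 + 37 / 150)) \<le> exp (- 4) * ?L"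
    by (intro mult_left_mono) auto
  then have S: "ln 4 + 37 / 150 \<le> exp (- 4) * ?L"
    by (simp add: mult.assoc[symmetric] exp_minus)
  have "log_gap 4 + log_gap_slope 4 * exp (- 4) = ln 4 + exp (- 4) / 4
      - exp (- 4) * ((\<Sum>k. log_half k / fact k * 4 ^ k) + (\<Sum>k. log_err k / fact k * 4 ^ k))"
    by (simp add: log_gap_def log_gap_slope_def poisson_mean_def algebra_simps)
  also have "\<dots> = ln 4 + 1 / 4 - exp (- 4) * ?L"
    unfolding eq by (simp add: right_diff_distrib diff_divide_distrib exp_minus)
  finally show ?thesis using S by linarith
qed

text \<open>Since the slope is decreasing, \<open>log_gap x + log_gap_slope 4 * exp (- x)\<close> is maximal at 4.\<close>
lemma log_gap_le:
  assumes "\<mu> > 0" shows "log_gap \<mu> \<le> 1 / 300"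
proof -
  define q where "q x = log_gap x + log_gap_slope 4 * exp (- x)" for x
  have d: "(q has_real_derivative exp (- x) * (log_gap_slope x - log_gap_slope 4)) (at x)" if "x > 0" for x
    unfolding q_def[abs_def]
    by (rule DERIV_cong[OF DERIV_add[OF DERIV_log_gap_slope[OF that] DERIV_cmult[OF DERIV_chain'[OF DERIV_minus[OF DERIV_ident] DERIV_exp]]]])
      (simp add: algebra_simps)
  have "q \<mu> \<le> q 4"
  proof (cases "\<mu> \<le> 4")
    case True
    show ?thesis
    proof (rule DERIV_nonneg_imp_nondecreasing[OF True])
      fix x assume x: "\<mu> \<le> x" "x \<le> 4"
      then have "0 \<le> exp (- x) * (log_gap_slope x - log_gap_slope 4)"
        using assms log_gap_slope_antimono[of x 4] by simp
      then show "\<exists>y. (q has_real_derivative y) (at x) \<and> 0 \<le> y" using d[of x] x assms by auto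
    qed
  next
    case False
    then have "4 \<le> \<mu>" by simp
    then show ?thesis
    proof (rule DERIV_nonpos_imp_nonincreasing)
      fix x assume x: "4 \<le> x" "x \<le> \<mu>"
      then have "exp (- x) * (log_gap_slope x - log_gap_slope 4) \<le> 0"
        using log_gap_slope_antimono[of 4 x] by (simp add: mult_nonneg_nonpos)
      then show "\<exists>y. (q has_real_derivative y) (at x) \<and> y \<le> 0" using d[of x] x by auto
    qed
  qed
  moreover have "log_gap \<mu> \<le> q \<mu>" using log_gap_slope_4_nonneg by (simp add: q_def)
  ultimately show ?thesis using log_gap_4 by (simp add: q_def)
qed

text \<open>The two regimes meet at 6 because 6 / 300 = 1 / 50.\<close>

lemma log_gap_bound:
  assumes "\<mu> > 0" shows "\<mu> * log_gap \<mu> < 1 / 50"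
proof (cases "\<mu> < 6")
  case True
  have "\<mu> * log_gap \<mu> \<le> \<mu> * (1 / 300)" using assms by (intro mult_left_mono log_gap_le) auto
  then show ?thesis using True by simp
qed (use log_gap_large in simp)

section \<open>Lebesgue measure in orthogonal and in squared coordinates\<close>

lemma infdist_orthogonal_decomp:
  fixes V :: "'a::euclidean_space set"
  assumes "a \<in> V" "subspace V" "\<And>v. v \<in> V \<Longrightarrow> v \<bullet> b = 0"
  shows "infdist (a + b) V = norm b"
proof (rule antisym)
  show "infdist (a + b) V \<le> norm b"
    using infdist_le[OF assms(1), of "a + b"] by (simp add: dist_norm)
  have "norm b \<le> dist (a + b) v" if "v \<in> V" for v
  proof -
    have "a - v \<in> V" using assms that by (simp add: subspace_diff)
    then have "(a - v) \<bullet> b = 0" by (rule assms(3))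
    then have "(norm ((a - v) + b))\<^sup>2 = (norm (a - v))\<^sup>2 + (norm b)\<^sup>2"
      by (simp add: norm_add_Pythagorean orthogonal_def)
    then have "(norm b)\<^sup>2 \<le> (norm ((a - v) + b))\<^sup>2" by simp
    then have "norm b \<le> norm ((a - v) + b)" by (rule power2_le_imp_le) simp
    then show ?thesis by (simp add: dist_norm algebra_simps)
  qed
  then show "norm b \<le> infdist (a + b) V"
    using assms(1) by (subst infdist_notempty) (auto intro!: cINF_greatest)
qed

text \<open>Orthonormal bases of \<open>V\<close> and of its orthogonal complement together define
  \<open>T\<close>; \<open>I\<close> indexes the complement, so its size is the codimension. In
  these coordinates functions exp (- u s) of the squared distance s factor into one-dimensional
  ones.\<close>

lemma subspace_orthogonal_coordinates:
  fixes V :: "(real ^ 'n::finite) set"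
  assumes "subspace V"
  shows "\<exists>(T :: real ^ 'n \<Rightarrow> real ^ 'n) I. orthogonal_transformation T \<and> card I + dim V = CARD('n) \<and>
    (\<forall>v. sq_dist V (T v) = (\<Sum>i\<in>I. (v $ i)\<^sup>2))"
proof -
  obtain B1 where B1: "B1 \<subseteq> V" "pairwise orthogonal B1" "\<And>x. x \<in> B1 \<Longrightarrow> norm x = 1"
    "independent B1" "card B1 = dim V" "span B1 = V"
    by (rule orthonormal_basis_subspace[OF assms], rule that)
  define W where "W = {y \<in> UNIV. \<forall>x\<in>V. orthogonal x y}"
  have "W = orthogonal_comp V" by (auto simp: W_def orthogonal_comp_def)
  then have W: "subspace W" by (simp only: subspace_orthogonal_comp)
  have dimW: "dim W + dim V = CARD('n)"
    using dim_subspace_orthogonal_to_vectors[OF assms subspace_UNIV] by (simp add: W_def)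
  obtain B2 where B2: "B2 \<subseteq> W" "pairwise orthogonal B2" "\<And>x. x \<in> B2 \<Longrightarrow> norm x = 1"
    "independent B2" "card B2 = dim W" "span B2 = W"
    by (rule orthonormal_basis_subspace[OF W], rule that)
  have orth: "x \<bullet> y = 0" if "x \<in> V" "y \<in> B2" for x y
    using that B2(1) by (auto simp: orthogonal_def W_def)
  have disj: "B1 \<inter> B2 = {}"
  proof (rule ccontr)
    assume "B1 \<inter> B2 \<noteq> {}"
    then obtain x where "x \<in> B1" "x \<in> B2" by blast
    then have "x \<bullet> x = 0" using orth[of x x] B1(1) by blast
    then show False using B1(3)[OF \<open>x \<in> B1\<close>] by simp
  qed
  define B where "B = B1 \<union> B2"
  have "finite B1" "finite B2" using B1(4) B2(4) by (auto intro: independent_imp_finite)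
  then have "card B = CARD('n)" "finite B"
    using disj B1(5) B2(5) dimW by (auto simp: B_def card_Un_disjoint)
  then obtain e :: "'n \<Rightarrow> real ^ 'n" where e: "bij_betw e UNIV B"
    using finite_same_card_bij[of "UNIV :: 'n set" B] by auto
  then have eB: "e i \<in> B" for i by (auto simp: bij_betw_def)
  have inj: "e i = e j \<longleftrightarrow> i = j" for i j using e by (auto simp: bij_betw_def inj_eq)
  have ee: "e i \<bullet> e j = (if i = j then 1 else 0)" for i j
  proof (cases "i = j")
    case True
    have "norm (e i) = 1" using eB[of i] B1(3) B2(3) by (auto simp: B_def)
    then show ?thesis using True by (simp add: norm_eq_1)
  next
    case False
    then have ne: "e i \<noteq> e j" using inj by simp
    have "e i \<bullet> e j = 0"
      using eB[of i] eB[of j] ne B1(1,2) B2(2) orth[of "e i" "e j"] orth[of "e j" "e i"]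
      unfolding B_def pairwise_def orthogonal_def by (auto simp: inner_commute)
    then show ?thesis using False by simp
  qed
  have ee2: "c * (e i \<bullet> e j) = (if i = j then c else 0)" for c i j by (simp add: ee)
  define T where "T v = (\<Sum>i\<in>UNIV. v $ i *\<^sub>R e i)" for v :: "real ^ 'n"
  define I where "I = {i. e i \<in> B2}"
  have lin: "linear T"
    unfolding T_def by (intro linearI) (simp_all add: scaleR_left_distrib sum.distrib scaleR_right.sum)
  have "T v \<bullet> T w = v \<bullet> w" for v w
  proof -
    have "T v \<bullet> T w = (\<Sum>i\<in>UNIV. v $ i * w $ i)"
      by (simp add: T_def inner_sum_left inner_sum_right ee2 mult.commute)
    then show ?thesis by (simp add: inner_vec_def)
  qed
  then have "orthogonal_transformation T" using lin by (simp add: orthogonal_transformation_def)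
  moreover have "card I + dim V = CARD('n)"
  proof -
    have "e ` I = B2" using e unfolding I_def B_def bij_betw_def by auto
    moreover have "inj_on e I" using inj by (auto simp: inj_on_def)
    ultimately have "card I = card B2" using card_image by fastforce
    then show ?thesis using dimW B2(5) by simp
  qed
  moreover have "sq_dist V (T v) = (\<Sum>i\<in>I. (v $ i)\<^sup>2)" for v
  proof -
    let ?a = "\<Sum>i\<in>-I. v $ i *\<^sub>R e i" and ?b = "\<Sum>i\<in>I. v $ i *\<^sub>R e i"
    have "T v = ?a + ?b"
      unfolding T_def by (subst sum.union_disjoint[symmetric]) (auto intro: sum.cong)
    moreover have "infdist (?a + ?b) V = norm ?b"
    proof (rule infdist_orthogonal_decomp[OF _ assms])
      have "e i \<in> V" if "i \<in> -I" for i using that eB[of i] B1(1) by (auto simp: I_def B_def)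
      then show "?a \<in> V" using assms by (intro subspace_sum subspace_scale) auto
      show "x \<bullet> ?b = 0" if "x \<in> V" for x
        using orth[OF that] by (auto simp: inner_sum_right I_def intro!: sum.neutral)
    qed
    moreover have "(norm ?b)\<^sup>2 = (\<Sum>i\<in>I. (v $ i)\<^sup>2)"
    proof -
      have "(norm ?b)\<^sup>2 = (\<Sum>i\<in>I. v $ i * v $ i)"
        by (simp add: power2_norm_eq_inner inner_sum_left inner_sum_right ee2)
      then show ?thesis by (simp add: power2_eq_square)
    qed
    ultimately show ?thesis by (simp add: sq_dist_def)
  qed
  ultimately show ?thesis by blast
qed

section \<open>Products, shifts and Gamma integrals\<close>

lemma nn_integral_lborel_prod_cart:
  fixes f :: "'n::finite \<Rightarrow> real \<Rightarrow> ennreal"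
  assumes [measurable]: "\<And>i. f i \<in> borel_measurable borel"
  shows "(\<integral>\<^sup>+x. (\<Prod>i\<in>UNIV. f i (x $ i)) \<partial>(lborel :: (real ^ 'n) measure)) = (\<Prod>i\<in>UNIV. \<integral>\<^sup>+t. f i t \<partial>lborel)"
proof -
  let ?e = "\<lambda>i::'n. axis i (1::real)"
  have bij: "bij_betw ?e UNIV Basis"
    unfolding bij_betw_def by (auto simp: inj_on_def axis_eq_axis Basis_vec_def)
  define g where "g b = f (the_inv_into UNIV ?e b)" for b
  have g: "g (?e i) = f i" for i
    unfolding g_def using the_inv_into_f_f[of ?e UNIV i] bij by (simp add: bij_betw_def)
  have "(\<integral>\<^sup>+x. (\<Prod>b\<in>Basis. g b (x \<bullet> b)) \<partial>(lborel :: (real ^ 'n) measure)) = (\<Prod>b\<in>Basis. \<integral>\<^sup>+t. g b t \<partial>lborel)"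
    by (rule nn_integral_lborel_prod) (auto simp: g_def)
  then show ?thesis
    unfolding prod.reindex_bij_betw[OF bij, symmetric] g by (simp add: inner_axis)
qed

lemma nn_integral_lborel_shift:
  fixes f :: "'a::euclidean_space \<Rightarrow> ennreal"
  assumes [measurable]: "f \<in> borel_measurable borel"
  shows "(\<integral>\<^sup>+x. f (a + x) \<partial>lborel) = (\<integral>\<^sup>+x. f x \<partial>lborel)"
proof -
  have "(\<integral>\<^sup>+x. f x \<partial>lborel) = (\<integral>\<^sup>+x. f x \<partial>distr lborel borel ((+) a))"
    by (simp add: lborel_distr_plus)
  also have "\<dots> = (\<integral>\<^sup>+x. f (a + x) \<partial>lborel)" by (subst nn_integral_distr) auto
  finally show ?thesis ..
qed

lemma borel_measurable_sq_dist [measurable]: "sq_dist V \<in> borel_measurable borel"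
  unfolding sq_dist_def
  by (intro borel_measurable_continuous_onI continuous_intros)

lemma nn_integral_Gamma_scaled:
  assumes "p > 0" "s > (0::real)"
  shows "(\<integral>\<^sup>+u. ennreal (indicator {0<..} u * u powr (p - 1) * exp (- (s * u))) \<partial>lborel) = ennreal (Gamma p / s powr p)"
proof -
  let ?F = "\<lambda>t. indicator {0<..} (0 + (1/s) * t) * (0 + (1/s) * t) powr (p - 1) * exp (- (s * (0 + (1/s) * t)))"
  have "(\<integral>\<^sup>+u. ennreal (indicator {0<..} u * u powr (p - 1) * exp (- (s * u))) \<partial>lborel) =
    ennreal \<bar>1/s\<bar> * (\<integral>\<^sup>+t. ennreal (?F t) \<partial>lborel)"
    using assms by (intro nn_integral_real_affine) auto
  also have "(\<integral>\<^sup>+t. ennreal (?F t) \<partial>lborel)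
     = (\<integral>\<^sup>+t. ennreal ((1 / s) powr (p - 1)) * ennreal (indicator {0..} t * t powr (p - 1) / exp t) \<partial>lborel)"
  proof (rule nn_integral_cong)
    fix t :: real
    show "ennreal (?F t) =
      ennreal ((1 / s) powr (p - 1)) * ennreal (indicator {0..} t * t powr (p - 1) / exp t)"
    proof (cases "t > 0")
      case True
      then have "((1/s) * t) powr (p - 1) = (1/s) powr (p - 1) * t powr (p - 1)"
        using assms by (intro powr_mult)
      then show ?thesis using True assms by (simp add: ennreal_mult[symmetric] exp_minus field_simps)
    next
      case False
      then show ?thesis using assms by (cases "t = 0") (auto simp: indicator_def zero_less_divide_iff)
    qed
  qed
  also have "\<dots> = ennreal ((1 / s) powr (p - 1)) * ennreal (Gamma p)"
    by (subst nn_integral_cmult) (simp_all add: Gamma_conv_nn_integral_real[OF assms(1)])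
  also have "ennreal \<bar>1/s\<bar> * (ennreal ((1 / s) powr (p - 1)) * ennreal (Gamma p)) = ennreal (Gamma p / s powr p)"
  proof -
    have "(1 / s) * ((1 / s) powr (p - 1) * Gamma p) = Gamma p / s powr p"
      using assms by (simp add: powr_divide powr_diff)
    then show ?thesis using assms Gamma_real_pos[OF assms(1)]
      by (simp add: ennreal_mult[symmetric] less_imp_le)
  qed
  finally show ?thesis .
qed

text \<open>The density of the image of one-dimensional Lebesgue measure under t -> g t^2. Each of
  the two square roots contributes 1 / (2 sqrt (g l)).\<close>

definition sq_density :: "real \<Rightarrow> real \<Rightarrow> real" where
  "sq_density g l = (if 0 < l then 1 / sqrt (g * l) else 0)"

lemma sq_density_nonneg [simp]: "0 < g \<Longrightarrow> 0 \<le> sq_density g l"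
  by (simp add: sq_density_def)

lemma borel_measurable_sq_density [measurable]: "sq_density g \<in> borel_measurable borel"
  unfolding sq_density_def by measurable

lemma emeasure_square_interval:
  assumes "g > 0" "a \<le> b"
  shows "emeasure lborel {t. a < g * t\<^sup>2 \<and> g * t\<^sup>2 < b} = ennreal (2 * (sqrt (max 0 b / g) - sqrt (max 0 a / g)))"
proof -
  define A where "A = sqrt (max 0 a / g)"
  define B where "B = sqrt (max 0 b / g)"
  have AB: "0 \<le> A" "A \<le> B" using assms by (auto simp: A_def B_def divide_right_mono)
  have nn: "0 \<le> g * t\<^sup>2" for t using assms(1) by simp
  have up: "g * t\<^sup>2 < b \<longleftrightarrow> \<bar>t\<bar> < B" for t
  proof -
    have "\<bar>t\<bar> < B \<longleftrightarrow> t\<^sup>2 < max 0 b / g"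
      unfolding B_def real_sqrt_abs[symmetric] by (rule real_sqrt_less_iff)
    also have "\<dots> \<longleftrightarrow> g * t\<^sup>2 < max 0 b" using assms(1) by (simp add: pos_less_divide_eq mult.commute)
    also have "\<dots> \<longleftrightarrow> g * t\<^sup>2 < b" using nn[of t] unfolding less_max_iff_disj by linarith
    finally show ?thesis ..
  qed
  have low: "a < g * t\<^sup>2 \<longleftrightarrow> A < \<bar>t\<bar> \<or> a < 0" for t
  proof (cases "a < 0")
    case True
    then have "a < g * t\<^sup>2" using nn[of t] by linarith
    then show ?thesis using True by simp
  next
    case False
    then have "A < \<bar>t\<bar> \<longleftrightarrow> a / g < t\<^sup>2"
      unfolding A_def real_sqrt_abs[symmetric] real_sqrt_less_iff by simp
    also have "\<dots> \<longleftrightarrow> a < g * t\<^sup>2" using assms(1) by (simp add: pos_divide_less_eq mult.commute)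
    finally show ?thesis using False by simp
  qed
  have "emeasure lborel {t. a < g * t\<^sup>2 \<and> g * t\<^sup>2 < b} = ennreal (2 * (B - A))"
  proof (cases "a < 0")
    case True
    have "{t. a < g * t\<^sup>2 \<and> g * t\<^sup>2 < b} = {- B<..<B}" unfolding up low using True by auto
    moreover have "A = 0" using True by (simp add: A_def)
    ultimately show ?thesis using AB by (simp add: ennreal_mult')
  next
    case False
    have "{t. a < g * t\<^sup>2 \<and> g * t\<^sup>2 < b} = {- B<..<- A} \<union> {A<..<B}" unfolding up low using False AB by auto
    moreover have "emeasure lborel ({- B<..<- A} \<union> {A<..<B}) = emeasure lborel {- B<..<- A} + emeasure lborel {A<..<B}"
      using AB by (intro plus_emeasure[symmetric]) auto
    ultimately show ?thesis using AB by (simp flip: ennreal_plus)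
  qed
  then show ?thesis by (simp add: A_def B_def)
qed

lemma nn_integral_sq_density_interval:
  assumes "g > 0" "a \<le> b"
  shows "(\<integral>\<^sup>+l. ennreal (sq_density g l) * indicator {a<..<b} l \<partial>lborel) =
    ennreal (2 * (sqrt (max 0 b / g) - sqrt (max 0 a / g)))"
proof -
  define A where "A = max 0 a"
  define B where "B = max 0 b"
  have AB: "0 \<le> A" "A \<le> B" using assms by (auto simp: A_def B_def)
  have "(sq_density g has_integral (2 * sqrt (B / g) - 2 * sqrt (A / g))) {A..B}"
  proof (rule fundamental_theorem_of_calculus_interior[OF AB(2)])
    show "continuous_on {A..B} (\<lambda>l. 2 * sqrt (l / g))" by (intro continuous_intros) (use assms in auto)
    fix x assume "x \<in> {A<..<B}"
    then have x: "x > 0" using AB by auto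
    have "((\<lambda>l. 2 * sqrt (l / g)) has_real_derivative 2 * (inverse (sqrt (x / g)) / 2 * (1 / g))) (at x)"
      using x assms by (auto intro!: derivative_eq_intros simp: divide_less_0_iff)
    also have "2 * (inverse (sqrt (x / g)) / 2 * (1 / g)) = sq_density g x"
    proof -
      have "sqrt (x / g) * g = sqrt (g * x)"
        using assms x by (simp add: real_sqrt_divide real_sqrt_mult field_simps flip: power2_eq_square)
      moreover have "sqrt (x / g) > 0" using x assms by simp
      ultimately show ?thesis using x assms by (simp add: sq_density_def inverse_eq_divide)
    qed
    finally show "((\<lambda>l. 2 * sqrt (l / g)) has_vector_derivative sq_density g x) (at x)"
      by (simp add: has_real_derivative_iff_has_vector_derivative)
  qed
  then have "(\<integral>\<^sup>+l. ennreal (sq_density g l) * indicator {A..B} l \<partial>lborel) = ennreal (2 * sqrt (B / g) - 2 * sqrt (A / g))"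
    by (rule nn_integral_has_integral_lebesgue'[rotated]) (use assms in auto)
  moreover have "(\<integral>\<^sup>+l. ennreal (sq_density g l) * indicator {a<..<b} l \<partial>lborel) =
      (\<integral>\<^sup>+l. ennreal (sq_density g l) * indicator {A..B} l \<partial>lborel)"
  proof (rule nn_integral_cong_AE)
    have "AE l in lborel. l \<noteq> A" "AE l in lborel. l \<noteq> B" by (rule AE_lborel_singleton)+
    then show "AE l in lborel. ennreal (sq_density g l) * indicator {a<..<b} l = ennreal (sq_density g l) * indicator {A..B} l"
      by eventually_elim (auto simp: sq_density_def indicator_def A_def B_def)
  qed
  ultimately show ?thesis by (simp add: A_def B_def algebra_simps)
qed

lemma indicator_box_cart:
  "indicator (box l u) (x :: real ^ 'n::finite) = (\<Prod>i\<in>UNIV. indicator {l $ i<..<u $ i} (x $ i) :: ennreal)"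
  by (auto simp: indicator_def mem_box_cart prod_zero_iff)

text \<open>The map is not injective, so instead of a change of variables the two measures are
  compared on boxes, where both factor into one-dimensional lengths. Boxes are stable under
  intersection and generate the Borel sets.\<close>

lemma distr_lborel_squares:
  fixes g :: "'n::finite \<Rightarrow> real"
  assumes "\<And>i. g i > 0"
  shows "distr lborel borel (\<lambda>t :: real ^ 'n. \<chi> i. g i * (t $ i)\<^sup>2) =
    density lborel (\<lambda>l. \<Prod>i\<in>UNIV. ennreal (sq_density (g i) (l $ i)))" (is "?M = ?N")
proof (rule measure_eqI_generator_eq)
  let ?E = "range (\<lambda>(a, b). box a b :: (real ^ 'n) set)"
  let ?A = "\<lambda>n::nat. box (- (real n *\<^sub>R One)) (real n *\<^sub>R One) :: (real ^ 'n) set"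
  \<comment> \<open>If some l $ i exceeds u $ i the box is empty, hence the value 0.\<close>
  let ?v = "\<lambda>l u :: real ^ 'n. \<lambda>i. if l $ i \<le> u $ i then ennreal (2 * (sqrt (max 0 (u $ i) / g i) - sqrt (max 0 (l $ i) / g i))) else 0"
  have [measurable]: "(\<lambda>t :: real ^ 'n. \<chi> i. g i * (t $ i)\<^sup>2) \<in> borel_measurable borel"
    by (intro borel_measurable_continuous_onI continuous_on_vec_lambda continuous_intros)
  have M: "emeasure ?M (box l u) = (\<Prod>i\<in>UNIV. ?v l u i)" for l u
  proof -
    have "emeasure ?M (box l u) = (\<integral>\<^sup>+x. indicator (box l u) x \<partial>?M)" by simp
    also have "\<dots> = (\<integral>\<^sup>+t. (\<Prod>i\<in>UNIV. indicator {l $ i<..<u $ i} (g i * (t $ i)\<^sup>2)) \<partial>lborel)"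
      by (subst nn_integral_distr) (auto simp: indicator_box_cart)
    also have "\<dots> = (\<Prod>i\<in>UNIV. \<integral>\<^sup>+t. indicator {l $ i<..<u $ i} (g i * t\<^sup>2) \<partial>lborel)"
      by (rule nn_integral_lborel_prod_cart) measurable
    also have "\<dots> = (\<Prod>i\<in>UNIV. ?v l u i)"
    proof (rule prod.cong[OF refl])
      fix i
      have "(\<integral>\<^sup>+t. indicator {l $ i<..<u $ i} (g i * t\<^sup>2) \<partial>lborel) = (\<integral>\<^sup>+t. indicator {t. l $ i < g i * t\<^sup>2 \<and> g i * t\<^sup>2 < u $ i} t \<partial>lborel)"
        by (intro nn_integral_cong) (auto simp: indicator_def)
      also have "\<dots> = emeasure lborel {t. l $ i < g i * t\<^sup>2 \<and> g i * t\<^sup>2 < u $ i}"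
        by (rule nn_integral_indicator) measurable
      finally show "(\<integral>\<^sup>+t. indicator {l $ i<..<u $ i} (g i * t\<^sup>2) \<partial>lborel) = ?v l u i"
        using emeasure_square_interval[OF assms, of "l $ i" "u $ i"] by auto
    qed
    finally show ?thesis .
  qed
  have N: "emeasure ?N (box l u) = (\<Prod>i\<in>UNIV. ?v l u i)" for l u
  proof -
    have "emeasure ?N (box l u) = (\<integral>\<^sup>+x. (\<Prod>i\<in>UNIV. ennreal (sq_density (g i) (x $ i)) * indicator {l $ i<..<u $ i} (x $ i)) \<partial>lborel)"
      by (subst emeasure_density) (auto simp: indicator_box_cart prod.distrib)
    also have "\<dots> = (\<Prod>i\<in>UNIV. \<integral>\<^sup>+t. ennreal (sq_density (g i) t) * indicator {l $ i<..<u $ i} t \<partial>lborel)"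
      by (rule nn_integral_lborel_prod_cart) measurable
    also have "\<dots> = (\<Prod>i\<in>UNIV. ?v l u i)"
      by (rule prod.cong[OF refl]) (auto simp: nn_integral_sq_density_interval[OF assms])
    finally show ?thesis .
  qed
  show "Int_stable ?E" by (auto simp: Int_stable_def box_Int_box)
  show "?E \<subseteq> Pow UNIV" "sets ?M = sigma_sets UNIV ?E" "sets ?N = sigma_sets UNIV ?E"
    by (simp_all add: borel_eq_box)
  show "range ?A \<subseteq> ?E" "(\<Union>i. ?A i) = UNIV" unfolding UN_box_eq_UNIV by auto
  show "emeasure ?M (?A i) \<noteq> \<infinity>" for i unfolding M by (simp add: ennreal_prod_eq_top)
  show "emeasure ?M X = emeasure ?N X" if "X \<in> ?E" for X using that M N by auto
qed

text \<open>The product of the \<open>sq_density\<close> factors is, up to a constant, the Jeffreys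
  prior on the positive orthant; so the prior turns into Lebesgue measure on the whole
  space.\<close>

lemma nn_integral_squares:
  fixes g :: "'n::finite \<Rightarrow> real" and F :: "real ^ 'n \<Rightarrow> ennreal"
  assumes "\<And>i. g i > 0" and [measurable]: "F \<in> borel_measurable borel"
  shows "(\<integral>\<^sup>+l. F l * (\<Prod>i\<in>UNIV. ennreal (sq_density (g i) (l $ i))) \<partial>lborel) =
    (\<integral>\<^sup>+t. F (\<chi> i. g i * (t $ i)\<^sup>2) \<partial>lborel)"
proof -
  have [measurable]: "(\<lambda>t :: real ^ 'n. \<chi> i. g i * (t $ i)\<^sup>2) \<in> borel_measurable borel"
    by (intro borel_measurable_continuous_onI continuous_on_vec_lambda continuous_intros)
  have "(\<integral>\<^sup>+t. F (\<chi> i. g i * (t $ i)\<^sup>2) \<partial>lborel) =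
      (\<integral>\<^sup>+l. F l \<partial>distr lborel borel (\<lambda>t :: real ^ 'n. \<chi> i. g i * (t $ i)\<^sup>2))"
    by (subst nn_integral_distr) auto
  also have "\<dots> = (\<integral>\<^sup>+l. F l * (\<Prod>i\<in>UNIV. ennreal (sq_density (g i) (l $ i))) \<partial>lborel)"
    unfolding distr_lborel_squares[OF assms(1)] by (subst nn_integral_density) (auto simp: mult.commute)
  finally show ?thesis ..
qed

lemma nn_integral_lborel_vec1:
  assumes [measurable]: "f \<in> borel_measurable borel"
  shows "(\<integral>\<^sup>+x. f (x $ 1) \<partial>(lborel :: (real ^ 1) measure)) = (\<integral>\<^sup>+t. f t \<partial>lborel)"
  using nn_integral_lborel_prod_cart[of "\<lambda>_::1. f"] by simp

lemma nn_integral_square: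
  assumes "g > 0" and [measurable]: "F \<in> borel_measurable borel"
  shows "(\<integral>\<^sup>+l. F l * ennreal (sq_density g l) \<partial>lborel) = (\<integral>\<^sup>+t. F (g * t\<^sup>2) \<partial>lborel)"
  using nn_integral_squares[of "\<lambda>_::1. g" "\<lambda>x. F (x $ 1)"] assms(1)
  by (simp add: nn_integral_lborel_vec1[of "\<lambda>l. F l * ennreal (sq_density g l)"]
      nn_integral_lborel_vec1[of "\<lambda>t. F (g * t\<^sup>2)"])

text \<open>The substitution l = t^2 gives the Gamma integral with exponent x + 1/2.\<close>

lemma nn_integral_even_moment:
  assumes "a > 0"
  shows "(\<integral>\<^sup>+t. ennreal (t ^ (2 * x) * exp (- (a * t\<^sup>2))) \<partial>lborel) =
    ennreal (Gamma (real x + 1 / 2) / a powr (real x + 1 / 2))"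
proof -
  have "(\<integral>\<^sup>+t. ennreal (t ^ (2 * x) * exp (- (a * t\<^sup>2))) \<partial>lborel) =
     (\<integral>\<^sup>+t. ennreal ((1 * t\<^sup>2) ^ x * exp (- (a * (1 * t\<^sup>2)))) \<partial>lborel)"
    by (simp add: power_mult)
  also have "\<dots> = (\<integral>\<^sup>+l. ennreal (l ^ x * exp (- (a * l))) * ennreal (sq_density 1 l) \<partial>lborel)"
    by (rule nn_integral_square[symmetric]) auto
  also have "\<dots> = (\<integral>\<^sup>+l. ennreal (indicator {0<..} l * l powr (real x + 1 / 2 - 1) * exp (- (a * l))) \<partial>lborel)"
  proof (rule nn_integral_cong)
    fix l :: real
    show "ennreal (l ^ x * exp (- (a * l))) * ennreal (sq_density 1 l) =
        ennreal (indicator {0<..} l * l powr (real x + 1 / 2 - 1) * exp (- (a * l)))"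
    proof (cases "l > 0")
      case True
      have "l powr (real x + 1 / 2 - 1) = l powr real x / l powr (1 / 2)"
        by (simp flip: powr_diff)
      also have "\<dots> = l ^ x / sqrt l" using True by (simp add: powr_realpow powr_half_sqrt)
      finally show ?thesis using True by (simp add: sq_density_def flip: ennreal_mult)
    qed (simp add: sq_density_def)
  qed
  also have "\<dots> = ennreal (Gamma (real x + 1 / 2) / a powr (real x + 1 / 2))"
    by (rule nn_integral_Gamma_scaled) (use assms in auto)
  finally show ?thesis .
qed

section \<open>Gaussian integrals and rotations\<close>

lemma nn_integral_gaussian:
  assumes "a > 0"
  shows "(\<integral>\<^sup>+t. ennreal (exp (- (a * t\<^sup>2))) \<partial>lborel) = ennreal (sqrt (pi / a))"
  using nn_integral_even_moment[OF assms, of 0] assms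
  by (simp add: Gamma_one_half_real powr_half_sqrt real_sqrt_divide)

lemma norm_power2_cart: "(norm (x :: real ^ 'n::finite))\<^sup>2 = (\<Sum>i\<in>UNIV. (x $ i)\<^sup>2)"
  unfolding power2_norm_eq_inner inner_vec_def by (simp add: power2_eq_square)

abbreviation gauss :: "real \<Rightarrow> 'a::real_normed_vector \<Rightarrow> ennreal" where
  "gauss c x \<equiv> ennreal (exp (- (c * (norm x)\<^sup>2)))"

lemma exp_norm_power2_cart:
  "gauss c (x :: real ^ 'n::finite) = (\<Prod>i\<in>UNIV. ennreal (exp (- (c * (x $ i)\<^sup>2))))"
  by (simp add: norm_power2_cart prod_ennreal sum_distrib_left exp_sum flip: sum_negf)

lemma nn_integral_gaussian_cart:
  assumes "a > 0"
  shows "(\<integral>\<^sup>+x. gauss a x \<partial>(lborel :: (real ^ 'n::finite) measure)) =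
    ennreal (sqrt (pi / a) ^ CARD('n))"
  unfolding exp_norm_power2_cart
  by (subst nn_integral_lborel_prod_cart) (use assms in \<open>simp_all add: nn_integral_gaussian ennreal_power\<close>)

text \<open>No Jacobian is computed. Weighting with the rotation-invariant \<open>G\<close> of total
  mass \<open>C\<close> and applying Fubini reduces the claim to shift invariance; in the end the
  finite nonzero \<open>C\<close> is cancelled.\<close>

lemma nn_integral_lborel_orthogonal:
  fixes f :: "real ^ 'n::finite \<Rightarrow> ennreal" and T :: "real ^ 'n \<Rightarrow> real ^ 'n"
  assumes [measurable]: "f \<in> borel_measurable borel" and T: "orthogonal_transformation T"
  shows "(\<integral>\<^sup>+x. f (T x) \<partial>lborel) = (\<integral>\<^sup>+x. f x \<partial>lborel)"
proof -
  have lin: "linear T" using T orthogonal_transformation_linear by blast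
  have bij: "bij T" using T orthogonal_transformation_bij by blast
  have [measurable]: "T \<in> borel_measurable borel"
    by (intro borel_measurable_continuous_onI linear_continuous_on) (use lin linear_conv_bounded_linear in blast)
  define G :: "real ^ 'n \<Rightarrow> ennreal" where "G x = gauss 1 x" for x
  have [measurable]: "G \<in> borel_measurable borel" unfolding G_def by measurable
  have GT: "G (T x) = G x" for x using T by (simp add: G_def orthogonal_transformation_norm)
  have G_minus: "G (- x) = G x" for x by (simp add: G_def)
  define C where "C = (\<integral>\<^sup>+x. G x \<partial>lborel)"
  have C: "C \<noteq> 0" "C \<noteq> \<infinity>" unfolding C_def G_def by (subst nn_integral_gaussian_cart; simp)+
  have "C * (\<integral>\<^sup>+x. f (T x) \<partial>lborel) = (\<integral>\<^sup>+x. f (T x) * C \<partial>lborel)"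
    by (subst nn_integral_multc) (auto simp: mult.commute)
  also have "\<dots> = (\<integral>\<^sup>+x. \<integral>\<^sup>+y. f (T x) * G (- T x + y) \<partial>lborel \<partial>lborel)"
  proof (rule nn_integral_cong)
    fix x
    have "C = (\<integral>\<^sup>+y. G (- T x + y) \<partial>lborel)"
      unfolding C_def by (rule nn_integral_lborel_shift[symmetric]) measurable
    then show "f (T x) * C = (\<integral>\<^sup>+y. f (T x) * G (- T x + y) \<partial>lborel)"
      by (subst nn_integral_cmult) simp_all
  qed
  also have "\<dots> = (\<integral>\<^sup>+y. \<integral>\<^sup>+x. f (T x) * G (- T x + y) \<partial>lborel \<partial>lborel)"
    by (rule lborel_pair.Fubini') measurable
  also have "\<dots> = (\<integral>\<^sup>+y. \<integral>\<^sup>+x. f (T x + y) * G x \<partial>lborel \<partial>lborel)"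
  proof (rule nn_integral_cong)
    fix y
    \<comment> \<open>Writing the outer variable as an image under \<open>T\<close> turns a shift of
      the inner variable by z into a shift by y inside \<open>f\<close>, and leaves only the
      rotation-invariant weight elsewhere.\<close>
    obtain z where z: "y = T z" using bij by (metis bij_pointE)
    have "(\<integral>\<^sup>+x. f (T x) * G (- T x + y) \<partial>lborel) = (\<integral>\<^sup>+x. f (T (z + x)) * G (- T (z + x) + y) \<partial>lborel)"
      by (rule nn_integral_lborel_shift[symmetric]) measurable
    also have "\<dots> = (\<integral>\<^sup>+x. f (T x + y) * G x \<partial>lborel)"
      by (simp add: z linear_add[OF lin] G_minus GT add.commute)
    finally show "(\<integral>\<^sup>+x. f (T x) * G (- T x + y) \<partial>lborel) = (\<integral>\<^sup>+x. f (T x + y) * G x \<partial>lborel)" .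
  qed
  also have "\<dots> = (\<integral>\<^sup>+x. \<integral>\<^sup>+y. f (T x + y) * G x \<partial>lborel \<partial>lborel)"
    by (rule lborel_pair.Fubini') measurable
  also have "\<dots> = (\<integral>\<^sup>+x. (\<integral>\<^sup>+y. f y \<partial>lborel) * G x \<partial>lborel)"
    by (subst nn_integral_multc) (auto simp: nn_integral_lborel_shift)
  also have "\<dots> = C * (\<integral>\<^sup>+y. f y \<partial>lborel)"
    by (subst nn_integral_cmult) (auto simp: C_def mult.commute)
  finally show ?thesis using C by (simp add: ennreal_mult_cancel_left)
qed

text \<open>Completing the square. The precision u of the first factor drops to u c / (c + u), the
  reciprocal of 1 / u + 1 / c, as variances add.\<close>

lemma nn_integral_gaussian_shifted:
  assumes "c > 0" "u \<ge> 0"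
  shows "(\<integral>\<^sup>+w. ennreal (exp (- (u * (a + w)\<^sup>2 + c * w\<^sup>2))) \<partial>lborel) =
    ennreal (sqrt (pi / c) * sqrt (c / (c + u)) * exp (- (u * c / (c + u) * a\<^sup>2)))"
proof -
  have cu: "c + u > 0" using assms by simp
  have sq: "u * (a + w)\<^sup>2 + c * w\<^sup>2 = (c + u) * (u * a / (c + u) + w)\<^sup>2 + u * c / (c + u) * a\<^sup>2" for w
  proof -
    define r where "r = u * a / (c + u)"
    have r: "r * (c + u) = u * a" using cu by (simp add: r_def)
    have "u * c / (c + u) * a\<^sup>2 = c * a * r" by (simp add: r_def power2_eq_square)
    moreover have "u * (a + w)\<^sup>2 + c * w\<^sup>2 = (c + u) * (r + w)\<^sup>2 + c * a * r" using r by algebra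
    ultimately show ?thesis unfolding r_def by (simp only:)
  qed
  have "(\<integral>\<^sup>+w. ennreal (exp (- (u * (a + w)\<^sup>2 + c * w\<^sup>2))) \<partial>lborel) =
    (\<integral>\<^sup>+w. ennreal (exp (- ((c + u) * (u * a / (c + u) + w)\<^sup>2))) * ennreal (exp (- (u * c / (c + u) * a\<^sup>2))) \<partial>lborel)"
    unfolding sq by (simp add: exp_add[symmetric] flip: ennreal_mult)
  also have "\<dots> = (\<integral>\<^sup>+w. ennreal (exp (- ((c + u) * (u * a / (c + u) + w)\<^sup>2))) \<partial>lborel) * ennreal (exp (- (u * c / (c + u) * a\<^sup>2)))"
    by (rule nn_integral_multc) simp
  also have "(\<integral>\<^sup>+w. ennreal (exp (- ((c + u) * (u * a / (c + u) + w)\<^sup>2))) \<partial>lborel) =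
      (\<integral>\<^sup>+w. ennreal (exp (- ((c + u) * w\<^sup>2))) \<partial>lborel)"
    by (rule nn_integral_lborel_shift[where f = "\<lambda>w. ennreal (exp (- ((c + u) * w\<^sup>2)))"]) simp
  also have "\<dots> = ennreal (sqrt (pi / (c + u)))" by (rule nn_integral_gaussian[OF cu])
  also have "sqrt (pi / (c + u)) = sqrt (pi / c) * sqrt (c / (c + u))"
    using assms by (simp flip: real_sqrt_mult)
  finally show ?thesis using assms by (simp add: ennreal_mult[symmetric])
qed

text \<open>After a rotation the integral factors. Only the coordinates orthogonal to
  \<open>V\<close> feel u, and each contributes one factor sqrt (c / (c + u)), so the exponent is
  the codimension.\<close>

lemma nn_integral_gaussian_sq_dist:
  fixes V :: "(real ^ 'n::finite) set"
  assumes "subspace V" "c > 0" "u \<ge> 0"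
  shows "(\<integral>\<^sup>+w. ennreal (exp (- (u * sq_dist V (p + w)))) * gauss c w \<partial>lborel) =
    ennreal (sqrt (pi / c) ^ CARD('n) * sqrt (c / (c + u)) ^ (CARD('n) - dim V) * exp (- (u * c / (c + u) * sq_dist V p)))"
proof -
  obtain T :: "real ^ 'n \<Rightarrow> real ^ 'n" and I where T: "orthogonal_transformation T" and I: "card I + dim V = CARD('n)"
    and s: "\<And>v. sq_dist V (T v) = (\<Sum>i\<in>I. (v $ i)\<^sup>2)"
    using subspace_orthogonal_coordinates[OF assms(1)] by blast
  have cI: "CARD('n) - dim V = card I" using I by linarith
  obtain q where q: "p = T q" using orthogonal_transformation_bij[OF T] by (metis bij_pointE)
  have lin: "linear T" using T orthogonal_transformation_linear by blast
  let ?f = "\<lambda>i w. ennreal (exp (- ((if i \<in> I then u else 0) * (q $ i + w)\<^sup>2 + c * w\<^sup>2)))"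
  have "(\<integral>\<^sup>+w. ennreal (exp (- (u * sq_dist V (p + w)))) * gauss c w \<partial>lborel) =
    (\<integral>\<^sup>+w. ennreal (exp (- (u * sq_dist V (p + T w)))) * gauss c (T w) \<partial>lborel)"
    by (rule nn_integral_lborel_orthogonal[OF _ T, symmetric]) measurable
  also have "\<dots> = (\<integral>\<^sup>+w. (\<Prod>i\<in>UNIV. ?f i (w $ i)) \<partial>lborel)"
  proof (rule nn_integral_cong)
    fix w :: "real ^ 'n"
    have "u * sq_dist V (p + T w) = (\<Sum>i\<in>UNIV. (if i \<in> I then u else 0) * (q $ i + w $ i)\<^sup>2)"
      unfolding q linear_add[OF lin, symmetric] s
      by (simp add: sum_distrib_left if_distrib[of "\<lambda>u. u * _"] sum.If_cases cong: if_cong)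
    moreover have "c * (norm (T w))\<^sup>2 = (\<Sum>i\<in>UNIV. c * (w $ i)\<^sup>2)"
      using T by (simp add: orthogonal_transformation_norm norm_power2_cart sum_distrib_left)
    ultimately have "ennreal (exp (- (u * sq_dist V (p + T w)))) * gauss c (T w) =
       ennreal (exp (\<Sum>i\<in>UNIV. - ((if i \<in> I then u else 0) * (q $ i + w $ i)\<^sup>2 + c * (w $ i)\<^sup>2)))"
      by (simp add: sum_negf sum_subtractf flip: ennreal_mult exp_add)
    then show "ennreal (exp (- (u * sq_dist V (p + T w)))) * gauss c (T w) = (\<Prod>i\<in>UNIV. ?f i (w $ i))"
      by (simp add: exp_sum prod_ennreal)
  qed
  also have "\<dots> = (\<Prod>i\<in>UNIV. \<integral>\<^sup>+t. ?f i t \<partial>lborel)"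
    by (rule nn_integral_lborel_prod_cart) measurable
  also have "\<dots> = (\<Prod>i\<in>UNIV. ennreal (sqrt (pi / c) * (if i \<in> I then sqrt (c / (c + u)) * exp (- (u * c / (c + u) * (q $ i)\<^sup>2)) else 1)))"
    by (rule prod.cong[OF refl], subst nn_integral_gaussian_shifted) (use assms in auto)
  also have "\<dots> = ennreal (\<Prod>i\<in>UNIV. sqrt (pi / c) * (if i \<in> I then sqrt (c / (c + u)) * exp (- (u * c / (c + u) * (q $ i)\<^sup>2)) else 1))"
    using assms by (intro prod_ennreal) auto
  also have "(\<Prod>i\<in>UNIV. sqrt (pi / c) * (if i \<in> I then sqrt (c / (c + u)) * exp (- (u * c / (c + u) * (q $ i)\<^sup>2)) else 1))
     = sqrt (pi / c) ^ CARD('n) * (\<Prod>i\<in>I. sqrt (c / (c + u)) * exp (- (u * c / (c + u) * (q $ i)\<^sup>2)))"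
    by (simp add: prod.distrib prod.If_cases)
  also have "(\<Prod>i\<in>I. sqrt (c / (c + u)) * exp (- (u * c / (c + u) * (q $ i)\<^sup>2))) =
      sqrt (c / (c + u)) ^ card I * exp (- (u * c / (c + u) * sq_dist V p))"
    unfolding q s by (simp add: prod.distrib sum_distrib_left exp_sum flip: sum_negf)
  finally show ?thesis unfolding cI by (simp only: mult.assoc)
qed

section \<open>Gaussian smoothing of powers of distances to subspaces\<close>

text \<open>The Gamma integral cut off at c; over the whole half-line it would be
  \<open>Gamma \<alpha> / s powr \<alpha>\<close>.\<close>

definition trunc_gamma :: "real \<Rightarrow> real \<Rightarrow> real \<Rightarrow> ennreal" where
  "trunc_gamma c \<alpha> s = (\<integral>\<^sup>+v. ennreal (indicator {0<..<c} v * v powr (\<alpha> - 1) * exp (- (s * v))) \<partial>lborel)"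

lemma nn_integral_powr_interval:
  assumes "\<alpha> > 0" "c > 0"
  shows "(\<integral>\<^sup>+v. ennreal (indicator {0<..<c} v * v powr (\<alpha> - 1)) \<partial>lborel) \<le> ennreal (c powr \<alpha> / \<alpha>)"
proof -
  have "((\<lambda>x. x powr (\<alpha> - 1)) has_integral (c powr (\<alpha> - 1 + 1) / (\<alpha> - 1 + 1))) {0..c}"
    by (rule has_integral_powr_from_0) (use assms in auto)
  then have "(\<integral>\<^sup>+v. ennreal (v powr (\<alpha> - 1)) * indicator {0..c} v \<partial>lborel) = ennreal (c powr \<alpha> / \<alpha>)"
    by (intro nn_integral_has_integral_lebesgue') auto
  moreover have "(\<integral>\<^sup>+v. ennreal (indicator {0<..<c} v * v powr (\<alpha> - 1)) \<partial>lborel) \<le>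
      (\<integral>\<^sup>+v. ennreal (v powr (\<alpha> - 1)) * indicator {0..c} v \<partial>lborel)"
    by (intro nn_integral_mono) (auto simp: indicator_def)
  ultimately show ?thesis by simp
qed

text \<open>The cut-off keeps the integral finite even at s = 0, where the full one diverges. So
  Gaussian averages of the powers of the distance stay finite on the subspace itself.\<close>

lemma trunc_gamma_finite:
  assumes "\<alpha> > 0" "c > 0" "s \<ge> 0"
  shows "trunc_gamma c \<alpha> s < \<infinity>"
proof -
  have "trunc_gamma c \<alpha> s \<le> (\<integral>\<^sup>+v. ennreal (indicator {0<..<c} v * v powr (\<alpha> - 1)) \<partial>lborel)"
    unfolding trunc_gamma_def
  proof (intro nn_integral_mono ennreal_leI)
    fix v :: real
    show "indicator {0<..<c} v * v powr (\<alpha> - 1) * exp (- (s * v)) \<le> indicator {0<..<c} v * v powr (\<alpha> - 1)"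
      using assms by (auto simp: indicator_def mult_left_le)
  qed
  also have "\<dots> < \<infinity>" using nn_integral_powr_interval[OF assms(1,2)] by (simp add: le_less_trans)
  finally show ?thesis .
qed

text \<open>The missing piece over [c, infinity) has positive mass, since the integrand is positive
  on [c, c + 1]. All strictness in the domination result originates here.\<close>

lemma trunc_gamma_less:
  assumes "\<alpha> > 0" "c > 0" "s > 0"
  shows "trunc_gamma c \<alpha> s < ennreal (Gamma \<alpha> / s powr \<alpha>)"
proof -
  let ?k = "\<lambda>v. v powr (\<alpha> - 1) * exp (- (s * v))"
  define D where "D = (\<integral>\<^sup>+v. ennreal (indicator {c..} v * ?k v) \<partial>lborel)"
  have "ennreal (Gamma \<alpha> / s powr \<alpha>) = (\<integral>\<^sup>+u. ennreal (indicator {0<..} u * u powr (\<alpha> - 1) * exp (- (s * u))) \<partial>lborel)"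
    by (rule nn_integral_Gamma_scaled[symmetric]) (use assms in auto)
  also have "\<dots> = (\<integral>\<^sup>+v. ennreal (indicator {0<..<c} v * v powr (\<alpha> - 1) * exp (- (s * v))) + ennreal (indicator {c..} v * ?k v) \<partial>lborel)"
    by (intro nn_integral_cong) (use assms in \<open>auto simp: indicator_def\<close>)
  also have "\<dots> = trunc_gamma c \<alpha> s + D"
    unfolding trunc_gamma_def D_def by (rule nn_integral_add) auto
  finally have eq: "ennreal (Gamma \<alpha> / s powr \<alpha>) = trunc_gamma c \<alpha> s + D" .
  have "D \<noteq> 0"
  proof
    assume "D = 0"
    then have "AE v in lborel. ennreal (indicator {c..} v * ?k v) = 0"
      unfolding D_def by (subst (asm) nn_integral_0_iff_AE) auto
    then have "AE v in lborel. \<not> v \<in> {c..c + 1}"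
    proof (rule AE_mp, intro AE_I2 impI notI)
      fix v assume "ennreal (indicator {c..} v * ?k v) = 0" "v \<in> {c..c + 1}"
      moreover have "?k v > 0" using \<open>v \<in> {c..c + 1}\<close> assms by simp
      ultimately show False by simp
    qed
    then have "emeasure lborel {c..c + 1} = 0"
      by (subst (asm) AE_iff_measurable[of "{c..c + 1}"]) auto
    then show False by simp
  qed
  then show ?thesis using trunc_gamma_finite[of \<alpha> c s] assms unfolding eq
    using ennreal_add_left_cancel_less[of "trunc_gamma c \<alpha> s" 0 D] by (simp add: zero_less_iff_neq_zero)
qed

text \<open>The map u -> v = u c / (c + u) sends the half-line onto (0, c) with dv = (c / (c + u))^2
  du. Together with the power \<alpha> - 1 of v this yields the exponent \<alpha> + 1.\<close>

lemma nn_integral_shrink_substitution: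
  assumes "\<alpha> > 0" "c > 0" "s \<ge> 0"
  shows "(\<integral>\<^sup>+u. ennreal (indicator {0<..} u * (u powr (\<alpha> - 1) * (c / (c + u)) powr (\<alpha> + 1) * exp (- (u * c / (c + u) * s)))) \<partial>lborel)
    = trunc_gamma c \<alpha> s"
proof -
  let ?J = "\<lambda>u. u powr (\<alpha> - 1) * (c / (c + u)) powr (\<alpha> + 1) * exp (- (u * c / (c + u) * s))"
  let ?k = "\<lambda>v. v powr (\<alpha> - 1) * exp (- (s * v))"
  let ?g = "\<lambda>u. u * c / (c + u)"
  let ?g' = "\<lambda>u. (c / (c + u))\<^sup>2"
  have img: "?g ` {0<..} = {0<..<c}"
  proof (intro set_eqI iffI)
    fix v assume "v \<in> ?g ` {0<..}"
    then obtain u where "u > 0" "v = ?g u" by auto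
    then show "v \<in> {0<..<c}" using assms by (auto simp: pos_divide_less_eq algebra_simps)
  next
    fix v assume v: "v \<in> {0<..<c}"
    then have "v = ?g (v * c / (c - v))" "v * c / (c - v) > 0" using assms by (auto simp: field_simps)
    then show "v \<in> ?g ` {0<..}" by blast
  qed
  obtain I where I: "trunc_gamma c \<alpha> s = ennreal I" "I \<ge> 0"
    using trunc_gamma_finite[OF assms] by (cases "trunc_gamma c \<alpha> s") auto
  have k: "((\<lambda>v. indicator {0<..<c} v * ?k v) has_integral I) UNIV"
    using I unfolding trunc_gamma_def by (intro nn_integral_has_integral) (auto simp: mult.assoc)
  then have k': "(?k has_integral I) {0<..<c}"
    by (subst has_integral_restrict_UNIV[symmetric]) (auto elim!: has_integral_eq[rotated] simp: indicator_def)
  then have "?k absolutely_integrable_on {0<..<c}"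
    by (intro nonnegative_absolutely_integrable_1) (auto simp: integrable_on_def)
  then have "?k absolutely_integrable_on ?g ` {0<..} \<and> integral (?g ` {0<..}) ?k = I"
    unfolding img using k' by (simp add: integral_unique)
  moreover have der: "(?g has_real_derivative ?g' u) (at u within {0<..})" if "u \<in> {0<..}" for u
  proof (rule has_field_derivative_at_within)
    have "c + u \<noteq> 0" using assms that by simp
    then show "(?g has_real_derivative ?g' u) (at u)"
      by (auto intro!: derivative_eq_intros simp: power2_eq_square field_simps)
  qed
  moreover have inj: "inj_on ?g {0<..}"
  proof (rule inj_onI)
    fix x y assume "x \<in> {0<..}" "y \<in> {0<..}" and e: "?g x = ?g y"
    then have "c + x \<noteq> 0" "c + y \<noteq> 0" using assms by auto
    with e have "c * c * x = c * c * y" by (simp add: field_simps)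
    then show "x = y" using assms by simp
  qed
  ultimately have "(\<lambda>x. \<bar>?g' x\<bar> * ?k (?g x)) absolutely_integrable_on {0<..} \<and>
      integral {0<..} (\<lambda>x. \<bar>?g' x\<bar> * ?k (?g x)) = I"
    using has_absolute_integral_change_of_variables_1'[of "{0<..}" ?g ?g' ?k I] by simp
  then have "((\<lambda>x. \<bar>?g' x\<bar> * ?k (?g x)) has_integral I) {0<..}"
    by (auto intro: set_lebesgue_integral_eq_integral(1) simp: has_integral_iff)
  then have "(\<integral>\<^sup>+u. ennreal (\<bar>?g' u\<bar> * ?k (?g u)) * indicator {0<..} u \<partial>lborel) = ennreal I"
    by (intro nn_integral_has_integral_lebesgue') auto
  moreover have "(\<integral>\<^sup>+u. ennreal (indicator {0<..} u * ?J u) \<partial>lborel)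
      = (\<integral>\<^sup>+u. ennreal (\<bar>?g' u\<bar> * ?k (?g u)) * indicator {0<..} u \<partial>lborel)"
  proof (rule nn_integral_cong)
    fix u :: real
    show "ennreal (indicator {0<..} u * ?J u) =
        ennreal (\<bar>?g' u\<bar> * ?k (?g u)) * indicator {0<..} u"
    proof (cases "u > 0")
      case True
      then have q: "c / (c + u) > 0" using assms by simp
      have "?g u powr (\<alpha> - 1) = u powr (\<alpha> - 1) * (c / (c + u)) powr (\<alpha> - 1)"
        using q True by (simp flip: powr_mult)
      moreover have "(c / (c + u)) powr (\<alpha> + 1) = (c / (c + u)) powr (\<alpha> - 1) * ?g' u"
      proof -
        have "(c / (c + u)) powr (\<alpha> - 1 + real 2) = (c / (c + u)) powr (\<alpha> - 1) * (c / (c + u)) powr real 2"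
          by (rule powr_add)
        then show ?thesis unfolding powr_realpow[OF q] by (simp add: add.commute)
      qed
      ultimately show ?thesis using True by (simp add: mult_ac)
    qed simp
  qed
  ultimately show ?thesis using I by simp
qed

text \<open>Here \<open>2 * \<alpha> + 2 \<le> codim V\<close> enters: the Gaussian average of \<open>exp (- u * sq_dist V p)\<close> carries
  the factor \<open>(c / (c + u)) powr (codim V / 2)\<close>, whereas \<open>(c / (c + u)) powr (\<alpha> + 1)\<close> is what the
  substitution \<open>v = u * c / (c + u)\<close> turns into a truncated Gamma integral.\<close>
lemma gaussian_smoothing_le:
  fixes V :: "(real ^ 'n::finite) set"
  assumes V: "subspace V" and c: "c > 0" and \<alpha>: "\<alpha> > 0" "\<alpha> \<le> (real CARD('n) - real (dim V) - 2) / 2"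
  shows "(\<integral>\<^sup>+w. ennreal (sq_dist V (p + w) powr (- \<alpha>)) * gauss c w \<partial>lborel) \<le>
    ennreal (sqrt (pi / c) ^ CARD('n) / Gamma \<alpha>) * trunc_gamma c \<alpha> (sq_dist V p)"
proof -
  let ?G = "\<lambda>w. \<integral>\<^sup>+u. ennreal (indicator {0<..} u * u powr (\<alpha> - 1) * exp (- (sq_dist V (p + w) * u))) \<partial>lborel"
  let ?X = "\<lambda>u. exp (- (u * c / (c + u) * sq_dist V p))"
  let ?A = "\<lambda>u. ennreal (indicator {0<..} u * u powr (\<alpha> - 1))"
  let ?E = "\<lambda>u w. ennreal (exp (- (u * sq_dist V (p + w)))) * gauss c w"
  have s0: "sq_dist V x \<ge> 0" for x by (simp add: sq_dist_def)
  let ?K = "sqrt (pi / c) ^ CARD('n)"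
  let ?m = "CARD('n) - dim V"
  have m: "real ?m \<ge> 2 * \<alpha> + 2"
    using \<alpha> dim_subset_UNIV[of V] by (simp add: of_nat_diff)
  \<comment> \<open>Only an inequality: at distance 0 the left side is 0 because
    \<open>0 powr _ = 0\<close>, whereas the integral diverges.\<close>
  have le: "ennreal (sq_dist V x powr (- \<alpha>)) \<le> ennreal (1 / Gamma \<alpha>) *
      (\<integral>\<^sup>+u. ennreal (indicator {0<..} u * u powr (\<alpha> - 1) * exp (- (sq_dist V x * u))) \<partial>lborel)" for x
  proof (cases "sq_dist V x > 0")
    case True
    have "1 / Gamma \<alpha> * (Gamma \<alpha> / sq_dist V x powr \<alpha>) = sq_dist V x powr (- \<alpha>)"
      using Gamma_real_pos[OF \<alpha>(1)] by (simp add: powr_minus field_simps)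
    then show ?thesis using True Gamma_real_pos[OF \<alpha>(1)]
      by (subst nn_integral_Gamma_scaled[OF \<alpha>(1)]) (simp_all add: ennreal_mult[symmetric] less_imp_le)
  next
    case False
    then have "sq_dist V x = 0" using s0[of x] by simp
    then show ?thesis by simp
  qed
  have "(\<integral>\<^sup>+w. ennreal (sq_dist V (p + w) powr (- \<alpha>)) * gauss c w \<partial>lborel) \<le>
    (\<integral>\<^sup>+w. (ennreal (1 / Gamma \<alpha>) *
      ?G w) * gauss c w \<partial>lborel)"
    by (intro nn_integral_mono mult_right_mono le) auto
  also have "\<dots> = ennreal (1 / Gamma \<alpha>) * (\<integral>\<^sup>+w. (\<integral>\<^sup>+u. ?A u *
      ?E u w \<partial>lborel) \<partial>lborel)"
  proof -
    have "ennreal (1 / Gamma \<alpha>) * ?G w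
        * gauss c w =
      ennreal (1 / Gamma \<alpha>) * (\<integral>\<^sup>+u. ?A u *
        ?E u w \<partial>lborel)" for w
      unfolding mult.assoc by (subst nn_integral_multc[symmetric]) (simp_all add: ennreal_mult'' mult_ac)
    then have "(\<integral>\<^sup>+w. ennreal (1 / Gamma \<alpha>) * ?G w
        * gauss c w \<partial>lborel) =
      (\<integral>\<^sup>+w. ennreal (1 / Gamma \<alpha>) * (\<integral>\<^sup>+u. ?A u *
        ?E u w \<partial>lborel) \<partial>lborel)"
      by (simp only:)
    also have "\<dots> = ennreal (1 / Gamma \<alpha>) * (\<integral>\<^sup>+w. (\<integral>\<^sup>+u. ?A u *
        ?E u w \<partial>lborel) \<partial>lborel)"
      by (rule nn_integral_cmult) measurable
    finally show ?thesis .
  qed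
  also have "(\<integral>\<^sup>+w. (\<integral>\<^sup>+u. ?A u *
      ?E u w \<partial>lborel) \<partial>lborel) =
     (\<integral>\<^sup>+u. (\<integral>\<^sup>+w. ?A u *
      ?E u w \<partial>lborel) \<partial>lborel)"
    by (rule lborel_pair.Fubini') measurable
  also have "\<dots> = (\<integral>\<^sup>+u. ?A u *
      ennreal (?K * sqrt (c / (c + u)) ^ ?m * ?X u) \<partial>lborel)"
  proof (rule nn_integral_cong)
    fix u :: real
    show "(\<integral>\<^sup>+w. ?A u *
      ?E u w \<partial>lborel) =
      ?A u *
      ennreal (?K * sqrt (c / (c + u)) ^ ?m * ?X u)"
      using nn_integral_gaussian_sq_dist[OF V c, of u p]
      by (cases "u > 0") (simp_all add: nn_integral_cmult)
  qed
  also have "\<dots> \<le> (\<integral>\<^sup>+u. ennreal ?K * ennreal (indicator {0<..} u * (u powr (\<alpha> - 1) * (c / (c + u)) powr (\<alpha> + 1) * ?X u)) \<partial>lborel)"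
  proof (rule nn_integral_mono)
    fix u :: real
    show "?A u *
      ennreal (?K * sqrt (c / (c + u)) ^ ?m * ?X u) \<le>
      ennreal ?K * ennreal (indicator {0<..} u * (u powr (\<alpha> - 1) * (c / (c + u)) powr (\<alpha> + 1) * ?X u))"
    proof (cases "u > 0")
      case True
      define q where "q = c / (c + u)"
      have q: "0 < q" "q \<le> 1" using True c by (auto simp: q_def)
      have "sqrt q ^ ?m = (q powr (1 / 2)) powr real ?m"
        using q by (simp add: powr_half_sqrt powr_realpow)
      also have "\<dots> = q powr (real ?m / 2)" by (simp add: powr_powr)
      also have "\<dots> \<le> q powr (\<alpha> + 1)" using q m by (intro powr_mono') auto
      finally have qm: "sqrt q ^ ?m \<le> q powr (\<alpha> + 1)" .
      have "u powr (\<alpha> - 1) * (?K * sqrt q ^ ?m * ?X u) \<le>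
          u powr (\<alpha> - 1) * (?K * q powr (\<alpha> + 1) * ?X u)"
        using c by (intro mult_left_mono mult_right_mono qm) auto
      then show ?thesis using True c unfolding q_def
        by (simp add: ennreal_mult'[symmetric] ennreal_mult''[symmetric] mult_ac)
    qed simp
  qed
  also have "\<dots> = ennreal ?K * trunc_gamma c \<alpha> (sq_dist V p)"
    using nn_integral_shrink_substitution[OF \<alpha>(1) c s0[of p]] by (subst nn_integral_cmult) auto
  also have "ennreal (1 / Gamma \<alpha>) * (ennreal ?K * trunc_gamma c \<alpha> (sq_dist V p)) =
      ennreal (?K / Gamma \<alpha>) * trunc_gamma c \<alpha> (sq_dist V p)"
    using c Gamma_real_pos[OF \<alpha>(1)] by (simp add: mult.assoc[symmetric] ennreal_mult[symmetric])
  finally show ?thesis by (simp add: mult_left_mono)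
qed

abbreviation smoothed :: "(real ^ 'n::finite \<Rightarrow> real) \<Rightarrow> real ^ 'n \<Rightarrow> ennreal" where
  "smoothed F p \<equiv> \<integral>\<^sup>+w. ennreal (F (p + w)) * gauss 1 w \<partial>lborel"

text \<open>A substitute for superharmonicity: averaging with the kernel exp (- |w|^2), whose mass
  is the power of sqrt pi, strictly lowers \<open>F\<close>. This is asked almost everywhere because
  the encoded powers of distances are 0 on their subspaces. The integrability clause makes the
  posterior means finite for every rate.\<close>

definition super_mean :: "(real ^ 'n::finite \<Rightarrow> real) \<Rightarrow> bool" where
  "super_mean F \<longleftrightarrow> F \<in> borel_measurable borel \<and> (\<forall>x. 0 \<le> F x) \<and>
    (\<forall>c>0. (\<integral>\<^sup>+x. ennreal (F x) * gauss c x \<partial>lborel) < \<infinity>) \<and>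
    (AE p in lborel. smoothed F p
      < ennreal (sqrt pi ^ CARD('n) * F p))"

lemma super_mean_cmult:
  fixes F :: "real ^ 'n::finite \<Rightarrow> real"
  assumes "super_mean F" "k > 0"
  shows "super_mean (\<lambda>x. k * F x)"
proof -
  have F: "F \<in> borel_measurable borel" "\<And>x. 0 \<le> F x"
    "\<And>c. c > 0 \<Longrightarrow> (\<integral>\<^sup>+x. ennreal (F x) * gauss c x \<partial>lborel) < \<infinity>"
    "AE p in lborel. smoothed F p
      < ennreal (sqrt pi ^ CARD('n) * F p)"
    using assms(1) by (auto simp: super_mean_def)
  note F(1)[measurable]
  have eq: "(\<integral>\<^sup>+w. ennreal (k * F (p + w)) * gauss c w \<partial>lborel) =
    ennreal k * (\<integral>\<^sup>+w. ennreal (F (p + w)) * gauss c w \<partial>lborel)" for p c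
    using assms(2) F(2) by (subst nn_integral_cmult[symmetric]) (simp_all add: ennreal_mult mult.assoc)
  have "(\<integral>\<^sup>+x. ennreal (k * F x) * gauss c x \<partial>lborel) < \<infinity>" if "c > 0" for c
    using eq[of 0 c] F(3)[OF that] by (simp add: ennreal_mult_less_top)
  moreover have "AE p in lborel. (\<integral>\<^sup>+w. ennreal (k * F (p + w)) * gauss 1 w \<partial>lborel)
      < ennreal (sqrt pi ^ CARD('n) * (k * F p))"
    using F(4)
  proof eventually_elim
    case (elim p)
    then have "ennreal k * smoothed F p
      < ennreal k * ennreal (sqrt pi ^ CARD('n) * F p)"
      using assms(2) by (intro ennreal_mult_strict_left_mono) auto
    also have "\<dots> = ennreal (sqrt pi ^ CARD('n) * (k * F p))"
      using assms(2) F(2) by (simp add: ennreal_mult[symmetric] mult_ac)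
    finally show ?case unfolding eq .
  qed
  ultimately show ?thesis using F(2) assms(2) unfolding super_mean_def by auto
qed

lemma super_mean_add:
  fixes F G :: "real ^ 'n::finite \<Rightarrow> real"
  assumes "super_mean F" "super_mean G"
  shows "super_mean (\<lambda>x. F x + G x)"
proof -
  have F: "F \<in> borel_measurable borel" "\<And>x. 0 \<le> F x"
    "\<And>c. c > 0 \<Longrightarrow> (\<integral>\<^sup>+x. ennreal (F x) * gauss c x \<partial>lborel) < \<infinity>"
    "AE p in lborel. smoothed F p
      < ennreal (sqrt pi ^ CARD('n) * F p)"
    using assms(1) by (auto simp: super_mean_def)
  have G: "G \<in> borel_measurable borel" "\<And>x. 0 \<le> G x"
    "\<And>c. c > 0 \<Longrightarrow> (\<integral>\<^sup>+x. ennreal (G x) * gauss c x \<partial>lborel) < \<infinity>"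
    "AE p in lborel. smoothed G p
      < ennreal (sqrt pi ^ CARD('n) * G p)"
    using assms(2) by (auto simp: super_mean_def)
  note F(1)[measurable] G(1)[measurable]
  have eq: "(\<integral>\<^sup>+w. ennreal (F (p + w) + G (p + w)) * gauss c w \<partial>lborel) =
    (\<integral>\<^sup>+w. ennreal (F (p + w)) * gauss c w \<partial>lborel) +
    (\<integral>\<^sup>+w. ennreal (G (p + w)) * gauss c w \<partial>lborel)" for p c
    using F(2) G(2) by (subst nn_integral_add[symmetric]) (simp_all add: distrib_right)
  have "(\<integral>\<^sup>+x. ennreal (F x + G x) * gauss c x \<partial>lborel) < \<infinity>" if "c > 0" for c
    using eq[of 0 c] F(3)[OF that] G(3)[OF that] by simp
  moreover have "AE p in lborel. (\<integral>\<^sup>+w. ennreal (F (p + w) + G (p + w)) * gauss 1 w \<partial>lborel)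
      < ennreal (sqrt pi ^ CARD('n) * (F p + G p))"
    using F(4) G(4)
  proof eventually_elim
    case (elim p)
    have "ennreal (sqrt pi ^ CARD('n) * (F p + G p)) = ennreal (sqrt pi ^ CARD('n) * F p) + ennreal (sqrt pi ^ CARD('n) * G p)"
      using F(2) G(2) by (simp add: distrib_left)
    then show ?case unfolding eq using add_strict_mono[OF elim] by simp
  qed
  ultimately show ?thesis using F(2) G(2) unfolding super_mean_def by auto
qed

lemma super_mean_sum:
  assumes "finite I" "I \<noteq> {}" "\<And>i. i \<in> I \<Longrightarrow> super_mean (F i)"
  shows "super_mean (\<lambda>x. \<Sum>i\<in>I. F i x)"
  using assms
proof (induction rule: finite_ne_induct)
  case (insert i I)
  then show ?case using super_mean_add[of "F i" "\<lambda>x. \<Sum>i\<in>I. F i x"] by simp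
qed simp

text \<open>Both parts follow from \<open>gaussian_smoothing_le\<close>: integrability from p = 0,
  strictness from points with positive distance. The bound on \<alpha> forces dim V below the full
  dimension, so \<open>V\<close> is a null set.\<close>

lemma super_mean_sq_dist_powr:
  fixes V :: "(real ^ 'n::finite) set"
  assumes V: "subspace V" and \<alpha>: "\<alpha> > 0" "\<alpha> \<le> (real CARD('n) - real (dim V) - 2) / 2"
  shows "super_mean (\<lambda>x. sq_dist V x powr (- \<alpha>))"
proof -
  have s0: "sq_dist V x \<ge> 0" for x by (simp add: sq_dist_def)
  have \<Gamma>: "Gamma \<alpha> > 0" by (rule Gamma_real_pos[OF \<alpha>(1)])
  have "(\<integral>\<^sup>+x. ennreal (sq_dist V x powr (- \<alpha>)) * gauss c x \<partial>lborel) < \<infinity>" if "c > 0" for c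
  proof -
    have "(\<integral>\<^sup>+x. ennreal (sq_dist V (0 + x) powr (- \<alpha>)) * gauss c x \<partial>lborel) \<le>
      ennreal (sqrt (pi / c) ^ CARD('n) / Gamma \<alpha>) * trunc_gamma c \<alpha> (sq_dist V 0)"
      by (rule gaussian_smoothing_le[OF V that \<alpha>])
    also have "\<dots> < \<infinity>" using trunc_gamma_finite[OF \<alpha>(1) that s0] by (simp add: ennreal_mult_less_top)
    finally show ?thesis by simp
  qed
  moreover have "AE p in lborel. (\<integral>\<^sup>+w. ennreal (sq_dist V (p + w) powr (- \<alpha>)) * gauss 1 w \<partial>lborel)
      < ennreal (sqrt pi ^ CARD('n) * sq_dist V p powr (- \<alpha>))"
  proof (rule AE_mp)
    have closed: "closed V" using V by (rule closed_subspace)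
    have "negligible V" using \<alpha> by (intro negligible_lowdim) simp
    then have "V \<in> null_sets lborel"
      using closed by (auto simp: negligible_iff_null_sets null_sets_def)
    then show "AE p in lborel. p \<notin> V" by (rule AE_not_in)
    show "AE p in lborel. p \<notin> V \<longrightarrow> (\<integral>\<^sup>+w. ennreal (sq_dist V (p + w) powr (- \<alpha>)) * gauss 1 w \<partial>lborel)
      < ennreal (sqrt pi ^ CARD('n) * sq_dist V p powr (- \<alpha>))"
    proof (intro AE_I2 impI)
      fix p assume "p \<notin> V"
      moreover have "V \<noteq> {}" using V subspace_0 by blast
      ultimately have "infdist p V \<noteq> 0" using closed in_closed_iff_infdist_zero by blast
      then have s: "sq_dist V p > 0" by (simp add: sq_dist_def)
      have "(\<integral>\<^sup>+w. ennreal (sq_dist V (p + w) powr (- \<alpha>)) * gauss 1 w \<partial>lborel) \<le>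
        ennreal (sqrt (pi / 1) ^ CARD('n) / Gamma \<alpha>) * trunc_gamma 1 \<alpha> (sq_dist V p)"
        by (rule gaussian_smoothing_le[OF V _ \<alpha>]) simp
      also have "\<dots> < ennreal (sqrt (pi / 1) ^ CARD('n) / Gamma \<alpha>) * ennreal (Gamma \<alpha> / sq_dist V p powr \<alpha>)"
        using \<Gamma> by (intro ennreal_mult_strict_left_mono trunc_gamma_less \<alpha> s) auto
      also have "\<dots> = ennreal (sqrt pi ^ CARD('n) * sq_dist V p powr (- \<alpha>))"
        using \<Gamma> by (simp add: ennreal_mult[symmetric] powr_minus field_simps)
      finally show "(\<integral>\<^sup>+w. ennreal (sq_dist V (p + w) powr (- \<alpha>)) * gauss 1 w \<partial>lborel)
        < ennreal (sqrt pi ^ CARD('n) * sq_dist V p powr (- \<alpha>))" .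
    qed
  qed
  ultimately show ?thesis unfolding super_mean_def by auto
qed

section \<open>Scalings and sign flips\<close>

lemma sq_dist_scaleR:
  fixes V :: "(real ^ 'n::finite) set"
  assumes "subspace V"
  shows "sq_dist V (k *\<^sub>R x) = k\<^sup>2 * sq_dist V x"
proof -
  obtain a b where ab: "a \<in> span V" "\<And>v. v \<in> span V \<Longrightarrow> orthogonal b v" "x = a + b"
    using orthogonal_subspace_decomp_exists[of V x] by metis
  have sp: "span V = V" using assms by (simp add: span_eq_iff)
  have "infdist (a + b) V = norm b"
    by (rule infdist_orthogonal_decomp) (use ab assms sp in \<open>auto simp: orthogonal_def inner_commute\<close>)
  moreover have "infdist (k *\<^sub>R a + k *\<^sub>R b) V = norm (k *\<^sub>R b)"
    by (rule infdist_orthogonal_decomp) (use ab assms sp in \<open>auto simp: orthogonal_def inner_commute subspace_scale\<close>)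
  ultimately show ?thesis
    by (simp add: sq_dist_def ab(3) scaleR_right_distrib power_mult_distrib)
qed

definition sign_flip :: "real ^ 'n::finite \<Rightarrow> real ^ 'n \<Rightarrow> real ^ 'n" where
  "sign_flip a x = (\<chi> i. a $ i * x $ i)"

lemma sign_flip_involution: "a \<in> sign_vectors \<Longrightarrow> sign_flip a (sign_flip a x) = x"
  by (auto simp: sign_flip_def sign_vectors_def vec_eq_iff) (metis mult_1 mult_minus1 minus_minus)

lemma linear_sign_flip: "linear (sign_flip a)"
  by (rule linearI) (auto simp: sign_flip_def vec_eq_iff algebra_simps)

lemma inner_sign_flip: "sign_flip a x \<bullet> y = x \<bullet> sign_flip a y"
  by (simp add: sign_flip_def inner_vec_def mult_ac)

text \<open>A sign flip is a self-inverse isometry, so it can be moved from the point to the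
  subspace. Every summand of f is thus a power of the distance to a subspace of the same
  dimension.\<close>

lemma sq_dist_sign_flip:
  assumes "subspace V" "a \<in> sign_vectors"
  shows "sq_dist V (sign_flip a x) = sq_dist (sign_flip a ` V) x"
proof -
  let ?W = "sign_flip a ` V"
  have W: "subspace ?W" using linear_sign_flip assms(1) by (rule linear_subspace_image)
  obtain p q where pq: "p \<in> span ?W" "\<And>v. v \<in> span ?W \<Longrightarrow> orthogonal q v" "x = p + q"
    using orthogonal_subspace_decomp_exists[of ?W x] by metis
  have sp: "span ?W = ?W" using W by (simp add: span_eq_iff)
  have "infdist (p + q) ?W = norm q"
    by (rule infdist_orthogonal_decomp) (use pq W sp in \<open>auto simp: orthogonal_def inner_commute\<close>)
  moreover have "infdist (sign_flip a p + sign_flip a q) V = norm (sign_flip a q)"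
  proof (rule infdist_orthogonal_decomp[OF _ assms(1)])
    show "sign_flip a p \<in> V" using pq(1) sp assms(2) by (auto simp: sign_flip_involution)
    show "v \<bullet> sign_flip a q = 0" if "v \<in> V" for v
    proof -
      have "q \<bullet> sign_flip a v = 0" using pq(2)[of "sign_flip a v"] that sp by (auto simp: orthogonal_def)
      then show ?thesis by (metis inner_sign_flip inner_commute)
    qed
  qed
  moreover have "norm (sign_flip a q) = norm q"
    by (simp add: norm_eq_sqrt_inner inner_sign_flip sign_flip_involution[OF assms(2)])
  ultimately show ?thesis by (simp add: sq_dist_def pq(3) linear_add[OF linear_sign_flip])
qed

lemma finite_sign_vectors: "finite (sign_vectors :: (real ^ 'n::finite) set)"
proof (rule finite_subset)
  show "(sign_vectors :: (real ^ 'n) set) \<subseteq> vec_lambda ` (PiE UNIV (\<lambda>_. {1, -1}))"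
  proof
    fix a :: "real ^ 'n" assume "a \<in> sign_vectors"
    then have "a = vec_lambda (\<lambda>i. a $ i)" "(\<lambda>i. a $ i) \<in> PiE UNIV (\<lambda>_. {1, -1})"
      by (auto simp: sign_vectors_def)
    then show "a \<in> vec_lambda ` (PiE UNIV (\<lambda>_. {1, -1}))" by blast
  qed
  show "finite (vec_lambda ` (PiE (UNIV :: 'n set) (\<lambda>_. {1, - 1 :: real})))"
    by (intro finite_imageI finite_PiE) auto
qed

lemma sign_vectors_nonempty: "sign_vectors \<noteq> {}"
proof -
  have "(\<chi> i. 1) \<in> sign_vectors" by (simp add: sign_vectors_def)
  then show ?thesis by blast
qed

text \<open>Flipping the signs of x permutes the sign vectors. The prior sees f only at points with
  nonnegative coordinates; this evenness is what permits integration over all t.\<close>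

lemma shrink_f_abs:
  fixes x :: "real ^ 'n::finite"
  shows "shrink_f n V \<alpha> (\<chi> i. \<bar>x $ i\<bar>) = shrink_f n V \<alpha> x"
proof -
  define b where "b = (\<chi> i. if x $ i < 0 then - 1 else (1 :: real))"
  have b: "b \<in> sign_vectors" by (simp add: b_def sign_vectors_def)
  have mem: "sign_flip b a \<in> sign_vectors" if "a \<in> sign_vectors" for a
    using that by (auto simp: sign_flip_def sign_vectors_def b_def)
  have "(\<Sum>a\<in>sign_vectors. sq_dist (V j) (\<chi> i. a $ i * \<bar>x $ i\<bar>) powr (- \<alpha> j)) =
      (\<Sum>a\<in>sign_vectors. sq_dist (V j) (\<chi> i. a $ i * x $ i) powr (- \<alpha> j))" for j
  proof (rule sum.reindex_bij_witness[of _ "sign_flip b" "sign_flip b"])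
    fix a :: "real ^ 'n" assume "a \<in> sign_vectors"
    have "sign_flip b a $ i * x $ i = a $ i * \<bar>x $ i\<bar>" for i by (simp add: sign_flip_def b_def)
    then show "sq_dist (V j) (\<chi> i. sign_flip b a $ i * x $ i) powr (- \<alpha> j) =
        sq_dist (V j) (\<chi> i. a $ i * \<bar>x $ i\<bar>) powr (- \<alpha> j)" by simp
  qed (simp_all add: mem sign_flip_involution[OF b])
  then show ?thesis by (simp add: shrink_f_def)
qed

lemma super_mean_shrink_f:
  fixes V :: "nat \<Rightarrow> (real ^ 'n::finite) set"
  assumes "n \<ge> 1" "\<And>j. j \<in> {1..n} \<Longrightarrow> subspace (V j)" "\<And>j. j \<in> {1..n} \<Longrightarrow> 0 < \<alpha> j"
    "\<And>j. j \<in> {1..n} \<Longrightarrow> \<alpha> j \<le> (real CARD('n) - real (dim (V j)) - 2) / 2" "\<kappa> > 0"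
  shows "super_mean (\<lambda>x. shrink_f n V \<alpha> (\<kappa> *\<^sub>R x))"
proof -
  let ?t = "\<lambda>j a x. (\<kappa>\<^sup>2) powr (- \<alpha> j) * sq_dist (sign_flip a ` V j) x powr (- \<alpha> j)"
  have "shrink_f n V \<alpha> (\<kappa> *\<^sub>R x) = (\<Sum>j=1..n. \<Sum>a\<in>sign_vectors. ?t j a x)" for x
    unfolding shrink_f_def
  proof (intro sum.cong refl)
    fix j and a :: "real ^ 'n" assume j: "j \<in> {1..n}" and a: "a \<in> sign_vectors"
    have "(\<chi> i. a $ i * (\<kappa> *\<^sub>R x) $ i) = \<kappa> *\<^sub>R sign_flip a x"
      by (simp add: sign_flip_def vec_eq_iff)
    then have "sq_dist (V j) (\<chi> i. a $ i * (\<kappa> *\<^sub>R x) $ i) = \<kappa>\<^sup>2 * sq_dist (sign_flip a ` V j) x"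
      using assms(2)[OF j] a by (simp add: sq_dist_scaleR sq_dist_sign_flip)
    then show "sq_dist (V j) (\<chi> i. a $ i * (\<kappa> *\<^sub>R x) $ i) powr (- \<alpha> j) = ?t j a x"
      by (simp add: powr_mult sq_dist_def)
  qed
  moreover have "super_mean (\<lambda>x. \<Sum>j=1..n. \<Sum>a\<in>sign_vectors. ?t j a x)"
  proof (intro super_mean_sum super_mean_cmult super_mean_sq_dist_powr)
    fix j and a :: "real ^ 'n" assume j: "j \<in> {1..n}" and a: "a \<in> sign_vectors"
    show "subspace (sign_flip a ` V j)" using linear_sign_flip assms(2)[OF j] by (rule linear_subspace_image)
    have "inj (sign_flip a)" using sign_flip_involution[OF a] by (metis injI)
    then have "dim (sign_flip a ` V j) = dim (V j)"
      by (intro dim_image_eq linear_sign_flip) (auto intro: inj_on_subset)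
    then show "\<alpha> j \<le> (real CARD('n) - real (dim (sign_flip a ` V j)) - 2) / 2" using assms(4)[OF j] by simp
  qed (use assms finite_sign_vectors sign_vectors_nonempty in auto)
  ultimately show ?thesis by simp
qed

section \<open>Binomial thinning as Gaussian smoothing\<close>

lemma Gamma_half: "Gamma (real n + 1 / 2) = fact (2 * n) * sqrt pi / (4 ^ n * fact n)"
proof (induction n)
  case 0
  then show ?case by (simp add: Gamma_one_half_real)
next
  case (Suc n)
  have "Gamma (real (Suc n) + 1 / 2) = Gamma ((real n + 1 / 2) + 1)" by (simp add: add_ac)
  also have "\<dots> = (real n + 1 / 2) * Gamma (real n + 1 / 2)"
    by (rule Gamma_plus1) (auto simp: nonpos_Ints_def)
  also have "\<dots> = (real n + 1 / 2) * (fact (2 * n) * sqrt pi / (4 ^ n * fact n))" by (simp only: Suc)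
  also have "\<dots> = fact (2 * Suc n) * sqrt pi / (4 ^ Suc n * fact (Suc n))"
  proof -
    have "(fact (2 * Suc n) :: real) = (2 * real n + 2) * (2 * real n + 1) * fact (2 * n)"
      by (simp add: algebra_simps)
    moreover have "(fact (Suc n) :: real) = (real n + 1) * fact n" by (simp add: algebra_simps)
    ultimately show ?thesis by (simp add: divide_simps del: fact_Suc) (simp add: algebra_simps)
  qed
  finally show ?case .
qed

text \<open>By \<open>Gamma_half\<close> all half-integer Gamma values become factorials. The
  identity is what converts the even part of a binomial expansion of order 2 z into binomial
  probabilities of order z.\<close>

lemma choose_Gamma_half:
  assumes "j \<le> z"
  shows "real (z choose j) / Gamma (real j + 1 / 2) =
    real ((2 * z) choose (2 * j)) * Gamma (real (z - j) + 1 / 2) / (sqrt pi * Gamma (real z + 1 / 2))"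
proof -
  have z: "(4::real) ^ z = 4 ^ j * 4 ^ (z - j)" using assms by (simp flip: power_add)
  have "real ((2 * z) choose (2 * j)) = fact (2 * z) / (fact (2 * j) * fact (2 * (z - j)))"
    using assms by (subst binomial_fact) (auto simp: diff_mult_distrib2)
  moreover have "real (z choose j) = fact z / (fact j * fact (z - j))"
    using assms by (rule binomial_fact)
  ultimately show ?thesis unfolding Gamma_half z by (simp add: field_simps)
qed

text \<open>The symmetric probability density of t on the line for which t^2 is Gamma distributed
  with shape x + 1/2 and rate a. It is the posterior density of t given count x under the Jeffreys
  prior.\<close>

definition sqgamma :: "real \<Rightarrow> nat \<Rightarrow> real \<Rightarrow> real" where
  "sqgamma a x t = a ^ x * sqrt a / Gamma (real x + 1 / 2) * (t ^ (2 * x) * exp (- (a * t\<^sup>2)))"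

lemma Gamma_half_pos: "Gamma (real x + 1 / 2) > 0"
  by (rule Gamma_real_pos) simp

lemma even_power_nonneg [simp]: "0 \<le> (t::real) ^ (2 * x)"
  by (simp add: power_mult)

lemma sqgamma_nonneg [simp]: "a \<ge> 0 \<Longrightarrow> sqgamma a x t \<ge> 0"
  using Gamma_half_pos[of x] unfolding sqgamma_def by (intro mult_nonneg_nonneg divide_nonneg_nonneg) auto

lemma borel_measurable_sqgamma [measurable]: "sqgamma a x \<in> borel_measurable borel"
  unfolding sqgamma_def by measurable

lemma even_binomial_sum:
  fixes c w :: real
  shows "(c + w) ^ (2 * z) + (c - w) ^ (2 * z) =
    2 * (\<Sum>j\<le>z. real ((2 * z) choose (2 * j)) * c ^ (2 * j) * w ^ (2 * (z - j)))"
proof -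
  have even: "(\<Sum>k\<le>2 * m. f k) = (\<Sum>j\<le>m. f (2 * j))" if "\<And>k. odd k \<Longrightarrow> f k = 0" for f :: "nat \<Rightarrow> real" and m
    by (induction m) (simp_all add: that)
  define f where "f k = real ((2 * z) choose k) * c ^ k * (w ^ (2 * z - k) + (- w) ^ (2 * z - k))" for k
  have "(c + w) ^ (2 * z) + (c + (- w)) ^ (2 * z) = (\<Sum>k\<le>2 * z. f k)"
    unfolding binomial_ring f_def by (simp add: sum.distrib[symmetric] distrib_left)
  also have "\<dots> = (\<Sum>j\<le>z. f (2 * j))"
  proof (rule even)
    fix k :: nat assume k: "odd k"
    show "f k = 0"
    proof (cases "k \<le> 2 * z")
      case True
      then have "odd (2 * z - k)" using k by simp
      then show ?thesis by (simp add: f_def)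
    qed (simp add: f_def)
  qed
  also have "\<dots> = (\<Sum>j\<le>z. 2 * (real ((2 * z) choose (2 * j)) * c ^ (2 * j) * w ^ (2 * (z - j))))"
  proof (rule sum.cong[OF refl])
    fix j assume "j \<in> {..z}"
    then have "2 * z - 2 * j = 2 * (z - j)" by simp
    then show "f (2 * j) = 2 * (real ((2 * z) choose (2 * j)) * c ^ (2 * j) * w ^ (2 * (z - j)))"
      by (simp add: f_def)
  qed
  finally show ?thesis by (simp add: sum_distrib_left)
qed

lemma nn_integral_lborel_minus:
  fixes f :: "real \<Rightarrow> ennreal"
  assumes [measurable]: "f \<in> borel_measurable borel"
  shows "(\<integral>\<^sup>+x. f (- x) \<partial>lborel) = (\<integral>\<^sup>+x. f x \<partial>lborel)"
  using nn_integral_real_affine[of f "-1" 0] by simp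

lemma ennreal_double_cancel: "x = y" if "x + x = y + (y::ennreal)"
proof -
  have "2 * x = 2 * y" using that by (simp only: mult_2)
  then show ?thesis by (simp add: ennreal_mult_cancel_left)
qed

text \<open>Adding the reflected integral removes the odd powers of w, which are not nonnegative and
  so cannot be integrated term by term in \<open>ennreal\<close>. The factor 2 is cancelled at the
  end.\<close>

lemma nn_integral_even_moment_shifted:
  assumes "A > 0"
  shows "(\<integral>\<^sup>+w. ennreal ((c + w) ^ (2 * z) * exp (- (A * w\<^sup>2))) \<partial>lborel) =
    ennreal (\<Sum>j\<le>z. real ((2 * z) choose (2 * j)) * c ^ (2 * j) * (Gamma (real (z - j) + 1 / 2) / A powr (real (z - j) + 1 / 2)))"
    (is "?I = ennreal ?S")
proof -
  let ?M = "\<lambda>j w. w ^ (2 * (z - j)) * exp (- (A * w\<^sup>2))"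
  let ?G = "\<lambda>j. Gamma (real (z - j) + 1 / 2) / A powr (real (z - j) + 1 / 2)"
  let ?B = "\<lambda>j. 2 * real ((2 * z) choose (2 * j)) * c ^ (2 * j)"
  have nn: "0 \<le> Gamma (real (z - j) + 1 / 2) / A powr (real (z - j) + 1 / 2)" for j
    using Gamma_half_pos[of "z - j"] by simp
  have "?I + ?I = ?I + (\<integral>\<^sup>+w. ennreal ((c + (- w)) ^ (2 * z) * exp (- (A * (- w)\<^sup>2))) \<partial>lborel)"
    by (subst nn_integral_lborel_minus[of "\<lambda>w. ennreal ((c + w) ^ (2 * z) * exp (- (A * w\<^sup>2)))"]) simp_all
  also have "\<dots> = (\<integral>\<^sup>+w. ennreal ((c + w) ^ (2 * z) * exp (- (A * w\<^sup>2))) + ennreal ((c + (- w)) ^ (2 * z) * exp (- (A * (- w)\<^sup>2))) \<partial>lborel)"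
    by (rule nn_integral_add[symmetric]) auto
  also have "\<dots> = (\<integral>\<^sup>+w. (\<Sum>j\<le>z. ennreal (?B j) * ennreal (?M j w)) \<partial>lborel)"
  proof (rule nn_integral_cong)
    fix w
    have "ennreal ((c + w) ^ (2 * z) * exp (- (A * w\<^sup>2))) + ennreal ((c + (- w)) ^ (2 * z) * exp (- (A * (- w)\<^sup>2))) =
       ennreal (((c + w) ^ (2 * z) + (c - w) ^ (2 * z)) * exp (- (A * w\<^sup>2)))"
      by (subst ennreal_plus[symmetric]) (simp_all add: distrib_right)
    also have "\<dots> = ennreal (\<Sum>j\<le>z. ?B j * ?M j w)"
      unfolding even_binomial_sum by (simp add: sum_distrib_left sum_distrib_right mult_ac)
    also have "\<dots> = (\<Sum>j\<le>z. ennreal (?B j * ?M j w))"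
      by (rule sum_ennreal[symmetric]) simp
    finally show "ennreal ((c + w) ^ (2 * z) * exp (- (A * w\<^sup>2))) + ennreal ((c + (- w)) ^ (2 * z) * exp (- (A * (- w)\<^sup>2))) =
      (\<Sum>j\<le>z. ennreal (?B j) * ennreal (?M j w))"
      by (simp add: ennreal_mult)
  qed
  also have "\<dots> = (\<Sum>j\<le>z. ennreal (?B j) * (\<integral>\<^sup>+w. ennreal (?M j w) \<partial>lborel))"
    by (subst nn_integral_sum) (auto simp: nn_integral_cmult)
  also have "\<dots> = (\<Sum>j\<le>z. ennreal (?B j * ?G j))"
    unfolding nn_integral_even_moment[OF assms]
    by (intro sum.cong refl ennreal_mult[symmetric] nn mult_nonneg_nonneg) auto
  also have "\<dots> = ennreal (\<Sum>j\<le>z. ?B j * ?G j)"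
    by (rule sum_ennreal) (intro mult_nonneg_nonneg nn; simp)
  also have "\<dots> = ennreal (?S + ?S)"
    unfolding mult_2[symmetric] sum_distrib_left by (simp only: mult.assoc)
  also have "\<dots> = ennreal ?S + ennreal ?S"
    by (intro ennreal_plus sum_nonneg mult_nonneg_nonneg nn) auto
  finally show ?thesis by (rule ennreal_double_cancel)
qed

lemma nn_integral_sqgamma:
  assumes "a > 0" shows "(\<integral>\<^sup>+t. ennreal (sqgamma a x t) \<partial>lborel) = 1"
proof -
  have p: "a powr (real x + 1 / 2) = a ^ x * sqrt a"
    using assms by (simp add: powr_add powr_realpow powr_half_sqrt)
  have "(\<integral>\<^sup>+t. ennreal (sqgamma a x t) \<partial>lborel) =
     ennreal (a ^ x * sqrt a / Gamma (real x + 1 / 2)) * (\<integral>\<^sup>+t. ennreal (t ^ (2 * x) * exp (- (a * t\<^sup>2))) \<partial>lborel)"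
  proof (subst nn_integral_cmult[symmetric])
    have "0 \<le> a ^ x * sqrt a / Gamma (real x + 1 / 2)" using assms Gamma_half_pos[of x] by simp
    then show "(\<integral>\<^sup>+t. ennreal (sqgamma a x t) \<partial>lborel) =
       (\<integral>\<^sup>+t. ennreal (a ^ x * sqrt a / Gamma (real x + 1 / 2)) * ennreal (t ^ (2 * x) * exp (- (a * t\<^sup>2))) \<partial>lborel)"
      unfolding sqgamma_def by (intro nn_integral_cong ennreal_mult')
  qed simp
  also have "\<dots> = ennreal (a ^ x * sqrt a / Gamma (real x + 1 / 2) * (Gamma (real x + 1 / 2) / a powr (real x + 1 / 2)))"
    unfolding nn_integral_even_moment[OF assms] using assms Gamma_half_pos[of x]
    by (subst ennreal_mult[symmetric]) (simp_all add: less_imp_le)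
  also have "\<dots> = 1"
  proof -
    have "Gamma (real x + 1 / 2) \<noteq> 0" using Gamma_half_pos[of x] by linarith
    then show ?thesis unfolding p using assms by simp
  qed
  finally show ?thesis .
qed

text \<open>If \<open>t\<^sup>2\<close> given \<open>z\<close> is Gamma distributed with rate \<open>b\<close> and \<open>w\<close> is Gaussian with
  variance 1/2, then \<open>t + w\<close> has the law obtained by thinning \<open>z\<close> binomially and lowering
  the rate from \<open>b\<close> to \<open>b / (1 + b)\<close>.\<close>
lemma sqgamma_binomial_thinning:
  assumes "b > 0"
  defines "\<rho> \<equiv> 1 / (1 + b)"
  shows "(\<integral>\<^sup>+p. ennreal (sqgamma b z p) * ennreal (exp (- (1 * (t - p)\<^sup>2))) \<partial>lborel) =
    ennreal (sqrt pi * (\<Sum>x\<le>z. real (z choose x) * \<rho> ^ x * (1 - \<rho>) ^ (z - x) * sqgamma (b / (1 + b)) x t))"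
proof -
  let ?S = "\<Sum>j\<le>z. real ((2 * z) choose (2 * j)) * (\<rho> * t) ^ (2 * j) * (Gamma (real (z - j) + 1 / 2) / (1 + b) powr (real (z - j) + 1 / 2))"
  let ?a = "b / (1 + b)"
  have \<rho>: "\<rho> > 0" using assms by (simp add: \<rho>_def)
  have ab: "?a = b * \<rho>" "1 - \<rho> = b * \<rho>" using assms by (simp_all add: \<rho>_def field_simps)
  have A: "1 + b > 0" using assms by simp
  define K where "K = b ^ z * sqrt b / Gamma (real z + 1 / 2)"
  have K: "K \<ge> 0" using assms Gamma_half_pos[of z] by (simp add: K_def)
  \<comment> \<open>The variable p is recentred at \<rho> t, the minimiser of the quadratic form, so
    the mixed term disappears.\<close>
  have sq: "b * (\<rho> * t + w)\<^sup>2 + (t - (\<rho> * t + w))\<^sup>2 = (1 + b) * w\<^sup>2 + ?a * t\<^sup>2" for w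
  proof -
    have "\<rho> * (1 + b) = 1" using A by (simp add: \<rho>_def)
    then show ?thesis unfolding ab by algebra
  qed
  have "(\<integral>\<^sup>+p. ennreal (sqgamma b z p) * ennreal (exp (- (1 * (t - p)\<^sup>2))) \<partial>lborel) =
    (\<integral>\<^sup>+w. ennreal (sqgamma b z (\<rho> * t + w)) * ennreal (exp (- (1 * (t - (\<rho> * t + w))\<^sup>2))) \<partial>lborel)"
    by (rule nn_integral_lborel_shift[symmetric]) measurable
  also have "\<dots> = (\<integral>\<^sup>+w. ennreal (K * exp (- (?a * t\<^sup>2))) * ennreal ((\<rho> * t + w) ^ (2 * z) * exp (- ((1 + b) * w\<^sup>2))) \<partial>lborel)"
  proof (rule nn_integral_cong)
    fix w
    have "exp (- (b * (\<rho> * t + w)\<^sup>2)) * exp (- (1 * (t - (\<rho> * t + w))\<^sup>2)) = exp (- ((1 + b) * w\<^sup>2)) * exp (- (?a * t\<^sup>2))"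
      unfolding exp_add[symmetric] using sq[of w] by (intro arg_cong[where f = exp]) linarith
    moreover have "sqgamma b z (\<rho> * t + w) * exp (- (1 * (t - (\<rho> * t + w))\<^sup>2)) =
        K * (\<rho> * t + w) ^ (2 * z) * (exp (- (b * (\<rho> * t + w)\<^sup>2)) * exp (- (1 * (t - (\<rho> * t + w))\<^sup>2)))"
      unfolding sqgamma_def K_def[symmetric] by (simp only: mult.assoc)
    ultimately have "sqgamma b z (\<rho> * t + w) * exp (- (1 * (t - (\<rho> * t + w))\<^sup>2)) =
        (K * exp (- (?a * t\<^sup>2))) * ((\<rho> * t + w) ^ (2 * z) * exp (- ((1 + b) * w\<^sup>2)))"
      by (simp only: mult_ac)
    then show "ennreal (sqgamma b z (\<rho> * t + w)) * ennreal (exp (- (1 * (t - (\<rho> * t + w))\<^sup>2))) =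
      ennreal (K * exp (- (?a * t\<^sup>2))) * ennreal ((\<rho> * t + w) ^ (2 * z) * exp (- ((1 + b) * w\<^sup>2)))"
      using K assms by (simp only: ennreal_mult[symmetric] sqgamma_nonneg less_imp_le exp_ge_zero mult_nonneg_nonneg even_power_nonneg)
  qed
  also have "\<dots> = ennreal (K * exp (- (?a * t\<^sup>2))) * ennreal ?S"
    by (subst nn_integral_cmult) (simp_all add: nn_integral_even_moment_shifted[OF A])
  also have "\<dots> = ennreal (K * exp (- (?a * t\<^sup>2)) * ?S)"
    using K by (intro ennreal_mult'[symmetric]) auto
  also have "K * exp (- (?a * t\<^sup>2)) * ?S
    = sqrt pi * (\<Sum>x\<le>z. real (z choose x) * \<rho> ^ x * (1 - \<rho>) ^ (z - x) * sqgamma ?a x t)"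
    unfolding sum_distrib_left
  proof (rule sum.cong[OF refl])
    fix j assume "j \<in> {..z}"
    then have j: "j \<le> z" by simp
    have "(1 + b) = 1 / \<rho>" by (simp add: \<rho>_def)
    then have "(1 + b) powr (real (z - j) + 1 / 2) = 1 / (\<rho> ^ (z - j) * sqrt \<rho>)"
      using \<rho> by (simp add: powr_divide powr_add powr_realpow powr_half_sqrt)
    then have "K * exp (- (?a * t\<^sup>2)) * (real ((2 * z) choose (2 * j)) * (\<rho> * t) ^ (2 * j) * (Gamma (real (z - j) + 1 / 2) / (1 + b) powr (real (z - j) + 1 / 2)))
      = (b ^ z * sqrt b * sqrt \<rho> * (\<rho> ^ (2 * j) * \<rho> ^ (z - j)) * t ^ (2 * j) * exp (- (?a * t\<^sup>2))) * (sqrt pi *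
         (real ((2 * z) choose (2 * j)) * Gamma (real (z - j) + 1 / 2) / (sqrt pi * Gamma (real z + 1 / 2))))"
      by (simp add: K_def power_mult_distrib)
    also have "\<dots> = (b ^ z * sqrt b * sqrt \<rho> * (\<rho> ^ (2 * j) * \<rho> ^ (z - j)) * t ^ (2 * j) * exp (- (?a * t\<^sup>2))) * (sqrt pi * (real (z choose j) / Gamma (real j + 1 / 2)))"
      unfolding choose_Gamma_half[OF j] ..
    \<comment> \<open>The powers are regrouped to match 1 - \<rho> = b \<rho> and the new rate b
      \<rho>: z - j factors b \<rho> go to the binomial weight, j of them to
      \<open>sqgamma\<close>.\<close>
    also have "b ^ z = b ^ (z - j) * b ^ j" using j by (simp flip: power_add)
    also have "(\<rho> ^ (2 * j) * \<rho> ^ (z - j)) = \<rho> ^ j * \<rho> ^ (z - j) * \<rho> ^ j"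
      by (simp add: mult_2 power_add)
    finally show "K * exp (- (?a * t\<^sup>2)) * (real ((2 * z) choose (2 * j)) * (\<rho> * t) ^ (2 * j) * (Gamma (real (z - j) + 1 / 2) / (1 + b) powr (real (z - j) + 1 / 2)))
      = sqrt pi * (real (z choose j) * \<rho> ^ j * (1 - \<rho>) ^ (z - j) * sqgamma ?a j t)"
      unfolding sqgamma_def ab by (simp add: power_mult_distrib real_sqrt_mult)
  qed
  finally show ?thesis .
qed

section \<open>Posterior means\<close>

abbreviation sqgamma_prod :: "('n::finite \<Rightarrow> real) \<Rightarrow> ('n \<Rightarrow> nat) \<Rightarrow> real ^ 'n \<Rightarrow> ennreal" where
  "sqgamma_prod a z t \<equiv> \<Prod>i\<in>UNIV. ennreal (sqgamma (a i) (z i) (t $ i))"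

text \<open>The posterior mean of \<open>F\<close> given counts z, in the coordinates t with rates
  a. It is \<open>ennreal\<close>-valued so that Fubini applies before finiteness is known.\<close>

definition mixture :: "(real ^ 'n::finite \<Rightarrow> real) \<Rightarrow> ('n \<Rightarrow> real) \<Rightarrow> ('n \<Rightarrow> nat) \<Rightarrow> ennreal" where
  "mixture F a z = (\<integral>\<^sup>+t. ennreal (F t) * sqgamma_prod a z t \<partial>lborel)"

text \<open>The conditional probability of x given the totals z when each count is kept
  independently with probability \<rho> i.\<close>

definition thinning :: "('n::finite \<Rightarrow> real) \<Rightarrow> ('n \<Rightarrow> nat) \<Rightarrow> ('n \<Rightarrow> nat) \<Rightarrow> real" where
  "thinning \<rho> z x = (\<Prod>i\<in>UNIV. real (z i choose x i) * \<rho> i ^ x i * (1 - \<rho> i) ^ (z i - x i))"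

lemma thinning_nonneg: "(\<And>i. 0 \<le> \<rho> i \<and> \<rho> i \<le> 1) \<Longrightarrow> 0 \<le> thinning \<rho> z x"
  unfolding thinning_def by (intro prod_nonneg) auto

lemma borel_measurable_vec_nth' [measurable (raw)]:
  fixes f :: "'a \<Rightarrow> real ^ 'n::finite"
  assumes "f \<in> borel_measurable M"
  shows "(\<lambda>x. f x $ i) \<in> borel_measurable M"
  by (rule measurable_compose[OF assms]) (intro borel_measurable_continuous_onI continuous_intros)

text \<open>Both sides are the double integral of F(t) exp (- |t - p|^2) against the posterior
  density of p given z. Integrating over p first thins the counts, by the one-dimensional
  convolution identity in each coordinate; integrating over t first smooths
  \<open>F\<close>.\<close>

lemma mixture_thinning_eq:
  fixes F :: "real ^ 'n::finite \<Rightarrow> real"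
  assumes [measurable]: "F \<in> borel_measurable borel" and b: "\<And>i. b i > 0"
  shows "ennreal (sqrt pi ^ CARD('n)) * (\<Sum>x\<in>PiE UNIV (\<lambda>i. {..z i}).
      ennreal (thinning (\<lambda>i. 1 / (1 + b i)) z x) * mixture F (\<lambda>i. b i / (1 + b i)) x) =
    (\<integral>\<^sup>+p. sqgamma_prod b z p *
      smoothed F p \<partial>lborel)"
proof -
  let ?T = "\<lambda>t p. \<Prod>i\<in>UNIV. ennreal (sqgamma (b i) (z i) (p $ i)) * ennreal (exp (- (1 * (t $ i - p $ i)\<^sup>2)))"
  let ?P = "PiE UNIV (\<lambda>i. {..z i})"
  let ?\<rho> = "\<lambda>i. 1 / (1 + b i)"
  let ?a = "\<lambda>i. b i / (1 + b i)"
  let ?c = "\<lambda>i x. real (z i choose x) * ?\<rho> i ^ x * (1 - ?\<rho> i) ^ (z i - x)"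
  have finP: "finite ?P" by (intro finite_PiE) auto
  have a: "?a i > 0" for i using b[of i] by (intro divide_pos_pos) auto
  have c: "?c i x \<ge> 0" for i x using b[of i] by simp
  have th: "thinning ?\<rho> z x \<ge> 0" for x using b by (intro thinning_nonneg) (auto simp: less_imp_le add_pos_pos)
  have fac: "(\<Prod>i\<in>UNIV. ennreal (?c i (x i) * sqgamma (?a i) (x i) (t $ i))) =
       ennreal (thinning ?\<rho> z x) * sqgamma_prod ?a x t" for x and t :: "real ^ 'n"
    proof -
      have "(\<Prod>i\<in>UNIV. ennreal (?c i (x i) * sqgamma (?a i) (x i) (t $ i))) =
        (\<Prod>i\<in>UNIV. ennreal (?c i (x i)) * ennreal (sqgamma (?a i) (x i) (t $ i)))"
        by (intro prod.cong refl ennreal_mult' c)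
      also have "\<dots> = (\<Prod>i\<in>UNIV. ennreal (?c i (x i))) * sqgamma_prod ?a x t"
        by (rule prod.distrib)
      also have "(\<Prod>i\<in>UNIV. ennreal (?c i (x i))) = ennreal (thinning ?\<rho> z x)"
        unfolding thinning_def by (rule prod_ennreal) (rule c)
      finally show ?thesis .
    qed
  have conv: "(\<integral>\<^sup>+p. ?T t p \<partial>lborel)
      = ennreal (sqrt pi ^ CARD('n)) * (\<Sum>x\<in>?P. ennreal (thinning ?\<rho> z x) * sqgamma_prod ?a x t)"
      for t :: "real ^ 'n"
  proof -
    have "(\<integral>\<^sup>+p. ?T t p \<partial>lborel)
      = (\<Prod>i\<in>UNIV. \<integral>\<^sup>+p. ennreal (sqgamma (b i) (z i) p) * ennreal (exp (- (1 * (t $ i - p)\<^sup>2))) \<partial>lborel)"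
      by (rule nn_integral_lborel_prod_cart) measurable
    also have "\<dots> = (\<Prod>i\<in>UNIV. ennreal (sqrt pi) * (\<Sum>x\<in>{..z i}. ennreal (?c i x * sqgamma (?a i) x (t $ i))))"
    proof (rule prod.cong[OF refl])
      fix i
      show "(\<integral>\<^sup>+p. ennreal (sqgamma (b i) (z i) p) * ennreal (exp (- (1 * (t $ i - p)\<^sup>2))) \<partial>lborel) =
         ennreal (sqrt pi) * (\<Sum>x\<in>{..z i}. ennreal (?c i x * sqgamma (?a i) x (t $ i)))"
        unfolding sqgamma_binomial_thinning[OF b[of i]] using c a[of i]
        by (subst sum_ennreal) (auto intro!: ennreal_mult' mult_nonneg_nonneg less_imp_le)
    qed
    also have "\<dots> = ennreal (sqrt pi) ^ CARD('n) * (\<Sum>x\<in>?P. \<Prod>i\<in>UNIV. ennreal (?c i (x i) * sqgamma (?a i) (x i) (t $ i)))"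
      by (subst prod.distrib, subst prod_sum_PiE) auto
    also have "ennreal (sqrt pi) ^ CARD('n) = ennreal (sqrt pi ^ CARD('n))" by (simp add: ennreal_power)
    also have "(\<Sum>x\<in>?P. \<Prod>i\<in>UNIV. ennreal (?c i (x i) * sqgamma (?a i) (x i) (t $ i))) =
       (\<Sum>x\<in>?P. ennreal (thinning ?\<rho> z x) * sqgamma_prod ?a x t)"
      by (simp only: fac)
    finally show ?thesis .
  qed
  have "ennreal (sqrt pi ^ CARD('n)) * (\<Sum>x\<in>?P. ennreal (thinning ?\<rho> z x) * mixture F ?a x) =
    (\<integral>\<^sup>+t. ennreal (sqrt pi ^ CARD('n)) * (\<Sum>x\<in>?P. ennreal (thinning ?\<rho> z x) *
       (ennreal (F t) * sqgamma_prod ?a x t)) \<partial>lborel)"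
    unfolding mixture_def by (simp add: nn_integral_cmult nn_integral_sum)
  also have "\<dots> = (\<integral>\<^sup>+t. ennreal (F t) * (\<integral>\<^sup>+p. ?T t p \<partial>lborel) \<partial>lborel)"
    unfolding conv by (intro nn_integral_cong) (simp add: sum_distrib_left mult_ac)
  also have "\<dots> = (\<integral>\<^sup>+t. (\<integral>\<^sup>+p. sqgamma_prod b z p * (ennreal (F t) * gauss 1 (t - p)) \<partial>lborel) \<partial>lborel)"
  proof (rule nn_integral_cong)
    fix t :: "real ^ 'n"
    have "?T t p =
      sqgamma_prod b z p * gauss 1 (t - p)" for p
      by (simp only: prod.distrib exp_norm_power2_cart vector_minus_component)
    then show "ennreal (F t) * (\<integral>\<^sup>+p. ?T t p \<partial>lborel) =
      (\<integral>\<^sup>+p. sqgamma_prod b z p * (ennreal (F t) * gauss 1 (t - p)) \<partial>lborel)"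
      by (subst nn_integral_cmult[symmetric]) (simp_all only: mult_ac, measurable)
  qed
  also have "\<dots> = (\<integral>\<^sup>+p. (\<integral>\<^sup>+t. sqgamma_prod b z p * (ennreal (F t) * gauss 1 (t - p)) \<partial>lborel) \<partial>lborel)"
    by (rule lborel_pair.Fubini') measurable
  also have "\<dots> = (\<integral>\<^sup>+p. sqgamma_prod b z p *
      smoothed F p \<partial>lborel)"
  proof (rule nn_integral_cong)
    fix p :: "real ^ 'n"
    have "(\<integral>\<^sup>+t. ennreal (F t) * gauss 1 (t - p) \<partial>lborel) =
      (\<integral>\<^sup>+w. ennreal (F (p + w)) * gauss 1 (p + w - p) \<partial>lborel)"
      by (rule nn_integral_lborel_shift[symmetric]) measurable
    then show "(\<integral>\<^sup>+t. sqgamma_prod b z p * (ennreal (F t) * gauss 1 (t - p)) \<partial>lborel) =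
      sqgamma_prod b z p *
      smoothed F p"
      by (subst nn_integral_cmult) simp_all
  qed
  finally show ?thesis .
qed

lemma nn_integral_mixture_scaled:
  fixes F :: "real ^ 'n::finite \<Rightarrow> real"
  assumes [measurable]: "F \<in> borel_measurable borel" and "\<And>x. 0 \<le> F x"
  shows "(\<integral>\<^sup>+p. sqgamma_prod b z p * ennreal (sqrt pi ^ CARD('n) * F p) \<partial>lborel) =
    ennreal (sqrt pi ^ CARD('n)) * mixture F b z"
  unfolding mixture_def using assms(2)
  by (subst nn_integral_cmult[symmetric]) (auto simp: ennreal_mult mult_ac intro!: nn_integral_cong)

lemma mixture_thinning_le:
  fixes F :: "real ^ 'n::finite \<Rightarrow> real"
  assumes F: "super_mean F" and b: "\<And>i. b i > 0"
  shows "(\<Sum>x\<in>PiE UNIV (\<lambda>i. {..z i}).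
      ennreal (thinning (\<lambda>i. 1 / (1 + b i)) z x) * mixture F (\<lambda>i. b i / (1 + b i)) x) \<le> mixture F b z" (is "?S \<le> _")
proof -
  have [measurable]: "F \<in> borel_measurable borel" and F0: "\<And>x. 0 \<le> F x"
    and AE: "AE p in lborel. smoothed F p
      < ennreal (sqrt pi ^ CARD('n) * F p)"
    using F by (auto simp: super_mean_def)
  have "ennreal (sqrt pi ^ CARD('n)) * ?S \<le> ennreal (sqrt pi ^ CARD('n)) * mixture F b z"
    unfolding mixture_thinning_eq[OF \<open>F \<in> borel_measurable borel\<close> b]
      nn_integral_mixture_scaled[OF \<open>F \<in> borel_measurable borel\<close> F0, symmetric]
    by (rule nn_integral_mono_AE) (use AE in \<open>eventually_elim, auto intro!: mult_left_mono\<close>)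
  then show ?thesis by (simp add: ennreal_mult_le_mult_iff)
qed

lemma super_mean_pos:
  fixes F :: "real ^ 'n::finite \<Rightarrow> real"
  assumes "super_mean F" shows "AE p in lborel. F p > 0"
proof -
  have "AE p in lborel. smoothed F p
      < ennreal (sqrt pi ^ CARD('n) * F p)"
    using assms by (auto simp: super_mean_def)
  then show ?thesis
  proof eventually_elim
    case (elim p)
    then have "0 < ennreal (sqrt pi ^ CARD('n) * F p)" by (rule le_less_trans[rotated]) simp
    then show ?case by (simp add: zero_less_mult_iff)
  qed
qed

lemma not_AE_lborel_False: "\<not> (AE x in (lborel :: 'a::euclidean_space measure). False)"
  by (simp add: AE_iff_null null_sets_def emeasure_lborel_UNIV)

lemma mixture_pos_0:
  fixes F :: "real ^ 'n::finite \<Rightarrow> real"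
  assumes F: "super_mean F" and a: "\<And>i. a i > 0"
  shows "mixture F a (\<lambda>_. 0) > 0"
proof -
  have [measurable]: "F \<in> borel_measurable borel" using F by (auto simp: super_mean_def)
  have "mixture F a (\<lambda>_. 0) \<noteq> 0"
  proof
    assume "mixture F a (\<lambda>_. 0) = 0"
    then have "AE t in lborel. ennreal (F t) * sqgamma_prod a (\<lambda>_. 0) t = 0"
      unfolding mixture_def by (subst (asm) nn_integral_0_iff_AE) measurable
    with super_mean_pos[OF F] have "AE t in (lborel :: (real ^ 'n) measure). False"
    proof eventually_elim
      case (elim t)
      have "sqgamma (a i) 0 (t $ i) > 0" for i using a[of i] Gamma_half_pos[of 0] by (simp add: sqgamma_def)
      then show ?case using elim by (auto simp: ennreal_eq_0_iff not_le[symmetric])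
    qed
    then show False using not_AE_lborel_False by blast
  qed
  then show ?thesis by (simp add: zero_less_iff_neq_zero)
qed

text \<open>At count 0 the posterior density is a centred Gaussian, dominated up to a constant by
  the one with the smallest rate; the integrability clause of \<open>super_mean\<close> applies to
  it.\<close>

lemma mixture_finite_0:
  fixes F :: "real ^ 'n::finite \<Rightarrow> real"
  assumes F: "super_mean F" and a: "\<And>i. a i > 0"
  shows "mixture F a (\<lambda>_. 0) < \<infinity>"
proof -
  have [measurable]: "F \<in> borel_measurable borel" using F by (auto simp: super_mean_def)
  define c where "c = Min (range a)"
  have c: "c > 0" "\<And>i. c \<le> a i" using a by (auto simp: c_def)
  define K where "K = (\<Prod>i\<in>UNIV. sqrt (a i) / Gamma (1 / 2))"
  have K0: "sqrt (a i) / Gamma (1 / 2) \<ge> 0" for i using Gamma_half_pos[of 0] a[of i] by simp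
  have "mixture F a (\<lambda>_. 0) \<le> (\<integral>\<^sup>+t. ennreal K * (ennreal (F t) * gauss c t) \<partial>lborel)"
    unfolding mixture_def
  proof (rule nn_integral_mono)
    fix t :: "real ^ 'n"
    have "sqgamma_prod a (\<lambda>_. 0) t \<le> (\<Prod>i\<in>UNIV. ennreal (sqrt (a i) / Gamma (1 / 2)) * ennreal (exp (- (c * (t $ i)\<^sup>2))))"
    proof (rule prod_mono_ennreal)
      fix i
      have "sqgamma (a i) 0 (t $ i) \<le> sqrt (a i) / Gamma (1 / 2) * exp (- (c * (t $ i)\<^sup>2))"
      proof -
        have "sqgamma (a i) 0 (t $ i) = sqrt (a i) / Gamma (1 / 2) * exp (- (a i * (t $ i)\<^sup>2))" by (simp add: sqgamma_def)
        also have "\<dots> \<le> sqrt (a i) / Gamma (1 / 2) * exp (- (c * (t $ i)\<^sup>2))"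
          by (rule mult_left_mono[OF _ K0]) (use c(2)[of i] in \<open>simp add: mult_right_mono\<close>)
        finally show ?thesis .
      qed
      then show "ennreal (sqgamma (a i) 0 (t $ i)) \<le> ennreal (sqrt (a i) / Gamma (1 / 2)) * ennreal (exp (- (c * (t $ i)\<^sup>2)))"
        using K0[of i] by (simp add: ennreal_mult'[symmetric] ennreal_leI del: times_divide_eq_left)
    qed
    also have "\<dots> = ennreal K * gauss c t"
      unfolding prod.distrib exp_norm_power2_cart K_def by (subst prod_ennreal) (use K0 in auto)
    finally show "ennreal (F t) * sqgamma_prod a (\<lambda>_. 0) t \<le> ennreal K * (ennreal (F t) * gauss c t)"
      by (subst mult.left_commute) (rule mult_left_mono, auto)
  qed
  also have "\<dots> < \<infinity>"
    using F c(1) by (subst nn_integral_cmult) (auto simp: super_mean_def ennreal_mult_less_top)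
  finally show ?thesis .
qed

text \<open>For total 0 the only thinned count is 0, and the weight is a Gaussian, positive
  everywhere, so the almost sure strict inequality survives integration. Finiteness of the larger
  integral is essential for this.\<close>

lemma mixture_strict_0:
  fixes F :: "real ^ 'n::finite \<Rightarrow> real"
  assumes F: "super_mean F" and b: "\<And>i. b i > 0"
  shows "mixture F (\<lambda>i. b i / (1 + b i)) (\<lambda>_. 0) < mixture F b (\<lambda>_. 0)"
proof -
  have Fm[measurable]: "F \<in> borel_measurable borel" and F0: "\<And>x. 0 \<le> F x"
    and AE: "AE p in lborel. smoothed F p
      < ennreal (sqrt pi ^ CARD('n) * F p)"
    using F by (auto simp: super_mean_def)
  let ?D = "\<lambda>p :: real ^ 'n. \<Prod>i\<in>UNIV. ennreal (sqgamma (b i) 0 (p $ i))"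
  let ?G = "\<lambda>p. \<integral>\<^sup>+w. ennreal (F (p + w)) * gauss 1 w \<partial>lborel"
  have P: "PiE UNIV (\<lambda>i::'n. {..0::nat}) = {\<lambda>_. 0}" by (auto simp: PiE_def fun_eq_iff)
  have D: "?D p \<noteq> 0" "?D p < \<infinity>" for p
  proof -
    have "sqgamma (b i) 0 (p $ i) > 0" for i using b[of i] Gamma_half_pos[of 0] by (simp add: sqgamma_def)
    then have "\<forall>i. ennreal (sqgamma (b i) 0 (p $ i)) \<noteq> 0" by (simp add: ennreal_eq_0_iff not_le)
    then show "?D p \<noteq> 0" by simp
    show "?D p < \<infinity>" by (subst prod_ennreal) (auto intro: sqgamma_nonneg[OF less_imp_le[OF b]])
  qed
  have lt: "AE p in lborel. ?D p * ?G p < ?D p * ennreal (sqrt pi ^ CARD('n) * F p)"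
    using AE
  proof eventually_elim
    case (elim p)
    then show ?case
      by (rule ennreal_mult_strict_left_mono) (use D[of p] in \<open>auto simp: zero_less_iff_neq_zero\<close>)
  qed
  have "(\<integral>\<^sup>+p. ?D p * ?G p \<partial>lborel) < (\<integral>\<^sup>+p. ?D p * ennreal (sqrt pi ^ CARD('n) * F p) \<partial>lborel)"
  proof (rule nn_integral_less)
    have "(\<integral>\<^sup>+p. ?D p * ?G p \<partial>lborel) \<le> (\<integral>\<^sup>+p. ?D p * ennreal (sqrt pi ^ CARD('n) * F p) \<partial>lborel)"
      by (rule nn_integral_mono_AE) (use lt in \<open>eventually_elim, auto\<close>)
    also have "\<dots> < \<infinity>"
      unfolding nn_integral_mixture_scaled[OF Fm F0] using mixture_finite_0[OF F b]
      by (simp add: ennreal_mult_less_top)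
    finally show "(\<integral>\<^sup>+p. ?D p * ?G p \<partial>lborel) \<noteq> \<infinity>" by simp
    show "AE p in lborel. ?D p * ?G p \<le> ?D p * ennreal (sqrt pi ^ CARD('n) * F p)"
      using lt by eventually_elim auto
    show "\<not> (AE p in lborel. ?D p * ennreal (sqrt pi ^ CARD('n) * F p) \<le> ?D p * ?G p)"
    proof
      assume "AE p in lborel. ?D p * ennreal (sqrt pi ^ CARD('n) * F p) \<le> ?D p * ?G p"
      with lt have "AE p in (lborel :: (real ^ 'n) measure). False" by eventually_elim auto
      then show False using not_AE_lborel_False by blast
    qed
  qed measurable
  then have "ennreal (sqrt pi ^ CARD('n)) * mixture F (\<lambda>i. b i / (1 + b i)) (\<lambda>_. 0) <
      ennreal (sqrt pi ^ CARD('n)) * mixture F b (\<lambda>_. 0)"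
    unfolding nn_integral_mixture_scaled[OF Fm F0]
      mixture_thinning_eq[OF Fm b, where z = "\<lambda>_. 0", symmetric] P by (simp add: thinning_def)
  then show ?thesis by (meson leD mult_left_mono not_le zero_le)
qed


section \<open>Growth of the posterior means in the counts\<close>

lemma power_div_fact_le_exp:
  assumes "s \<ge> 0" shows "s ^ y / fact y \<le> exp (s::real)"
proof -
  have "(\<Sum>k\<in>{y}. s ^ k /\<^sub>R fact k) \<le> (\<Sum>k. s ^ k /\<^sub>R fact k)"
    by (rule sum_le_suminf) (use assms summable_exp[of s] in \<open>auto simp: scaleR_conv_of_real\<close>)
  then show ?thesis by (simp add: exp_def divide_inverse mult.commute)
qed

text \<open>A bound, uniform in t, for the ratio of \<open>sqgamma b (x + y)\<close> to
  \<open>sqgamma a x\<close>: the normalising constants times the bound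
  \<open>fact y / (b - a) ^ y\<close> on what is left.\<close>

definition sqgamma_ratio :: "real \<Rightarrow> real \<Rightarrow> nat \<Rightarrow> nat \<Rightarrow> real" where
  "sqgamma_ratio a b x y = b ^ (x + y) * sqrt b / Gamma (real (x + y) + 1 / 2) *
    (Gamma (real x + 1 / 2) / (a ^ x * sqrt a)) * (fact y / (b - a) ^ y)"

lemma sqgamma_ratio_pos: "0 < a \<Longrightarrow> a < b \<Longrightarrow> sqgamma_ratio a b x y > 0"
  unfolding sqgamma_ratio_def
  by (intro mult_pos_pos divide_pos_pos Gamma_half_pos zero_less_power) auto

text \<open>With s = (b - a) t^2, s^y / y! is one term of the series of exp s, so the surplus rate b
  - a pays for the surplus power 2 y of t.\<close>

lemma sqgamma_compare:
  assumes "0 < a" "a < b"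
  shows "sqgamma b (x + y) t \<le> sqgamma_ratio a b x y * sqgamma a x t"
proof -
  have s: "(b - a) * t\<^sup>2 \<ge> 0" using assms by simp
  have "((b - a) * t\<^sup>2) ^ y / fact y \<le> exp ((b - a) * t\<^sup>2)" by (rule power_div_fact_le_exp[OF s])
  then have "(b - a) ^ y * (t ^ (2 * y)) \<le> fact y * exp ((b - a) * t\<^sup>2)"
    unfolding power_mult[of t 2 y] by (simp add: power_mult_distrib pos_divide_le_eq mult.commute)
  then have "t ^ (2 * y) \<le> fact y / (b - a) ^ y * exp ((b - a) * t\<^sup>2)"
    using assms by (simp add: pos_le_divide_eq mult.commute)
  then have "t ^ (2 * y) * exp (- ((b - a) * t\<^sup>2)) \<le> fact y / (b - a) ^ y * exp ((b - a) * t\<^sup>2) * exp (- ((b - a) * t\<^sup>2))"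
    by (rule mult_right_mono) simp
  also have "\<dots> = fact y / (b - a) ^ y" by (simp add: exp_minus)
  finally have key: "t ^ (2 * y) * exp (- ((b - a) * t\<^sup>2)) \<le> fact y / (b - a) ^ y" .
  let ?B = "b ^ (x + y) * sqrt b / Gamma (real (x + y) + 1 / 2)"
  have B: "?B \<ge> 0" using assms Gamma_half_pos[of "x + y"] by simp
  have "sqgamma b (x + y) t = ?B * (t ^ (2 * x) * exp (- (a * t\<^sup>2))) * (t ^ (2 * y) * exp (- ((b - a) * t\<^sup>2)))"
  proof -
    have "exp (- (b * t\<^sup>2)) = exp (- (a * t\<^sup>2)) * exp (- ((b - a) * t\<^sup>2))"
      by (simp add: algebra_simps flip: exp_add)
    then show ?thesis unfolding sqgamma_def distrib_left power_add by (simp only: mult_ac)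
  qed
  also have "\<dots> \<le> ?B * (t ^ (2 * x) * exp (- (a * t\<^sup>2))) * (fact y / (b - a) ^ y)"
    by (rule mult_left_mono[OF key]) (intro mult_nonneg_nonneg B; simp)
  also have "\<dots> = sqgamma_ratio a b x y * sqgamma a x t"
  proof -
    have "Gamma (real x + 1 / 2) / (a ^ x * sqrt a) * (a ^ x * sqrt a / Gamma (real x + 1 / 2)) = 1"
      using assms Gamma_half_pos[of x] by (simp add: less_imp_neq[symmetric])
    moreover have "X * A * B = (X * P * B) * (Q * A)" if "P * Q = 1" for X A B P Q :: real
      using that by algebra
    ultimately show ?thesis unfolding sqgamma_ratio_def sqgamma_def by blast
  qed
  finally show ?thesis .
qed

text \<open>Applied in two ways: with x = 0 and half the rate it bounds a mixture above by a
  constant multiple of its value at count 0; with y = 0 it carries lower bounds from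
  \<open>H\<close> over to \<open>h\<close>.\<close>

lemma mixture_compare:
  fixes F :: "real ^ 'n::finite \<Rightarrow> real"
  assumes [measurable]: "F \<in> borel_measurable borel" and ab: "\<And>i. 0 < a i" "\<And>i. a i < b i"
  shows "mixture F b (\<lambda>i. x i + y i) \<le> ennreal (\<Prod>i\<in>UNIV. sqgamma_ratio (a i) (b i) (x i) (y i)) * mixture F a x"
proof -
  let ?C = "\<Prod>i\<in>UNIV. sqgamma_ratio (a i) (b i) (x i) (y i)"
  have r: "sqgamma_ratio (a i) (b i) (x i) (y i) \<ge> 0" for i
    using sqgamma_ratio_pos[OF ab] by (rule less_imp_le)
  have "mixture F b (\<lambda>i. x i + y i) \<le> (\<integral>\<^sup>+t. ennreal ?C *
      (ennreal (F t) * sqgamma_prod a x t) \<partial>lborel)"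
    unfolding mixture_def
  proof (rule nn_integral_mono)
    fix t :: "real ^ 'n"
    have "(\<Prod>i\<in>UNIV. ennreal (sqgamma (b i) (x i + y i) (t $ i))) \<le>
      (\<Prod>i\<in>UNIV. ennreal (sqgamma_ratio (a i) (b i) (x i) (y i)) * ennreal (sqgamma (a i) (x i) (t $ i)))"
    proof (rule prod_mono_ennreal)
      fix i
      show "ennreal (sqgamma (b i) (x i + y i) (t $ i)) \<le> ennreal (sqgamma_ratio (a i) (b i) (x i) (y i)) * ennreal (sqgamma (a i) (x i) (t $ i))"
        unfolding ennreal_mult'[OF r, symmetric] by (intro ennreal_leI sqgamma_compare ab)
    qed
    also have "\<dots> = ennreal ?C * sqgamma_prod a x t"
      unfolding prod.distrib by (subst prod_ennreal) (use r in auto)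
    finally show "ennreal (F t) * (\<Prod>i\<in>UNIV. ennreal (sqgamma (b i) (x i + y i) (t $ i))) \<le>
      ennreal ?C * (ennreal (F t) * sqgamma_prod a x t)"
      by (subst mult.left_commute) (rule mult_left_mono, auto)
  qed
  also have "\<dots> = ennreal ?C * mixture F a x"
    unfolding mixture_def by (rule nn_integral_cmult) measurable
  finally show ?thesis .
qed

lemma sqgamma_ratio_0_right:
  assumes "0 < a" "a < b" shows "sqgamma_ratio a b x 0 = sqrt (b / a) * (b / a) ^ x"
proof -
  have "Gamma (real x + 1 / 2) \<noteq> 0" using Gamma_half_pos[of x] by linarith
  then show ?thesis unfolding sqgamma_ratio_def by (simp add: power_divide real_sqrt_divide mult.commute)
qed

text \<open>The base 8 is 2 * 4: 2 from a / (a - a / 2), 4 from the formula for Gamma at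
  half-integers. The factorials are absorbed by y! y! <= (2 y)!.\<close>

lemma sqgamma_ratio_half_le:
  assumes "a > 0" shows "sqgamma_ratio (a / 2) a 0 y \<le> sqrt 2 * 8 ^ y"
proof -
  have G: "Gamma (1 / 2) / Gamma (real y + 1 / 2) = 4 ^ y * fact y / fact (2 * y)"
    by (simp add: Gamma_half Gamma_one_half_real)
  have "(fact y * fact y :: nat) \<le> fact (2 * y)"
    using dvd_imp_le[OF fact_fact_dvd_fact[of y y]] by (simp add: mult_2)
  then have "(fact y * fact y :: real) \<le> fact (2 * y)" by (metis of_nat_fact of_nat_le_iff of_nat_mult)
  then have f: "fact y * fact y / fact (2 * y) \<le> (1::real)" by simp
  have "sqgamma_ratio (a / 2) a 0 y = (a / (a - a / 2)) ^ y * (sqrt a / sqrt (a / 2)) * (Gamma (1 / 2) / Gamma (real y + 1 / 2) * fact y)"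
    unfolding sqgamma_ratio_def by (simp add: power_divide mult_ac)
  also have "a / (a - a / 2) = 2" using assms by simp
  also have "sqrt a / sqrt (a / 2) = sqrt 2" using assms by (simp flip: real_sqrt_divide)
  also have "Gamma (1 / 2) / Gamma (real y + 1 / 2) * fact y = 4 ^ y * (fact y * fact y / fact (2 * y))"
    unfolding G by simp
  also have "2 ^ y * sqrt 2 * (4 ^ y * (fact y * fact y / fact (2 * y))) \<le> 2 ^ y * sqrt 2 * (4 ^ y * 1)"
    by (intro mult_left_mono f) auto
  also have "\<dots> = sqrt 2 * 8 ^ y" by (simp flip: power_mult_distrib)
  finally show ?thesis .
qed

text \<open>Linear growth of ln f follows from exponential bounds on both sides, and it is
  integrable against Poisson laws because \<open>two_pow\<close> dominates it.\<close>

definition log_linear :: "(('n::finite \<Rightarrow> nat) \<Rightarrow> real) \<Rightarrow> bool" where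
  "log_linear f \<longleftrightarrow> (\<exists>C. \<forall>z. \<bar>ln (f z)\<bar> \<le> C * (1 + (\<Sum>i\<in>UNIV. real (z i))))"

lemma ln_prod_power_bound:
  fixes D :: "'n::finite \<Rightarrow> real"
  assumes "K > 0" "\<And>i. D i > 0"
  shows "\<bar>ln (K * (\<Prod>i\<in>UNIV. D i ^ z i))\<bar> \<le> (\<bar>ln K\<bar> + (\<Sum>i\<in>UNIV. \<bar>ln (D i)\<bar>)) * (1 + (\<Sum>i\<in>UNIV. real (z i)))"
proof -
  have "ln (K * (\<Prod>i\<in>UNIV. D i ^ z i)) = ln K + (\<Sum>i\<in>UNIV. real (z i) * ln (D i))"
  proof -
    have nz: "D i \<noteq> 0" for i using assms(2)[of i] by simp
    have "(\<Prod>i\<in>UNIV. D i ^ z i) > 0" by (intro prod_pos zero_less_power assms(2))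
    then have "ln (K * (\<Prod>i\<in>UNIV. D i ^ z i)) = ln K + ln (\<Prod>i\<in>UNIV. D i ^ z i)"
      using assms(1) by (intro ln_mult_pos)
    also have "ln (\<Prod>i\<in>UNIV. D i ^ z i) = (\<Sum>i\<in>UNIV. ln (D i ^ z i))"
      by (rule ln_prod) (auto simp: nz)
    finally show ?thesis using assms(2) by (simp add: ln_realpow)
  qed
  also have "\<bar>\<dots>\<bar> \<le> \<bar>ln K\<bar> + (\<Sum>i\<in>UNIV. \<bar>real (z i) * ln (D i)\<bar>)"
    by (rule order_trans[OF abs_triangle_ineq]) (intro add_left_mono sum_abs)
  also have "\<dots> \<le> \<bar>ln K\<bar> * (1 + (\<Sum>i\<in>UNIV. real (z i))) + (\<Sum>i\<in>UNIV. \<bar>ln (D i)\<bar> * (1 + (\<Sum>i\<in>UNIV. real (z i))))"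
  proof (intro add_mono sum_mono)
    show "\<bar>ln K\<bar> \<le> \<bar>ln K\<bar> * (1 + (\<Sum>i\<in>UNIV. real (z i)))"
      by (simp add: distrib_left sum_nonneg)
    fix i
    have "real (z i) \<le> (\<Sum>i\<in>UNIV. real (z i))" by (rule member_le_sum) auto
    then have "\<bar>ln (D i)\<bar> * real (z i) \<le> \<bar>ln (D i)\<bar> * (1 + (\<Sum>i\<in>UNIV. real (z i)))"
      by (intro mult_left_mono) auto
    then show "\<bar>real (z i) * ln (D i)\<bar> \<le> \<bar>ln (D i)\<bar> * (1 + (\<Sum>i\<in>UNIV. real (z i)))"
      by (simp add: abs_mult mult.commute)
  qed
  finally show ?thesis by (simp add: distrib_right sum_distrib_right)
qed

lemma log_linearI:
  fixes D D' :: "'n::finite \<Rightarrow> real"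
  assumes "K > 0" "\<And>i. D i > 0" "K' > 0" "\<And>i. D' i > 0"
    "\<And>z. f z \<le> K * (\<Prod>i\<in>UNIV. D i ^ z i)" "\<And>z. K' * (\<Prod>i\<in>UNIV. D' i ^ z i) \<le> f z"
  shows "log_linear f"
proof -
  let ?C = "\<bar>ln K\<bar> + (\<Sum>i\<in>UNIV. \<bar>ln (D i)\<bar>)" and ?C' = "\<bar>ln K'\<bar> + (\<Sum>i\<in>UNIV. \<bar>ln (D' i)\<bar>)"
  have "\<bar>ln (f z)\<bar> \<le> (?C + ?C') * (1 + (\<Sum>i\<in>UNIV. real (z i)))" for z
  proof -
    let ?u = "K * (\<Prod>i\<in>UNIV. D i ^ z i)" and ?l = "K' * (\<Prod>i\<in>UNIV. D' i ^ z i)"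
    have l: "?l > 0" using assms by (intro mult_pos_pos prod_pos) auto
    have f: "f z > 0" using l assms(6)[of z] by linarith
    have "ln (f z) \<le> ln ?u" "ln ?l \<le> ln (f z)"
      using f l assms(5)[of z] assms(6)[of z] by (simp_all only: ln_mono)
    moreover have "0 \<le> ?C * (1 + (\<Sum>i\<in>UNIV. real (z i)))" "0 \<le> ?C' * (1 + (\<Sum>i\<in>UNIV. real (z i)))"
      by (intro mult_nonneg_nonneg add_nonneg_nonneg sum_nonneg; simp)+
    ultimately show ?thesis
      using ln_prod_power_bound[where K = K and D = D and z = z, OF assms(1,2)]
        ln_prod_power_bound[where K = K' and D = D' and z = z, OF assms(3,4)]
      unfolding distrib_right by linarith
  qed
  then show ?thesis unfolding log_linear_def by blast
qed

lemma mixture_upper: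
  fixes F :: "real ^ 'n::finite \<Rightarrow> real"
  assumes F: "super_mean F" and a: "\<And>i. a i > 0"
  shows "\<exists>K>0. \<forall>z. mixture F a z \<le> ennreal (K * (\<Prod>i\<in>UNIV. 8 ^ z i))"
proof -
  have Fm: "F \<in> borel_measurable borel" using F by (auto simp: super_mean_def)
  have a2: "\<And>i. a i / 2 > 0" "\<And>i. a i / 2 < a i" using a by simp_all
  obtain m where m: "mixture F (\<lambda>i. a i / 2) (\<lambda>_. 0) = ennreal m" "m > 0"
    using mixture_pos_0[where a = "\<lambda>i. a i / 2", OF F a2(1)] mixture_finite_0[where a = "\<lambda>i. a i / 2", OF F a2(1)]
    by (cases "mixture F (\<lambda>i. a i / 2) (\<lambda>_. 0)") auto
  let ?K = "sqrt 2 ^ CARD('n) * m"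
  have "mixture F a z \<le> ennreal (?K * (\<Prod>i\<in>UNIV. 8 ^ z i))" for z
  proof -
    have "mixture F a (\<lambda>i. 0 + z i) \<le> ennreal (\<Prod>i\<in>UNIV. sqgamma_ratio (a i / 2) (a i) 0 (z i)) * mixture F (\<lambda>i. a i / 2) (\<lambda>_. 0)"
      by (rule mixture_compare[where a = "\<lambda>i. a i / 2" and b = a, OF Fm a2])
    also have "\<dots> \<le> ennreal (\<Prod>i\<in>UNIV. sqrt 2 * 8 ^ z i) * mixture F (\<lambda>i. a i / 2) (\<lambda>_. 0)"
      by (intro mult_right_mono ennreal_leI prod_mono conjI sqgamma_ratio_half_le a
          less_imp_le[OF sqgamma_ratio_pos[OF a2]]) simp
    also have "\<dots> = ennreal (?K * (\<Prod>i\<in>UNIV. 8 ^ z i))"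
      unfolding m(1) prod.distrib using m(2)
      by (subst ennreal_mult[symmetric]) (auto intro!: arg_cong[where f = ennreal] simp: prod_nonneg)
    finally show ?thesis by simp
  qed
  moreover have "?K > 0" using m(2) by simp
  ultimately show ?thesis by blast
qed

lemma thinning_0: "thinning \<rho> z (\<lambda>_. 0) = (\<Prod>i\<in>UNIV. (1 - \<rho> i) ^ z i)"
  by (simp add: thinning_def)

text \<open>Here b is the rate of t given the totals and a the rate given x alone, so that 1 / a - 1
  / b = 1. For b = s / r the number \<rho> is r / (r + s), the probability that a point of the total
  belongs to x.\<close>

locale mixture_pair =
  fixes F :: "real ^ 'n::finite \<Rightarrow> real" and b :: "'n \<Rightarrow> real"
  assumes F: "super_mean F" and b: "\<And>i. b i > 0"
begin

definition a :: "'n \<Rightarrow> real" where "a i = b i / (1 + b i)"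
definition \<rho> :: "'n \<Rightarrow> real" where "\<rho> i = 1 / (1 + b i)"
definition h :: "('n \<Rightarrow> nat) \<Rightarrow> real" where "h z = enn2real (mixture F a z)"
definition H :: "('n \<Rightarrow> nat) \<Rightarrow> real" where "H z = enn2real (mixture F b z)"

lemma Fm: "F \<in> borel_measurable borel" and F_nonneg: "0 \<le> F x"
  using F by (auto simp: super_mean_def)

lemma a_pos: "a i > 0" and a_less: "a i < b i" and \<rho>: "0 < \<rho> i" "\<rho> i < 1"
  using b[of i] mult_pos_pos[OF b b, of i i] by (auto simp: a_def \<rho>_def field_simps)

lemma mixture_h: "mixture F a z = ennreal (h z)"
  and mixture_H: "mixture F b z = ennreal (H z)"
proof -
  have fin: "mixture F c z < \<infinity>" if c: "\<And>i. c i > 0" for c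
  proof -
    obtain K where "mixture F c z \<le> ennreal (K * (\<Prod>i\<in>UNIV. 8 ^ z i))" using mixture_upper[where a = c, OF F c] by blast
    also have "\<dots> < \<infinity>" by simp
    finally show ?thesis .
  qed
  show "mixture F a z = ennreal (h z)" using fin[of a] a_pos by (simp add: h_def)
  show "mixture F b z = ennreal (H z)" using fin[of b] b by (simp add: H_def)
qed

lemma h_nonneg: "h z \<ge> 0" and H_nonneg: "H z \<ge> 0"
  by (simp_all add: h_def H_def)

lemma h_0_pos: "h (\<lambda>_. 0) > 0"
  using mixture_pos_0[where a = a, OF F a_pos] by (simp add: mixture_h)

lemma thinning_nn: "thinning \<rho> z x \<ge> 0"
  using \<rho> by (intro thinning_nonneg) (auto intro: less_imp_le)

lemma thinning_sum_le: "(\<Sum>x\<in>PiE UNIV (\<lambda>i. {..z i}). thinning \<rho> z x * h x) \<le> H z"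
proof -
  have "ennreal (\<Sum>x\<in>PiE UNIV (\<lambda>i. {..z i}). thinning \<rho> z x * h x) =
      (\<Sum>x\<in>PiE UNIV (\<lambda>i. {..z i}). ennreal (thinning \<rho> z x) * mixture F a x)"
    using thinning_nn h_nonneg by (simp add: mixture_h ennreal_mult flip: sum_ennreal)
  also have "\<dots> \<le> mixture F b z"
    using mixture_thinning_le[where b = b and z = z, OF F b] by (simp add: a_def[abs_def] \<rho>_def[abs_def])
  finally show ?thesis using H_nonneg by (simp add: mixture_H)
qed

lemma h_0_less_H_0: "h (\<lambda>_. 0) < H (\<lambda>_. 0)"
proof -
  have "mixture F a (\<lambda>_. 0) < mixture F b (\<lambda>_. 0)"
    using mixture_strict_0[where b = b, OF F b] by (simp add: a_def[abs_def])
  then show ?thesis using h_nonneg by (simp add: mixture_h mixture_H ennreal_less_iff)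
qed

text \<open>Only the term x = 0 of the thinned average is kept.\<close>

lemma H_lower: "h (\<lambda>_. 0) * (\<Prod>i\<in>UNIV. (1 - \<rho> i) ^ z i) \<le> H z"
proof -
  have "thinning \<rho> z (\<lambda>_. 0) * h (\<lambda>_. 0) \<le> (\<Sum>x\<in>PiE UNIV (\<lambda>i. {..z i}). thinning \<rho> z x * h x)"
    by (rule member_le_sum) (auto intro!: mult_nonneg_nonneg thinning_nn h_nonneg finite_PiE)
  then show ?thesis using thinning_sum_le[of z] by (simp add: thinning_0 mult.commute)
qed

lemma H_pos: "H z > 0"
proof -
  have "h (\<lambda>_. 0) * (\<Prod>i\<in>UNIV. (1 - \<rho> i) ^ z i) > 0"
    using h_0_pos \<rho> by (intro mult_pos_pos prod_pos zero_less_power) auto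
  then show ?thesis using H_lower[of z] by linarith
qed

text \<open>Comparison of densities with y = 0 bounds \<open>H z\<close> by an explicit multiple of
  \<open>h z\<close>, so the lower bound on \<open>H\<close> passes to \<open>h\<close>.\<close>

lemma h_lower: "h (\<lambda>_. 0) * (\<Prod>i\<in>UNIV. sqrt (a i / b i)) * (\<Prod>i\<in>UNIV. ((1 - \<rho> i) * (a i / b i)) ^ z i) \<le> h z"
proof -
  let ?c = "\<Prod>i\<in>UNIV. sqgamma_ratio (a i) (b i) (z i) 0"
  have c: "?c > 0" by (intro prod_pos sqgamma_ratio_pos a_pos a_less)
  have "mixture F b (\<lambda>i. z i + 0) \<le> ennreal ?c * mixture F a z"
    using mixture_compare[where a = a and b = b and x = z and y = "\<lambda>_. 0", OF Fm a_pos a_less] by simp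
  then have "H z \<le> ?c * h z"
    using c h_nonneg by (simp add: mixture_h mixture_H ennreal_mult[symmetric] less_imp_le)
  then have "h (\<lambda>_. 0) * (\<Prod>i\<in>UNIV. (1 - \<rho> i) ^ z i) / ?c \<le> h z"
    using H_lower[of z] c by (simp add: pos_divide_le_eq mult.commute)
  moreover have "1 / ?c = (\<Prod>i\<in>UNIV. sqrt (a i / b i)) * (\<Prod>i\<in>UNIV. (a i / b i) ^ z i)"
  proof -
    have "1 / ?c = (\<Prod>i\<in>UNIV. 1 / sqgamma_ratio (a i) (b i) (z i) 0)"
      by (simp only: prod_dividef prod.neutral_const)
    also have "\<dots> = (\<Prod>i\<in>UNIV. sqrt (a i / b i) * (a i / b i) ^ z i)"
      by (simp add: sqgamma_ratio_0_right[OF a_pos a_less] real_sqrt_divide power_divide)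
    finally show ?thesis by (simp only: prod.distrib)
  qed
  moreover have "h (\<lambda>_. 0) * Q * (P * R) = h (\<lambda>_. 0) * P / c" if "1 / c = Q * R" for Q P R c :: real
    using that by (metis (no_types) mult.assoc mult.commute mult.right_neutral times_divide_eq_right)
  ultimately show ?thesis
    by (simp only: power_mult_distrib prod.distrib)
qed

lemma h_pos: "h z > 0"
proof -
  have "h (\<lambda>_. 0) * (\<Prod>i\<in>UNIV. sqrt (a i / b i)) * (\<Prod>i\<in>UNIV. ((1 - \<rho> i) * (a i / b i)) ^ z i) > 0"
    using h_0_pos \<rho> a_pos b by (intro mult_pos_pos prod_pos zero_less_power) auto
  then show ?thesis using h_lower[of z] by linarith
qed

lemma log_linear_h: "log_linear h" and log_linear_H: "log_linear H"
proof -
  obtain K where K: "K > 0" "\<And>z. mixture F a z \<le> ennreal (K * (\<Prod>i\<in>UNIV. 8 ^ z i))"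
    using mixture_upper[where a = a, OF F a_pos] by blast
  have "h z \<le> K * (\<Prod>i\<in>UNIV. 8 ^ z i)" for z
    using K(1) K(2)[of z] by (simp add: mixture_h prod_nonneg)
  then show "log_linear h"
    by (rule log_linearI[rotated 4, OF _ h_lower])
       (use K h_0_pos \<rho> a_pos b in \<open>auto intro!: mult_pos_pos prod_pos\<close>)
  obtain L where L: "L > 0" "\<And>z. mixture F b z \<le> ennreal (L * (\<Prod>i\<in>UNIV. 8 ^ z i))"
    using mixture_upper[where a = b, OF F b] by blast
  have "H z \<le> L * (\<Prod>i\<in>UNIV. 8 ^ z i)" for z
    using L(1) L(2)[of z] by (simp add: mixture_H prod_nonneg)
  then show "log_linear H"
    by (rule log_linearI[rotated 4, OF _ H_lower])
       (use L h_0_pos \<rho> in auto)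
qed

end

section \<open>Bayesian predictive distributions\<close>

text \<open>The integral of l^z exp (- t l) against l^(-1/2) over the half-line.\<close>

definition gamma_weight :: "real \<Rightarrow> nat \<Rightarrow> real" where
  "gamma_weight t z = Gamma (real z + 1 / 2) / (t ^ z * sqrt t)"

lemma gamma_weight_pos: "t > 0 \<Longrightarrow> gamma_weight t z > 0"
  unfolding gamma_weight_def by (intro divide_pos_pos Gamma_half_pos mult_pos_pos) auto

lemma jeffreys_sq_density:
  fixes l :: "real ^ 'n::finite"
  assumes g: "\<And>i. g i > 0"
  shows "indicator pos_orthant l * jeffreys_prior l =
    (\<Prod>i\<in>UNIV. sqrt (g i)) * (\<Prod>i\<in>UNIV. sq_density (g i) (l $ i))"
proof (cases "l \<in> pos_orthant")
  case True
  then have l: "l $ i > 0" for i by (simp add: pos_orthant_def)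
  have "(\<Prod>i\<in>UNIV. sqrt (g i)) * (\<Prod>i\<in>UNIV. sq_density (g i) (l $ i)) = (\<Prod>i\<in>UNIV. (l $ i) powr (- 1 / 2))"
    unfolding prod.distrib[symmetric]
  proof (rule prod.cong[OF refl])
    fix i
    have "(l $ i) powr (- (1 / 2)) = 1 / sqrt (l $ i)"
      using l[of i] by (simp add: powr_minus powr_half_sqrt inverse_eq_divide)
    then show "sqrt (g i) * sq_density (g i) (l $ i) = (l $ i) powr (- 1 / 2)"
      using l[of i] g[of i] by (simp add: sq_density_def real_sqrt_mult)
  qed
  then show ?thesis using True by (simp add: jeffreys_prior_def)
next
  case False
  then obtain i where "\<not> 0 < l $ i" by (auto simp: pos_orthant_def)
  then have "(\<Prod>i\<in>UNIV. sq_density (g i) (l $ i)) = 0" by (auto simp: sq_density_def)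
  then show ?thesis using False by simp
qed

text \<open>Numerator and denominator of \<open>bayes_pred\<close> in one form, via the substitution
  l = g t^2. It produces sqrt (t^2) = |t| inside \<open>G\<close>, hence the evenness
  assumption.\<close>

lemma lebesgue_integral_gamma_prior:
  fixes G :: "real ^ 'n::finite \<Rightarrow> real"
  assumes G[measurable]: "G \<in> borel_measurable borel" and G0: "\<And>x. 0 \<le> G x"
    and Gabs: "\<And>x. G (\<chi> i. \<bar>x $ i\<bar>) = G x"
    and g: "\<And>i. g i > 0" and t: "\<And>i. t i > 0" and c: "c \<ge> 0"
    and m: "mixture G (\<lambda>i. t i * g i) z = ennreal m" "m \<ge> 0"
    and f: "\<And>l. l \<in> pos_orthant \<Longrightarrow> f l = c * (\<Prod>i\<in>UNIV. (l $ i) ^ z i * exp (- (t i * l $ i))) *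
      (G (\<chi> i. sqrt (l $ i / g i)) * jeffreys_prior l)"
  shows "(LINT l:pos_orthant|lborel. f l) = c * (\<Prod>i\<in>UNIV. gamma_weight (t i) (z i)) * m"
proof -
  let ?D = "\<lambda>l. \<Prod>i\<in>UNIV. ennreal (sq_density (g i) (l $ i))"
  let ?Q = "\<lambda>x. \<Prod>i\<in>UNIV. ennreal (sqgamma (t i * g i) (z i) (x $ i))"
  let ?P = "\<lambda>x. \<Prod>i\<in>UNIV. sqgamma (t i * g i) (z i) (x $ i)"
  let ?W = "\<Prod>i\<in>UNIV. gamma_weight (t i) (z i)"
  have [measurable]: "(\<lambda>l :: real ^ 'n. \<chi> i. sqrt (l $ i / g i)) \<in> borel_measurable borel"
    by (intro borel_measurable_continuous_onI continuous_on_vec_lambda continuous_intros) (use g in \<open>auto simp: less_imp_neq[symmetric]\<close>)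
  let ?k = "\<lambda>l :: real ^ 'n. c * (\<Prod>i\<in>UNIV. (l $ i) ^ z i * exp (- (t i * l $ i))) * G (\<chi> i. sqrt (l $ i / g i))"
  let ?S = "\<Prod>i\<in>UNIV. sqrt (g i)"
  let ?q = "\<lambda>l :: real ^ 'n. \<Prod>i\<in>UNIV. sq_density (g i) (l $ i)"
  have eq: "indicator pos_orthant l *\<^sub>R f l = ?k l * (?S * ?q l)" for l
    using f[of l] jeffreys_sq_density[where g = g and l = l, OF g] by (cases "l \<in> pos_orthant") (auto simp: mult_ac)
  have S0: "?S \<ge> 0" using g by (intro prod_nonneg) (auto intro: less_imp_le)
  have q0: "?q l \<ge> 0" for l using g by (intro prod_nonneg) auto
  have nonneg: "?k l * (?S * ?q l) \<ge> 0" for l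
  proof (cases "l \<in> pos_orthant")
    case True
    then have "?k l \<ge> 0" using c G0 by (auto intro!: mult_nonneg_nonneg prod_nonneg simp: pos_orthant_def less_imp_le)
    then show ?thesis using S0 q0 by simp
  next
    case False
    then obtain i where "\<not> 0 < l $ i" by (auto simp: pos_orthant_def)
    then have "?q l = 0" by (auto simp: sq_density_def)
    then show ?thesis by (simp only: mult_zero_right order_refl)
  qed
  have "(LINT l:pos_orthant|lborel. f l) = (LINT l|lborel. ?k l * (?S * ?q l))"
    unfolding set_lebesgue_integral_def eq ..
  also have "\<dots> = enn2real (\<integral>\<^sup>+l. ennreal (?k l * (?S * ?q l)) \<partial>lborel)"
    by (rule integral_eq_nn_integral) (use nonneg in auto)
  also have "(\<integral>\<^sup>+l. ennreal (?k l * (?S * ?q l)) \<partial>lborel) = (\<integral>\<^sup>+l. ennreal (?S * ?k l) * ?D l \<partial>lborel)"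
  proof (rule nn_integral_cong)
    fix l :: "real ^ 'n"
    have "?D l = ennreal (?q l)" using g by (intro prod_ennreal) auto
    then show "ennreal (?k l * (?S * ?q l)) = ennreal (?S * ?k l) * ?D l"
      using q0[of l] by (simp only: ennreal_mult''[symmetric]) (simp only: mult_ac)
  qed
  also have "\<dots> = (\<integral>\<^sup>+x. ennreal (?S * ?k (\<chi> i. g i * (x $ i)\<^sup>2)) \<partial>lborel)"
    by (rule nn_integral_squares[where F = "\<lambda>l. ennreal (?S * ?k l)", OF g]) measurable
  also have "\<dots> = (\<integral>\<^sup>+x. ennreal (c * ?W) *
      (ennreal (G x) * ?Q x) \<partial>lborel)"
  proof (rule nn_integral_cong)
    fix x :: "real ^ 'n"
    have Gx: "G (\<chi> i. sqrt (g i * (x $ i)\<^sup>2 / g i)) = G x"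
    proof -
      have "(\<chi> i. sqrt (g i * (x $ i)\<^sup>2 / g i)) = (\<chi> i. \<bar>x $ i\<bar>)"
        using g by (simp add: vec_eq_iff less_imp_neq[symmetric])
      then show ?thesis using Gabs by simp
    qed
    have "sqrt (g i) * ((g i * (x $ i)\<^sup>2) ^ z i * exp (- (t i * (g i * (x $ i)\<^sup>2)))) =
        gamma_weight (t i) (z i) * sqgamma (t i * g i) (z i) (x $ i)" for i
    proof -
      have "Gamma (real (z i) + 1 / 2) \<noteq> 0" using Gamma_half_pos[of "z i"] by linarith
      moreover have "t i \<noteq> 0" "sqrt (t i) \<noteq> 0" using t[of i] by auto
      moreover have "(g i * (x $ i)\<^sup>2) ^ z i = g i ^ z i * (x $ i) ^ (2 * z i)"
        by (simp only: power_mult_distrib power_mult)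
      moreover have "(t i * g i) ^ z i * sqrt (t i * g i) = (t i ^ z i * sqrt (t i)) * (g i ^ z i * sqrt (g i))"
        by (simp add: power_mult_distrib real_sqrt_mult)
      ultimately show ?thesis unfolding gamma_weight_def sqgamma_def by (simp add: mult.assoc) 
    qed
    then have "?S * (\<Prod>i\<in>UNIV. (g i * (x $ i)\<^sup>2) ^ z i * exp (- (t i * (g i * (x $ i)\<^sup>2)))) =
      ?W * ?P x"
      unfolding prod.distrib[symmetric] by (simp only:)
    then have "?S * ?k (\<chi> i. g i * (x $ i)\<^sup>2) = (c * ?W) *
       (G x * ?P x)"
      unfolding vec_lambda_beta Gx by algebra
    moreover have "0 \<le> c * ?W"
      using c gamma_weight_pos[OF t] by (intro mult_nonneg_nonneg prod_nonneg) (auto intro: less_imp_le)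
    moreover have "?Q x = ennreal (?P x)"
      by (intro prod_ennreal sqgamma_nonneg mult_nonneg_nonneg less_imp_le t g)
    ultimately show "ennreal (?S * ?k (\<chi> i. g i * (x $ i)\<^sup>2)) = ennreal (c * ?W) *
      (ennreal (G x) * ?Q x)"
      by (simp only: ennreal_mult' G0)
  qed
  also have "\<dots> = ennreal (c * ?W) * mixture G (\<lambda>i. t i * g i) z"
    unfolding mixture_def by (rule nn_integral_cmult) measurable
  also have "enn2real \<dots> = c * ?W * m"
    using c m gamma_weight_pos[OF t] by (simp add: enn2real_mult prod_nonneg less_imp_le)
  finally show ?thesis .
qed

text \<open>A product of negative binomial masses, with shape x i + 1/2 and success probability r /
  (r + s). The form by weights is the quotient of the two integrals in
  \<open>bayes_pred\<close>.\<close>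

definition neg_binomial :: "real ^ 'n::finite \<Rightarrow> real ^ 'n \<Rightarrow> ('n \<Rightarrow> nat) \<Rightarrow> ('n \<Rightarrow> nat) \<Rightarrow> real" where
  "neg_binomial r s x y = (\<Prod>i\<in>UNIV. (s $ i) ^ y i / fact (y i) *
     gamma_weight (r $ i + s $ i) (x i + y i) / gamma_weight (r $ i) (x i))"

text \<open>The likelihoods of x and y multiply to that of x + y at rate r + s, up to a factor free
  of l. So the quotient splits into the Jeffreys part and the ratio of posterior means.\<close>

lemma bayes_pred_mixture:
  fixes G :: "real ^ 'n::finite \<Rightarrow> real"
  assumes G: "G \<in> borel_measurable borel" "\<And>x. 0 \<le> G x" "\<And>x. G (\<chi> i. \<bar>x $ i\<bar>) = G x"
    and g: "\<And>i. g i > 0" and r: "\<And>i. r $ i > 0" and s: "\<And>i. s $ i > 0"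
    and h: "\<And>z. mixture G (\<lambda>i. r $ i * g i) z = ennreal (h z)" "\<And>z. h z \<ge> 0"
    and H: "\<And>z. mixture G (\<lambda>i. (r $ i + s $ i) * g i) z = ennreal (H z)" "\<And>z. H z \<ge> 0"
  shows "bayes_pred r s (\<lambda>l. G (\<chi> i. sqrt (l $ i / g i)) * jeffreys_prior l) x y =
    neg_binomial r s x y * H (\<lambda>i. x i + y i) / h x"
proof -
  let ?c = "\<Prod>i\<in>UNIV. (r $ i) ^ x i / fact (x i)" and ?d = "\<Prod>i\<in>UNIV. (s $ i) ^ y i / fact (y i)"
  have rs: "r $ i + s $ i > 0" for i using r[of i] s[of i] by linarith
  have c: "?c > 0" "?d > 0" using r s by (auto intro!: prod_pos)
  let ?\<pi> = "\<lambda>l. G (\<chi> i. sqrt (l $ i / g i)) * jeffreys_prior l"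
  have p1: "poisson_lik r l x = ?c * (\<Prod>i\<in>UNIV. (l $ i) ^ x i * exp (- (r $ i * l $ i)))" for l :: "real ^ 'n"
    unfolding poisson_lik_def prod.distrib[symmetric] by (simp add: power_mult_distrib mult.assoc)
  have p2: "poisson_lik r l x * poisson_lik s l y = (?c * ?d) * (\<Prod>i\<in>UNIV. (l $ i) ^ (x i + y i) * exp (- ((r $ i + s $ i) * l $ i)))" for l :: "real ^ 'n"
    unfolding poisson_lik_def prod.distrib[symmetric]
    by (rule prod.cong[OF refl]) (simp add: power_mult_distrib power_add distrib_right exp_add exp_diff exp_minus field_simps)
  have "(LINT l:pos_orthant|lborel. poisson_lik r l x * ?\<pi> l) = ?c * (\<Prod>i\<in>UNIV. gamma_weight (r $ i) (x i)) * h x"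
    by (rule lebesgue_integral_gamma_prior[where g = g and G = G, OF G g r _ h]) (use c p1 in auto)
  moreover have "(LINT l:pos_orthant|lborel. poisson_lik r l x * poisson_lik s l y * ?\<pi> l) =
      (?c * ?d) * (\<Prod>i\<in>UNIV. gamma_weight (r $ i + s $ i) (x i + y i)) * H (\<lambda>i. x i + y i)"
    by (rule lebesgue_integral_gamma_prior[where g = g and G = G, OF G g rs _ H]) (use c p2 in auto)
  ultimately have "bayes_pred r s ?\<pi> x y =
    ((?c * ?d) * (\<Prod>i\<in>UNIV. gamma_weight (r $ i + s $ i) (x i + y i)) * H (\<lambda>i. x i + y i)) /
    (?c * (\<Prod>i\<in>UNIV. gamma_weight (r $ i) (x i)) * h x)"
    by (simp add: bayes_pred_def)
  also have "\<dots> = (?d * (\<Prod>i\<in>UNIV. gamma_weight (r $ i + s $ i) (x i + y i)) / (\<Prod>i\<in>UNIV. gamma_weight (r $ i) (x i))) * H (\<lambda>i. x i + y i) / h x"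
  proof -
    have "((c * d) * u * v) / (c * w * k) = (d * u / w) * v / k" if "c > 0" for c d u v w k :: real
      using that by simp
    from this[OF c(1)] show ?thesis .
  qed
  also have "?d * (\<Prod>i\<in>UNIV. gamma_weight (r $ i + s $ i) (x i + y i)) / (\<Prod>i\<in>UNIV. gamma_weight (r $ i) (x i)) = neg_binomial r s x y"
    unfolding neg_binomial_def prod.distrib[symmetric] prod_dividef[symmetric] ..
  finally show ?thesis .
qed

lemma mixture_one: "(\<And>i. a i > 0) \<Longrightarrow> mixture (\<lambda>_. 1) a z = 1"
  unfolding mixture_def
  by (simp add: nn_integral_lborel_prod_cart[of "\<lambda>i t. ennreal (sqgamma (a i) (z i) t)"] nn_integral_sqgamma)

lemma bayes_pred_jeffreys:
  assumes "\<And>i. r $ i > 0" "\<And>i. s $ i > 0"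
  shows "bayes_pred r s jeffreys_prior x y = neg_binomial r s x y"
proof -
  have "r $ i + s $ i > 0" for i using assms(1)[of i] assms(2)[of i] by linarith
  then show ?thesis
    using bayes_pred_mixture[where G = "\<lambda>_. 1" and g = "\<lambda>_. 1" and r = r and s = s and h = "\<lambda>_. 1" and H = "\<lambda>_. 1" and x = x and y = y] assms
    by (simp add: mixture_one)
qed

section \<open>Sums over independent Poisson counts\<close>

text \<open>A common dominating weight for \<open>tame\<close> and \<open>log_linear\<close>
  functions. It is multiplicative, so it splits over x + y.\<close>

definition two_pow :: "('n::finite \<Rightarrow> nat) \<Rightarrow> real" where
  "two_pow z = (\<Prod>i\<in>UNIV. 2 ^ z i)"

lemma two_pow_ge_1: "two_pow z \<ge> 1"
  unfolding two_pow_def by (intro prod_ge_1) auto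

lemma two_pow_add: "two_pow (\<lambda>i. x i + y i) = two_pow x * two_pow y"
  by (simp add: two_pow_def power_add prod.distrib)

lemma two_pow_component: "2 ^ z i \<le> two_pow z"
proof -
  have "two_pow z = 2 ^ z i * (\<Prod>j\<in>UNIV - {i}. 2 ^ z j)"
    unfolding two_pow_def by (rule prod.remove) auto
  moreover have "(\<Prod>j\<in>UNIV - {i}. (2::real) ^ z j) \<ge> 1" by (intro prod_ge_1) auto
  ultimately show ?thesis by simp
qed

lemma two_pow_sum: "1 + (\<Sum>i\<in>UNIV. real (z i)) \<le> two_pow z"
proof -
  have "1 + (\<Sum>i\<in>I. real (z i)) \<le> (\<Prod>i\<in>I. 2 ^ z i)" if "finite I" for I
    using that
  proof (induction I)
    case (insert j I)
    have n: "1 + real (z j) \<le> 2 ^ z j"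
      using Bernoulli_inequality[of 1 "z j"] by simp
    have "1 + (\<Sum>i\<in>insert j I. real (z i)) \<le> (1 + real (z j)) * (1 + (\<Sum>i\<in>I. real (z i)))"
      using insert by (simp add: algebra_simps sum_nonneg)
    also have "\<dots> \<le> 2 ^ z j * (\<Prod>i\<in>I. 2 ^ z i)"
      by (intro mult_mono n insert add_nonneg_nonneg sum_nonneg) auto
    finally show ?case using insert by simp
  qed simp
  then show ?thesis by (simp add: two_pow_def)
qed

lemma poisson_lik_pos:
  assumes "\<And>i. t $ i > 0" "\<And>i. l $ i > 0" shows "poisson_lik t l x > 0"
  unfolding poisson_lik_def
  by (intro prod_pos divide_pos_pos mult_pos_pos zero_less_power assms) auto

definition pois :: "real \<Rightarrow> nat \<Rightarrow> real" where "pois \<mu> k = \<mu> ^ k * exp (- \<mu>) / fact k"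

lemma poisson_lik_eq: "poisson_lik t l x = (\<Prod>i\<in>UNIV. pois (t $ i * l $ i) (x i))"
  by (simp add: poisson_lik_def pois_def)

lemma pois_tame:
  assumes "tame F"
  shows "(\<lambda>k. norm (pois \<mu> k * F k)) summable_on UNIV" "(\<Sum>\<^sub>\<infinity>k. pois \<mu> k * F k) = poisson_mean \<mu> F"
proof -
  have eq: "(\<lambda>k. pois \<mu> k * F k) = (\<lambda>k. exp (- \<mu>) * (F k / fact k * \<mu> ^ k))"
    by (simp add: pois_def fun_eq_iff)
  have abs: "summable (\<lambda>k. norm (pois \<mu> k * F k))"
  proof -
    have "norm (pois \<mu> k * F k) = exp (- \<mu>) * \<bar>F k / fact k * \<mu> ^ k\<bar>" for k
      using fun_cong[OF eq, of k] by (simp only: real_norm_def abs_mult abs_exp_cancel)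
    then show ?thesis using summable_mult[OF tame_summable_abs[OF assms, of \<mu>], of "exp (- \<mu>)"] by (simp only:)
  qed
  have "(\<lambda>k. pois \<mu> k * F k) sums poisson_mean \<mu> F"
    unfolding eq poisson_mean_def by (intro sums_mult summable_sums tame_summable assms)
  then have "((\<lambda>k. pois \<mu> k * F k) has_sum poisson_mean \<mu> F) UNIV"
    by (rule norm_summable_imp_has_sum[OF abs])
  then show "(\<Sum>\<^sub>\<infinity>k. pois \<mu> k * F k) = poisson_mean \<mu> F" "(\<lambda>k. norm (pois \<mu> k * F k)) summable_on UNIV"
    using infsumI has_sum_imp_summable summable_on_iff_abs_summable_on_real[of "\<lambda>k. pois \<mu> k * F k" UNIV]
    by fast+
qed

lemma poisson_marginal:
  assumes "tame F"
  shows "(\<Sum>\<^sub>\<infinity>x. poisson_lik t l x * F (x i)) = poisson_mean (t $ i * l $ i) F"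
proof -
  let ?f = "\<lambda>j k. pois (t $ j * l $ j) k * (if j = i then F k else 1)"
  have tm: "tame (\<lambda>k. if j = i then F k else 1)" for j using assms tame_const[of 1] by (cases "j = i") auto
  have "(\<Sum>\<^sub>\<infinity>x. poisson_lik t l x * F (x i)) = (\<Sum>\<^sub>\<infinity>x\<in>PiE UNIV (\<lambda>_. UNIV). \<Prod>j\<in>UNIV. ?f j (x j))"
    by (simp add: poisson_lik_eq prod.distrib)
  also have "\<dots> = (\<Prod>j\<in>UNIV. \<Sum>\<^sub>\<infinity>k. ?f j k)"
    by (rule infsum_prod_PiE_abs) (use pois_tame(1)[OF tm] in auto)
  also have "\<dots> = (\<Prod>j\<in>UNIV. if j = i then poisson_mean (t $ i * l $ i) F else 1)"
    by (rule prod.cong[OF refl], subst pois_tame(2)[OF tm]) (simp add: poisson_mean_const)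
  also have "\<dots> = poisson_mean (t $ i * l $ i) F" by simp
  finally show ?thesis .
qed

lemma poisson_lik_has_sum: "(poisson_lik t l has_sum 1) UNIV"
proof -
  have "infsum (poisson_lik t l) UNIV = 1"
    using poisson_marginal[OF tame_const[of 1], of t l] by (simp add: poisson_mean_const)
  \<comment> \<open>An unsummable family has \<open>infsum\<close> 0, so the value 1 certifies
    summability.\<close>
  then show ?thesis using infsum_not_exists[of "poisson_lik t l" UNIV] has_sum_infsum by fastforce
qed

text \<open>Weighting by powers of 2 is exponential tilting: it gives a constant times the Poisson
  mass function with doubled means.\<close>

lemma poisson_two_pow_summable: "(\<lambda>x. poisson_lik t l x * two_pow x) summable_on UNIV"
proof -
  have "poisson_lik t l x * two_pow x = (\<Prod>i\<in>UNIV. exp (t $ i * l $ i)) * poisson_lik (2 *\<^sub>R t) l x" for x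
    unfolding poisson_lik_def two_pow_def prod.distrib[symmetric]
    by (rule prod.cong[OF refl]) (simp add: power_mult_distrib exp_minus field_simps exp_add[symmetric] flip: exp_add mult_2)
  moreover have "(\<lambda>x. (\<Prod>i\<in>UNIV. exp (t $ i * l $ i)) * poisson_lik (2 *\<^sub>R t) l x) summable_on UNIV"
    by (intro summable_on_cmult_right has_sum_imp_summable[OF poisson_lik_has_sum])
  ultimately show ?thesis by simp
qed

locale poisson_pair =
  fixes r s l :: "real ^ 'n::finite"
  assumes r: "\<And>i. r $ i > 0" and s: "\<And>i. s $ i > 0" and l: "\<And>i. l $ i > 0"
begin

definition joint :: "('n \<Rightarrow> nat) \<times> ('n \<Rightarrow> nat) \<Rightarrow> real" where
  "joint p = poisson_lik r l (fst p) * poisson_lik s l (snd p)"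

lemma joint_pos: "joint p > 0"
  unfolding joint_def by (intro mult_pos_pos poisson_lik_pos r s l)

lemma joint_has_sum_1: "(joint has_sum 1) UNIV"
proof -
  have 1: "((\<lambda>y. joint (x, y)) has_sum poisson_lik r l x * 1) UNIV" for x
    unfolding joint_def by (simp only: fst_conv snd_conv) (intro has_sum_cmult_right poisson_lik_has_sum)
  have "joint summable_on UNIV \<times> UNIV"
    by (rule summable_on_SigmaI[where g = "\<lambda>x. poisson_lik r l x * 1"])
       (use 1 joint_pos has_sum_imp_summable[OF poisson_lik_has_sum] in \<open>auto intro: less_imp_le\<close>)
  then have "(joint has_sum 1) (UNIV \<times> UNIV)"
    by (intro has_sum_SigmaI[where g = "\<lambda>x. poisson_lik r l x * 1"]) (use 1 poisson_lik_has_sum in auto)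
  then show ?thesis by simp
qed

lemma joint_summable:
  assumes "\<And>x y. \<bar>G (x, y)\<bar> \<le> C * (two_pow x * two_pow y)"
  shows "(\<lambda>p. joint p * G p) summable_on UNIV"
proof -
  have pos: "poisson_lik r l x \<ge> 0" "poisson_lik s l y \<ge> 0" for x y
    using poisson_lik_pos[OF r l, of x] poisson_lik_pos[OF s l, of y] by simp_all
  let ?g = "\<lambda>p. (poisson_lik r l (fst p) * two_pow (fst p)) * (poisson_lik s l (snd p) * two_pow (snd p))"
  have g0: "two_pow x \<ge> 0" for x using two_pow_ge_1[of x] by linarith
  have "?g summable_on UNIV \<times> UNIV"
  proof (rule summable_on_SigmaI)
    show "((\<lambda>y. ?g (x, y)) has_sum (poisson_lik r l x * two_pow x) * infsum (\<lambda>y. poisson_lik s l y * two_pow y) UNIV) UNIV" for x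
      by (simp only: fst_conv snd_conv) (intro has_sum_cmult_right has_sum_infsum poisson_two_pow_summable)
    show "(\<lambda>x. (poisson_lik r l x * two_pow x) * infsum (\<lambda>y. poisson_lik s l y * two_pow y) UNIV) summable_on UNIV"
      by (intro summable_on_cmult_left poisson_two_pow_summable)
    show "?g (x, y) \<ge> 0" for x y by (intro mult_nonneg_nonneg) (simp_all add: pos g0)
  qed
  then have "(\<lambda>p. C * ?g p) summable_on UNIV" by (intro summable_on_cmult_right) simp
  then have "(\<lambda>p. norm (joint p * G p)) summable_on UNIV"
  proof (rule summable_on_comparison_test)
    fix p :: "('n \<Rightarrow> nat) \<times> ('n \<Rightarrow> nat)"
    obtain x y where p: "p = (x, y)" by (cases p)
    have "joint p * \<bar>G p\<bar> \<le> joint p * (C * (two_pow x * two_pow y))"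
      unfolding p by (intro mult_left_mono assms less_imp_le[OF joint_pos])
    moreover have "norm (joint p * G p) = joint p * \<bar>G p\<bar>"
      using joint_pos[of p] by (simp add: abs_mult)
    ultimately show "norm (joint p * G p) \<le> C * ?g p"
      by (simp add: p joint_def mult_ac)
  qed auto
  then show ?thesis by (rule abs_summable_summable)
qed

definition share :: "'n \<Rightarrow> real" where "share i = r $ i / (r $ i + s $ i)"

lemma share: "0 < share i" "share i < 1"
  using r[of i] s[of i] by (auto simp: share_def)

text \<open>Poisson splitting: the total is Poisson with the added rates, and given the total the
  first count is binomial.\<close>

lemma joint_thinning:
  assumes "\<And>i. x i \<le> z i"
  shows "joint (x, \<lambda>i. z i - x i) = poisson_lik (r + s) l z * thinning share z x"
  unfolding joint_def fst_conv snd_conv poisson_lik_def thinning_def prod.distrib[symmetric]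
proof (rule prod.cong[OF refl])
  fix i
  have R: "r $ i + s $ i \<noteq> 0" using r[of i] s[of i] by simp
  have z: "z i = x i + (z i - x i)" using assms[of i] by simp
  define m where "m = z i - x i"
  have zm: "z i = x i + m" using z by (simp add: m_def)
  have f: "1 - share i = s $ i / (r $ i + s $ i)" using R by (simp add: share_def field_simps)
  have b: "real (z i choose x i) / fact (z i) = 1 / (fact (x i) * fact m)"
    using assms[of i] by (simp add: binomial_fact m_def)
  have e: "exp (- ((r + s) $ i * l $ i)) = exp (- (r $ i * l $ i)) * exp (- (s $ i * l $ i))"
    by (simp add: distrib_right flip: exp_add)
  have "((r + s) $ i * l $ i) ^ z i * (share i ^ x i * (1 - share i) ^ m) = (r $ i * l $ i) ^ x i * (s $ i * l $ i) ^ m"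
    unfolding zm f unfolding share_def using R by (simp add: power_add power_mult_distrib power_divide)
  then show "(r $ i * l $ i) ^ x i * exp (- (r $ i * l $ i)) / fact (x i) *
      ((s $ i * l $ i) ^ (z i - x i) * exp (- (s $ i * l $ i)) / fact (z i - x i)) =
      ((r + s) $ i * l $ i) ^ z i * exp (- ((r + s) $ i * l $ i)) / fact (z i) *
      (real (z i choose x i) * share i ^ x i * (1 - share i) ^ (z i - x i))"
    unfolding e m_def[symmetric]
  proof -
    assume A: "((r + s) $ i * l $ i) ^ z i * (share i ^ x i * (1 - share i) ^ m) = (r $ i * l $ i) ^ x i * (s $ i * l $ i) ^ m"
    have gen: "X * E1 / fx * (Y * E2 / fm) = Z * (E1 * E2) / fz * (c * F * G)"
      if "Z * (F * G) = X * Y" "c / fz = 1 / (fx * fm)" for X E1 fx Y E2 fm Z fz c F G :: real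
    proof -
      have "Z * (E1 * E2) / fz * (c * F * G) = (Z * (F * G)) * (E1 * E2) * (c / fz)" by simp
      also have "\<dots> = X * E1 / fx * (Y * E2 / fm)" unfolding that by simp
      finally show ?thesis ..
    qed
    show "(r $ i * l $ i) ^ x i * exp (- (r $ i * l $ i)) / fact (x i) *
      ((s $ i * l $ i) ^ m * exp (- (s $ i * l $ i)) / fact m) =
      ((r + s) $ i * l $ i) ^ z i * (exp (- (r $ i * l $ i)) * exp (- (s $ i * l $ i))) / fact (z i) *
      (real (z i choose x i) * share i ^ x i * (1 - share i) ^ m)"
      by (rule gen[OF A b])
  qed
qed

abbreviation below :: "('n \<Rightarrow> nat) \<Rightarrow> ('n \<Rightarrow> nat) set" where
  "below z \<equiv> PiE UNIV (\<lambda>i. {..z i})"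

lemma finite_below: "finite (below z)" by (intro finite_PiE) auto

text \<open>Pairs of counts are reindexed by total and first count. Subtraction on nat is exact here
  since x i <= z i.\<close>

lemma bij_split: "bij_betw (\<lambda>(z, x). (x, \<lambda>i. z i - x i)) (Sigma UNIV below) (UNIV :: (('n \<Rightarrow> nat) \<times> ('n \<Rightarrow> nat)) set)"
  by (rule bij_betw_byWitness[where f' = "\<lambda>(x, y). (\<lambda>i. x i + y i, x)"]) (auto simp: fun_eq_iff PiE_def Pi_def)

lemma thinning_sum: "(\<Sum>x\<in>below z. thinning share z x) = 1"
proof -
  have "(\<Sum>x\<in>below z. thinning share z x) = (\<Prod>i\<in>UNIV. \<Sum>k\<in>{..z i}. real (z i choose k) * share i ^ k * (1 - share i) ^ (z i - k))"
    unfolding thinning_def by (rule prod_sum_PiE[symmetric]) auto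
  also have "\<dots> = (\<Prod>i\<in>UNIV. (share i + (1 - share i)) ^ z i)"
    by (simp only: binomial_ring)
  finally show ?thesis by simp
qed

lemma joint_regroup:
  assumes "(\<lambda>p. joint p * G (fst p) (\<lambda>i. fst p i + snd p i)) summable_on UNIV"
  shows "(\<Sum>\<^sub>\<infinity>p. joint p * G (fst p) (\<lambda>i. fst p i + snd p i)) =
    (\<Sum>\<^sub>\<infinity>z. poisson_lik (r + s) l z * (\<Sum>x\<in>below z. thinning share z x * G x z))"
proof -
  let ?g = "\<lambda>p. joint p * G (fst p) (\<lambda>i. fst p i + snd p i)"
  let ?k = "\<lambda>(z, x). (x, \<lambda>i. z i - x i) :: ('n \<Rightarrow> nat) \<times> ('n \<Rightarrow> nat)"
  have s: "(\<lambda>q. ?g (?k q)) summable_on Sigma UNIV below"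
    using assms by (subst summable_on_reindex_bij_betw[OF bij_split])
  have "infsum ?g UNIV = (\<Sum>\<^sub>\<infinity>q\<in>Sigma UNIV below. ?g (?k q))"
    by (rule infsum_reindex_bij_betw[OF bij_split, symmetric])
  also have "\<dots> = (\<Sum>\<^sub>\<infinity>z. \<Sum>\<^sub>\<infinity>x\<in>below z. ?g (?k (z, x)))"
    by (rule infsum_Sigma_banach[OF s, symmetric])
  also have "\<dots> = (\<Sum>\<^sub>\<infinity>z. poisson_lik (r + s) l z * (\<Sum>x\<in>below z. thinning share z x * G x z))"
  proof (rule infsum_cong)
    fix z :: "'n \<Rightarrow> nat"
    have "(\<Sum>\<^sub>\<infinity>x\<in>below z. ?g (?k (z, x))) = (\<Sum>x\<in>below z. poisson_lik (r + s) l z * (thinning share z x * G x z))"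
      unfolding infsum_finite[OF finite_below]
    proof (rule sum.cong[OF refl])
      fix x assume x: "x \<in> below z"
      then have le: "x i \<le> z i" for i by auto
      then have "(\<lambda>i. x i + (z i - x i)) = z" by auto
      then show "?g (?k (z, x)) = poisson_lik (r + s) l z * (thinning share z x * G x z)"
        by (simp add: joint_thinning[OF le])
    qed
    then show "(\<Sum>\<^sub>\<infinity>x\<in>below z. ?g (?k (z, x))) = poisson_lik (r + s) l z * (\<Sum>x\<in>below z. thinning share z x * G x z)"
      by (simp only: sum_distrib_left)
  qed
  finally show ?thesis .
qed

end

section \<open>Kullback--Leibler risks\<close>

lemma has_sum_ereal:
  assumes "(f has_sum a) A" shows "((\<lambda>x. ereal (f x)) has_sum ereal a) A"
proof -
  have "((\<lambda>F. ereal (sum f F)) \<longlongrightarrow> ereal a) (finite_subsets_at_top A)"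
    using assms unfolding has_sum_def by (rule tendsto_ereal)
  moreover have "(\<lambda>F. ereal (sum f F)) = sum (\<lambda>x. ereal (f x))" by (simp add: fun_eq_iff)
  ultimately show ?thesis unfolding has_sum_def by (simp only:)
qed

lemma has_sum_diff_real:
  fixes f g :: "'a \<Rightarrow> real"
  assumes "(f has_sum a) A" "(g has_sum b) A"
  shows "((\<lambda>x. f x - g x) has_sum (a - b)) A"
  using has_sum_add[OF assms(1) has_sum_cmult_right[OF assms(2), of "-1"]] by simp

lemma summable_on_diff_real:
  fixes f g :: "'a \<Rightarrow> real"
  shows "f summable_on A \<Longrightarrow> g summable_on A \<Longrightarrow> (\<lambda>x. f x - g x) summable_on A"
  unfolding summable_on_def using has_sum_diff_real by blast

lemma infsum_diff_real:
  fixes f g :: "'a \<Rightarrow> real"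
  shows "f summable_on A \<Longrightarrow> g summable_on A \<Longrightarrow> infsum (\<lambda>x. f x - g x) A = infsum f A - infsum g A"
  by (intro infsumI has_sum_diff_real has_sum_infsum)

lemma log_linear_two_pow:
  assumes "log_linear f" obtains C where "C \<ge> 0" "\<And>z. \<bar>ln (f z)\<bar> \<le> C * two_pow z"
proof -
  obtain C where C: "\<And>z. \<bar>ln (f z)\<bar> \<le> C * (1 + (\<Sum>i\<in>UNIV. real (z i)))"
    using assms unfolding log_linear_def by blast
  have "\<bar>ln (f z)\<bar> \<le> \<bar>C\<bar> * two_pow z" for z
  proof -
    have "C * (1 + (\<Sum>i\<in>UNIV. real (z i))) \<le> \<bar>C\<bar> * (1 + (\<Sum>i\<in>UNIV. real (z i)))"
      by (intro mult_right_mono add_nonneg_nonneg sum_nonneg) auto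
    also have "\<dots> \<le> \<bar>C\<bar> * two_pow z" by (intro mult_left_mono two_pow_sum) auto
    finally show ?thesis using C[of z] by linarith
  qed
  then show ?thesis using that[of "\<bar>C\<bar>"] by simp
qed

context poisson_pair
begin

text \<open>Summability of the double series makes every inner series summable, so
  \<open>KL_div\<close> takes its finite branch throughout and Fubini yields the risk.\<close>

lemma KL_risk_eq:
  assumes q: "\<And>x y. q x y > 0"
    and S: "(\<lambda>p. joint p * ln (poisson_lik s l (snd p) / q (fst p) (snd p))) summable_on UNIV"
  shows "KL_risk r s q l = ereal (\<Sum>\<^sub>\<infinity>p. joint p * ln (poisson_lik s l (snd p) / q (fst p) (snd p)))"
proof -
  let ?J = "\<lambda>p. joint p * ln (poisson_lik s l (snd p) / q (fst p) (snd p))"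
  let ?K = "\<lambda>x. \<Sum>\<^sub>\<infinity>y. poisson_lik s l y * ln (poisson_lik s l y / q x y)"
  have pos: "poisson_lik r l x > 0" for x by (rule poisson_lik_pos[OF r l])
  have S': "(\<lambda>(x, y). ?J (x, y)) summable_on (UNIV \<times> UNIV)" using S by (simp add: case_prod_unfold)
  have J: "?J (x, y) = poisson_lik r l x * (poisson_lik s l y * ln (poisson_lik s l y / q x y))" for x y
    by (simp add: joint_def)
  have sx: "(\<lambda>y. poisson_lik s l y * ln (poisson_lik s l y / q x y)) summable_on UNIV" for x
  proof -
    have "(\<lambda>y. ?J (x, y)) summable_on UNIV" by (rule summable_on_SigmaD1[OF S']) simp
    then show ?thesis unfolding J using pos[of x] by (subst (asm) summable_on_cmult_right') auto
  qed
  have K: "KL_div (poisson_lik s l) (q x) = ereal (?K x)" for x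
    using sx[of x] q by (simp add: KL_div_def)
  have in1: "(\<Sum>\<^sub>\<infinity>y. ?J (x, y)) = poisson_lik r l x * ?K x" for x
    unfolding J by (rule infsum_cmult_right')
  have "(\<lambda>x. \<Sum>\<^sub>\<infinity>y. ?J (x, y)) summable_on UNIV" by (rule summable_on_Sigma_banach[OF S'])
  then have "((\<lambda>x. poisson_lik r l x * ?K x) has_sum (\<Sum>\<^sub>\<infinity>x. \<Sum>\<^sub>\<infinity>y. ?J (x, y))) UNIV"
    unfolding in1 by (rule has_sum_infsum)
  also have "(\<Sum>\<^sub>\<infinity>x. \<Sum>\<^sub>\<infinity>y. ?J (x, y)) = infsum ?J UNIV"
    using infsum_Sigma'_banach[OF S'] by (simp add: case_prod_unfold)
  finally have "((\<lambda>x. ereal (poisson_lik r l x * ?K x)) has_sum ereal (infsum ?J UNIV)) UNIV"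
    by (rule has_sum_ereal)
  then show ?thesis unfolding KL_risk_def K by (simp add: infsumI)
qed

text \<open>The strict inequality enters only through total count 0, which has positive probability
  at every l; hence the strict improvement at every l.\<close>

lemma risk_improvement:
  assumes q: "\<And>x y. q x y > 0"
    and S: "(\<lambda>p. joint p * ln (poisson_lik s l (snd p) / q (fst p) (snd p))) summable_on UNIV"
    and h: "\<And>z. h z > 0" "log_linear h" and H: "\<And>z. H z > 0" "log_linear H"
    and le: "\<And>z. (\<Sum>x\<in>below z. thinning share z x * h x) \<le> H z"
    and less: "h (\<lambda>_. 0) < H (\<lambda>_. 0)"
  shows "KL_risk r s (\<lambda>x y. q x y * H (\<lambda>i. x i + y i) / h x) l < KL_risk r s q l"
proof -
  let ?q = "\<lambda>x y. q x y * H (\<lambda>i. x i + y i) / h x"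
  let ?J = "\<lambda>p. joint p * ln (poisson_lik s l (snd p) / q (fst p) (snd p))"
  let ?\<delta> = "\<lambda>p. ln (H (\<lambda>i. fst p i + snd p i)) - ln (h (fst p))"
  let ?\<kappa> = "\<lambda>x z. h x / H z"
  let ?K = "\<lambda>p. joint p * ?\<kappa> (fst p) (\<lambda>i. fst p i + snd p i)"
  let ?S = "\<lambda>z. \<Sum>x\<in>below z. thinning share z x * ?\<kappa> x z"
  have ps: "poisson_lik s l y > 0" for y by (rule poisson_lik_pos[OF s l])
  obtain C where C: "C \<ge> 0" "\<And>z. \<bar>ln (h z)\<bar> \<le> C * two_pow z" by (rule log_linear_two_pow[OF h(2)]) blast
  obtain D where D: "D \<ge> 0" "\<And>z. \<bar>ln (H z)\<bar> \<le> D * two_pow z" by (rule log_linear_two_pow[OF H(2)]) blast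
  have S\<delta>: "(\<lambda>p. joint p * ?\<delta> p) summable_on UNIV"
  proof (rule joint_summable[where C = "C + D"])
    fix x y :: "'n \<Rightarrow> nat"
    have "two_pow x \<le> two_pow x * two_pow y" using two_pow_ge_1[of x] two_pow_ge_1[of y] by (simp add: mult_le_cancel_left1)
    then have "C * two_pow x \<le> C * (two_pow x * two_pow y)" using C(1) by (rule mult_left_mono)
    moreover have "\<bar>ln (H (\<lambda>i. x i + y i))\<bar> \<le> D * (two_pow x * two_pow y)" using D(2)[of "\<lambda>i. x i + y i"] by (simp add: two_pow_add)
    ultimately show "\<bar>?\<delta> (x, y)\<bar> \<le> (C + D) * (two_pow x * two_pow y)"
      using C(2)[of x] unfolding distrib_right fst_conv snd_conv by linarith
  qed
  have qpos: "?q x y > 0" for x y using q h H by simp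
  have ln_eq: "ln (poisson_lik s l y / ?q x y) = ln (poisson_lik s l y / q x y) - (ln (H (\<lambda>i. x i + y i)) - ln (h x))" for x y
    using ps[of y] q[of x y] h(1)[of x] H(1)[of "\<lambda>i. x i + y i"] by (simp add: ln_div ln_mult_pos)
  have Jq: "joint p * ln (poisson_lik s l (snd p) / ?q (fst p) (snd p)) = ?J p - joint p * ?\<delta> p" for p
    unfolding ln_eq by (simp only: right_diff_distrib)
  have "(\<lambda>p. ?J p - joint p * ?\<delta> p) summable_on UNIV" by (rule summable_on_diff_real[OF S S\<delta>])
  then have risk: "KL_risk r s ?q l = ereal (\<Sum>\<^sub>\<infinity>p. ?J p - joint p * ?\<delta> p)"
    using KL_risk_eq[of ?q, OF qpos] unfolding Jq by simp
  have ratio: "?S z \<le> 1" for z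
  proof -
    have "?S z = (\<Sum>x\<in>below z. thinning share z x * h x) / H z"
      by (simp add: sum_divide_distrib)
    then show ?thesis using le[of z] H(1)[of z] by simp
  qed
  have th0: "thinning share z x \<ge> 0" for z x using share by (intro thinning_nonneg) (auto intro: less_imp_le)
  have pR: "poisson_lik (r + s) l z > 0" for z
    by (rule poisson_lik_pos) (use r s l in \<open>auto intro: add_pos_pos\<close>)
  have \<kappa>0: "?\<kappa> x z \<ge> 0" for x z using h(1)[of x] H(1)[of z] by simp
  have ratio0: "0 \<le> ?S z" for z
    by (intro sum_nonneg mult_nonneg_nonneg th0 \<kappa>0)
  have sR: "poisson_lik (r + s) l summable_on UNIV" using poisson_lik_has_sum has_sum_imp_summable by blast
  have sratio: "(\<lambda>z. poisson_lik (r + s) l z * ?S z) summable_on UNIV"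
    by (rule summable_on_comparison_test[OF sR])
       (intro mult_left_le mult_nonneg_nonneg ratio ratio0 less_imp_le[OF pR])+
  have K0: "?K p \<ge> 0" for p by (intro mult_nonneg_nonneg less_imp_le[OF joint_pos] \<kappa>0)
  \<comment> \<open>The ratio h / H may grow faster than \<open>two_pow\<close>, so domination does
    not apply. But the terms are nonnegative, and grouped by total they are bounded by Poisson
    probabilities.\<close>
  have SK: "?K summable_on UNIV"
  proof -
    have "(\<lambda>q. ?K (case q of (z, x) \<Rightarrow> (x, \<lambda>i. z i - x i))) summable_on Sigma UNIV below"
    proof (rule summable_on_SigmaI[OF _ sratio])
      fix z :: "'n \<Rightarrow> nat"
      have "(\<Sum>x\<in>below z. ?K (case (z, x) of (z, x) \<Rightarrow> (x, \<lambda>i. z i - x i))) =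
          poisson_lik (r + s) l z * ?S z"
        unfolding sum_distrib_left
      proof (rule sum.cong[OF refl])
        fix x assume "x \<in> below z"
        then have le: "x i \<le> z i" for i by auto
        then have "(\<lambda>i. x i + (z i - x i)) = z" by auto
        then show "?K (case (z, x) of (z, x) \<Rightarrow> (x, \<lambda>i. z i - x i)) = poisson_lik (r + s) l z * (thinning share z x * ?\<kappa> x z)"
          by (simp add: joint_thinning[OF le])
      qed
      then show "((\<lambda>x. ?K (case (z, x) of (z, x) \<Rightarrow> (x, \<lambda>i. z i - x i))) has_sum
          poisson_lik (r + s) l z * ?S z) (below z)"
        using finite_below by (intro has_sum_finiteI) auto
    qed (rule K0)
    then show ?thesis by (subst (asm) summable_on_reindex_bij_betw[OF bij_split])
  qed
  have K: "infsum ?K UNIV = (\<Sum>\<^sub>\<infinity>z. poisson_lik (r + s) l z * ?S z)"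
    by (rule joint_regroup[OF SK])
  have "infsum ?K UNIV < 1"
  proof -
    let ?d = "\<lambda>z. poisson_lik (r + s) l z - poisson_lik (r + s) l z * ?S z"
    have d0: "?d z \<ge> 0" for z using ratio[of z] pR[of z] by (simp add: mult_left_le)
    have single: "sum f {a} = f a" for f :: "('n \<Rightarrow> nat) \<Rightarrow> real" and a by simp
    have P0: "below (\<lambda>_. 0) = {\<lambda>_. 0}" by (auto simp: PiE_def fun_eq_iff)
    have "?\<kappa> (\<lambda>_. 0) (\<lambda>_. 0) < 1" using less H(1) by simp
    then have "poisson_lik (r + s) l (\<lambda>_. 0) * ?\<kappa> (\<lambda>_. 0) (\<lambda>_. 0) < poisson_lik (r + s) l (\<lambda>_. 0) * 1"
      using pR by (rule mult_strict_left_mono)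
    moreover have "(\<Sum>x\<in>below (\<lambda>_. 0). thinning share (\<lambda>_. 0) x * ?\<kappa> x (\<lambda>_. 0)) =
        (\<Sum>x\<in>{\<lambda>_. 0}. thinning share (\<lambda>_. 0) x * ?\<kappa> x (\<lambda>_. 0))"
      by (rule sum.cong[OF P0 refl])
    moreover have "\<dots> = ?\<kappa> (\<lambda>_. 0) (\<lambda>_. 0)" by (simp add: thinning_def)
    ultimately have "0 < ?d (\<lambda>_. 0)" by (simp only: mult_1_right diff_gt_0_iff_gt)
    also have "\<dots> = sum ?d {\<lambda>_. 0}" by (rule single[symmetric])
    also have "\<dots> \<le> infsum ?d UNIV"
      by (rule finite_sum_le_infsum) (use d0 summable_on_diff_real[OF sR sratio] in auto)
    also have "\<dots> = infsum (poisson_lik (r + s) l) UNIV - infsum ?K UNIV"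
      unfolding K by (rule infsum_diff_real[OF sR sratio])
    also have "infsum (poisson_lik (r + s) l) UNIV = 1" using poisson_lik_has_sum by (rule infsumI)
    finally show ?thesis by simp
  qed
  moreover have "1 - infsum ?K UNIV \<le> (\<Sum>\<^sub>\<infinity>p. joint p * ?\<delta> p)"
  proof -
    have sj: "joint summable_on UNIV" using joint_has_sum_1 has_sum_imp_summable by blast
    have "1 - infsum ?K UNIV = (\<Sum>\<^sub>\<infinity>p. joint p - ?K p)"
      using infsum_diff_real[OF sj SK] infsumI[OF joint_has_sum_1] by simp
    also have "\<dots> \<le> (\<Sum>\<^sub>\<infinity>p. joint p * ?\<delta> p)"
    proof (rule infsum_mono[OF summable_on_diff_real[OF sj SK] S\<delta>])
      fix p :: "('n \<Rightarrow> nat) \<times> ('n \<Rightarrow> nat)"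
      let ?u = "?\<kappa> (fst p) (\<lambda>i. fst p i + snd p i)"
      have u: "?u > 0" using h H by simp
      have "ln ?u \<le> ?u - 1" by (rule ln_le_minus_one[OF u])
      moreover have "ln ?u = - ?\<delta> p" using h(1)[of "fst p"] H(1)[of "\<lambda>i. fst p i + snd p i"] by (simp add: ln_div)
      ultimately have "1 - ?u \<le> ?\<delta> p" by linarith
      then have "joint p * (1 - ?u) \<le> joint p * ?\<delta> p" by (intro mult_left_mono less_imp_le[OF joint_pos])
      then show "joint p - ?K p \<le> joint p * ?\<delta> p" by (simp only: right_diff_distrib mult_1_right)
    qed
    finally show ?thesis .
  qed
  ultimately have "0 < (\<Sum>\<^sub>\<infinity>p. joint p * ?\<delta> p)" by linarith
  then have "(\<Sum>\<^sub>\<infinity>p. ?J p - joint p * ?\<delta> p) < infsum ?J UNIV"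
    unfolding infsum_diff_real[OF S S\<delta>] by linarith
  then show ?thesis unfolding risk KL_risk_eq[OF q S] by simp
qed

end

section \<open>The risk of the Jeffreys rule\<close>

lemma tame_of_differences:
  assumes "tame (\<lambda>k. F (Suc k) - F k)" shows "tame F"
proof -
  obtain C where C: "C \<ge> 0" "\<And>k. \<bar>F (Suc k) - F k\<bar> \<le> C * 2 ^ k" using tameE[OF assms] by blast
  have "\<bar>F k\<bar> \<le> (\<bar>F 0\<bar> + C) * 2 ^ k" for k
  proof (induction k)
    case (Suc k)
    have "\<bar>F (Suc k)\<bar> \<le> \<bar>F k\<bar> + \<bar>F (Suc k) - F k\<bar>" by linarith
    also have "\<dots> \<le> (\<bar>F 0\<bar> + C) * 2 ^ k + C * 2 ^ k" using Suc C(2)[of k] by linarith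
    also have "\<dots> \<le> (\<bar>F 0\<bar> + C) * 2 ^ k + (\<bar>F 0\<bar> + C) * 2 ^ k" by (intro add_left_mono mult_right_mono) auto
    finally show ?case by simp
  qed (use C in simp)
  then show ?thesis by (rule tameI)
qed

definition ln_gamma_half :: "nat \<Rightarrow> real" where "ln_gamma_half k = ln (Gamma (real k + 1 / 2))"

lemma ln_gamma_half_Suc: "ln_gamma_half (Suc k) - ln_gamma_half k = log_half k"
proof -
  have "Gamma (real (Suc k) + 1 / 2) = Gamma ((real k + 1 / 2) + 1)" by (simp add: add_ac)
  also have "\<dots> = (real k + 1 / 2) * Gamma (real k + 1 / 2)"
    by (rule Gamma_plus1) (auto simp: nonpos_Ints_def)
  finally show ?thesis unfolding ln_gamma_half_def using Gamma_half_pos[of k]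
    by (simp add: ln_mult_pos)
qed

lemma tame_ln_gamma_half: "tame ln_gamma_half"
  by (rule tame_of_differences) (simp only: ln_gamma_half_Suc tame_log_half)

lemma poisson_mean_real: "\<mu> > 0 \<Longrightarrow> poisson_mean \<mu> real = \<mu>"
  using poisson_mean_shift[OF _ tame_of_nat, of \<mu>] by (simp add: poisson_mean_const)

text \<open>This is phi of the overview.\<close>

definition log_lik_mean :: "real \<Rightarrow> real" where
  "log_lik_mean \<mu> = \<mu> * ln \<mu> - \<mu> - poisson_mean \<mu> ln_gamma_half"

lemma DERIV_log_lik_mean:
  assumes "\<mu> > 0" shows "(log_lik_mean has_real_derivative log_gap \<mu>) (at \<mu>)"
proof -
  have "((\<lambda>\<mu>. \<mu> * ln \<mu> - \<mu>) has_real_derivative ln \<mu>) (at \<mu>)"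
    using assms by (auto intro!: derivative_eq_intros)
  from DERIV_diff[OF this DERIV_poisson_mean[OF tame_ln_gamma_half]]
  show ?thesis by (simp only: log_lik_mean_def[abs_def] log_gap_def ln_gamma_half_Suc)
qed

text \<open>The bound \<open>\<mu> * log_gap \<mu> < 1 / 50\<close> says that
  \<open>log_lik_mean\<close> grows more slowly than ln / 50.\<close>

lemma log_lik_mean_increment:
  assumes "0 < \<mu>" "\<mu> < \<nu>"
  shows "log_lik_mean \<nu> - log_lik_mean \<mu> < (ln \<nu> - ln \<mu>) / 50"
proof -
  define w where "w x = log_lik_mean x - ln x / 50" for x
  have "w \<nu> < w \<mu>"
  proof (rule DERIV_neg_imp_decreasing[OF assms(2)])
    fix x assume "\<mu> \<le> x" "x \<le> \<nu>"
    then have x: "x > 0" using assms by simp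
    have "(w has_real_derivative log_gap x - 1 / x / 50) (at x)"
      unfolding w_def[abs_def] by (intro DERIV_diff DERIV_log_lik_mean DERIV_cdivide DERIV_ln_divide x)
    moreover have "log_gap x - 1 / x / 50 < 0" using log_gap_bound[OF x] x by (simp add: field_simps)
    ultimately show "\<exists>y. (w has_real_derivative y) (at x) \<and> y < 0" by blast
  qed
  then show ?thesis by (simp add: w_def diff_divide_distrib)
qed

text \<open>The logarithm of the Jeffreys posterior density of l given count k at rate t, with the
  factor l^(-1/2) left out.\<close>

definition log_lik :: "real \<Rightarrow> real \<Rightarrow> nat \<Rightarrow> real" where
  "log_lik t l k = (real k * ln (t * l) - t * l - ln_gamma_half k) + ln t / 2"

lemma tame_log_lik: "tame (log_lik t l)"
proof -
  have "tame (\<lambda>k. (ln (t * l) * real k - t * l - ln_gamma_half k) + ln t / 2)"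
    by (intro tame_add tame_diff tame_cmult tame_of_nat tame_const tame_ln_gamma_half)
  then show ?thesis by (simp add: log_lik_def[abs_def] mult.commute)
qed

lemma poisson_mean_log_lik:
  assumes "t > 0" "l > 0"
  shows "poisson_mean (t * l) (log_lik t l) = log_lik_mean (t * l) + ln t / 2"
proof -
  have "poisson_mean (t * l) (\<lambda>k. (ln (t * l) * real k - t * l - ln_gamma_half k) + ln t / 2) =
      (ln (t * l) * poisson_mean (t * l) real - t * l - poisson_mean (t * l) ln_gamma_half) + ln t / 2"
    by (simp only: poisson_mean_add poisson_mean_diff poisson_mean_cmult poisson_mean_const
        tame_add tame_diff tame_cmult tame_of_nat tame_const tame_ln_gamma_half)
  then show ?thesis using assms
    by (simp add: log_lik_def[abs_def] log_lik_mean_def poisson_mean_real mult.commute)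
qed

lemma exp_log_lik:
  assumes "t > 0" "l > 0"
  shows "exp (log_lik t l k) = l ^ k * exp (- (t * l)) / gamma_weight t k"
proof -
  have em: "exp (- (t * l)) = 1 / exp (t * l)" by (simp add: exp_minus inverse_eq_divide)
  have "exp (real k * ln (t * l)) = (t * l) ^ k"
    using assms by (simp add: exp_of_nat_mult)
  moreover have "exp (ln t / 2) = sqrt t"
  proof -
    have "sqrt t = t powr (1 / 2)" using assms by (simp add: powr_half_sqrt)
    then show ?thesis using assms by (simp add: powr_def)
  qed
  moreover have "exp (ln_gamma_half k) = Gamma (real k + 1 / 2)"
    unfolding ln_gamma_half_def by (rule exp_ln[OF Gamma_half_pos])
  ultimately have "exp (log_lik t l k) = (t * l) ^ k * exp (- (t * l)) / Gamma (real k + 1 / 2) * sqrt t"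
    unfolding log_lik_def exp_add exp_diff em by (simp only: times_divide_eq_right mult_1_right)
  then show ?thesis unfolding gamma_weight_def by (simp add: power_mult_distrib)
qed

lemma has_sum_finite_sum:
  fixes f :: "'i \<Rightarrow> 'a \<Rightarrow> real"
  assumes "finite I" "\<And>i. i \<in> I \<Longrightarrow> (f i has_sum c i) A"
  shows "((\<lambda>x. \<Sum>i\<in>I. f i x) has_sum (\<Sum>i\<in>I. c i)) A"
  using assms
proof (induction I)
  case (insert i I)
  then have "((\<lambda>x. f i x + (\<Sum>i\<in>I. f i x)) has_sum (c i + (\<Sum>i\<in>I. c i))) A"
    by (intro has_sum_add) auto
  then show ?case using insert by simp
qed simp

context poisson_pair
begin

lemma neg_binomial_pos: "neg_binomial r s x y > 0"
  unfolding neg_binomial_def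
proof (intro prod_pos ballI)
  fix i
  have "r $ i + s $ i > 0" using r[of i] s[of i] by simp
  then show "s $ i ^ y i / fact (y i) * gamma_weight (r $ i + s $ i) (x i + y i) / gamma_weight (r $ i) (x i) > 0"
    by (intro divide_pos_pos mult_pos_pos gamma_weight_pos zero_less_power r s) auto
qed

text \<open>Bayes' rule: p(y | l) / q(y | x) is the posterior density at l given x + y divided by
  that given x. So the risk splits into means of functions of a single Poisson count.\<close>

lemma ln_neg_binomial_ratio:
  "ln (poisson_lik s l y / neg_binomial r s x y) =
    (\<Sum>i\<in>UNIV. log_lik (r $ i + s $ i) (l $ i) (x i + y i) - log_lik (r $ i) (l $ i) (x i))"
proof -
  have "poisson_lik s l y / neg_binomial r s x y =
    (\<Prod>i\<in>UNIV. exp (log_lik (r $ i + s $ i) (l $ i) (x i + y i) - log_lik (r $ i) (l $ i) (x i)))"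
    unfolding poisson_lik_def neg_binomial_def prod_dividef[symmetric]
  proof (rule prod.cong[OF refl])
    fix i
    have R: "r $ i + s $ i > 0" using r[of i] s[of i] by simp
    have nz: "gamma_weight (r $ i + s $ i) (x i + y i) \<noteq> 0" "gamma_weight (r $ i) (x i) \<noteq> 0" "s $ i \<noteq> 0" "l $ i \<noteq> 0"
      using gamma_weight_pos[OF R, of "x i + y i"] gamma_weight_pos[OF r, of i "x i"] s[of i] l[of i] by simp_all
    have e: "exp (- ((r $ i + s $ i) * l $ i)) = exp (- (r $ i * l $ i)) * exp (- (s $ i * l $ i))"
      by (simp add: distrib_right flip: exp_add)
    show "(s $ i * l $ i) ^ y i * exp (- (s $ i * l $ i)) / fact (y i) /
        (s $ i ^ y i / fact (y i) * gamma_weight (r $ i + s $ i) (x i + y i) / gamma_weight (r $ i) (x i)) =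
        exp (log_lik (r $ i + s $ i) (l $ i) (x i + y i) - log_lik (r $ i) (l $ i) (x i))"
      unfolding exp_diff exp_log_lik[OF R l] exp_log_lik[OF r l] e
      using nz by (simp add: power_mult_distrib power_add)
  qed
  also have "\<dots> = exp (\<Sum>i\<in>UNIV. log_lik (r $ i + s $ i) (l $ i) (x i + y i) - log_lik (r $ i) (l $ i) (x i))"
    by (rule exp_sum[symmetric]) simp
  finally show ?thesis by simp
qed

lemma has_sum_first:
  assumes "tame F"
  shows "((\<lambda>p. joint p * F (fst p i)) has_sum poisson_mean (r $ i * l $ i) F) UNIV"
proof -
  obtain C where C: "C \<ge> 0" "\<And>k. \<bar>F k\<bar> \<le> C * 2 ^ k" using tameE[OF assms] by blast
  have S: "(\<lambda>p. joint p * F (fst p i)) summable_on UNIV"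
  proof (rule joint_summable[where C = C])
    fix x y :: "'n \<Rightarrow> nat"
    have "(2::real) ^ x i * 1 \<le> two_pow x * two_pow y"
      by (intro mult_mono two_pow_component two_pow_ge_1) (use two_pow_ge_1[of x] in auto)
    then have "C * 2 ^ x i \<le> C * (two_pow x * two_pow y)" using C(1) by (intro mult_left_mono) auto
    then show "\<bar>F (fst (x, y) i)\<bar> \<le> C * (two_pow x * two_pow y)" using C(2)[of "x i"] by simp
  qed
  then have "infsum (\<lambda>p. joint p * F (fst p i)) (UNIV \<times> UNIV) = (\<Sum>\<^sub>\<infinity>x. \<Sum>\<^sub>\<infinity>y. joint (x, y) * F (fst (x, y) i))"
    by (intro infsum_Sigma_banach[symmetric]) simp
  also have "\<dots> = (\<Sum>\<^sub>\<infinity>x. poisson_lik r l x * F (x i))"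
  proof (rule infsum_cong)
    fix x
    have "(\<Sum>\<^sub>\<infinity>y. joint (x, y) * F (fst (x, y) i)) = (\<Sum>\<^sub>\<infinity>y. (poisson_lik r l x * F (x i)) * poisson_lik s l y)"
      by (simp add: joint_def mult_ac)
    also have "\<dots> = (poisson_lik r l x * F (x i)) * (\<Sum>\<^sub>\<infinity>y. poisson_lik s l y)" by (rule infsum_cmult_right')
    also have "(\<Sum>\<^sub>\<infinity>y. poisson_lik s l y) = 1" using poisson_lik_has_sum by (rule infsumI)
    finally show "(\<Sum>\<^sub>\<infinity>y. joint (x, y) * F (fst (x, y) i)) = poisson_lik r l x * F (x i)" by simp
  qed
  also have "\<dots> = poisson_mean (r $ i * l $ i) F" by (rule poisson_marginal[OF assms])
  finally show ?thesis using has_sum_infsum[OF S] by simp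
qed

text \<open>After regrouping by totals the thinning weights sum to 1, leaving the Poisson law with
  rate r + s.\<close>

lemma has_sum_total:
  assumes "tame F"
  shows "((\<lambda>p. joint p * F (fst p i + snd p i)) has_sum poisson_mean ((r $ i + s $ i) * l $ i) F) UNIV"
proof -
  obtain C where C: "C \<ge> 0" "\<And>k. \<bar>F k\<bar> \<le> C * 2 ^ k" using tameE[OF assms] by blast
  have S: "(\<lambda>p. joint p * F (fst p i + snd p i)) summable_on UNIV"
  proof (rule joint_summable[where C = C])
    fix x y :: "'n \<Rightarrow> nat"
    have "(2::real) ^ x i * 2 ^ y i \<le> two_pow x * two_pow y"
      by (intro mult_mono two_pow_component) (use two_pow_ge_1[of x] in auto)
    then have "C * 2 ^ (x i + y i) \<le> C * (two_pow x * two_pow y)" using C(1) by (intro mult_left_mono) (auto simp: power_add)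
    then show "\<bar>F (fst (x, y) i + snd (x, y) i)\<bar> \<le> C * (two_pow x * two_pow y)" using C(2)[of "x i + y i"] by simp
  qed
  then have "infsum (\<lambda>p. joint p * F (fst p i + snd p i)) UNIV =
      (\<Sum>\<^sub>\<infinity>z. poisson_lik (r + s) l z * (\<Sum>x\<in>below z. thinning share z x * F (z i)))"
    by (rule joint_regroup[where G = "\<lambda>x z. F (z i)"])
  also have "\<dots> = (\<Sum>\<^sub>\<infinity>z. poisson_lik (r + s) l z * F (z i))"
    unfolding sum_distrib_right[symmetric] thinning_sum by simp
  also have "\<dots> = poisson_mean ((r $ i + s $ i) * l $ i) F"
    using poisson_marginal[OF assms, of "r + s" l i] by simp
  finally show ?thesis using has_sum_infsum[OF S] by simp
qed

lemma jeffreys_risk_has_sum: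
  "((\<lambda>p. joint p * ln (poisson_lik s l (snd p) / neg_binomial r s (fst p) (snd p))) has_sum
    (\<Sum>i\<in>UNIV. (log_lik_mean ((r $ i + s $ i) * l $ i) + ln (r $ i + s $ i) / 2)
      - (log_lik_mean (r $ i * l $ i) + ln (r $ i) / 2))) UNIV"
proof -
  have R: "r $ i + s $ i > 0" for i using r[of i] s[of i] by simp
  have "((\<lambda>p. \<Sum>i\<in>UNIV. joint p * log_lik (r $ i + s $ i) (l $ i) (fst p i + snd p i) - joint p * log_lik (r $ i) (l $ i) (fst p i)) has_sum
    (\<Sum>i\<in>UNIV. poisson_mean ((r $ i + s $ i) * l $ i) (log_lik (r $ i + s $ i) (l $ i))
      - poisson_mean (r $ i * l $ i) (log_lik (r $ i) (l $ i)))) UNIV"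
    by (intro has_sum_finite_sum has_sum_diff_real has_sum_total has_sum_first tame_log_lik) simp
  then show ?thesis
    unfolding ln_neg_binomial_ratio
    by (simp add: sum_distrib_left right_diff_distrib poisson_mean_log_lik[OF R l] poisson_mean_log_lik[OF r l])
qed

lemma jeffreys_risk_less:
  "(\<Sum>\<^sub>\<infinity>p. joint p * ln (poisson_lik s l (snd p) / neg_binomial r s (fst p) (snd p))) <
    1.04 * (0.5 * (\<Sum>i\<in>UNIV. ln ((r $ i + s $ i) / r $ i)))"
proof -
  \<comment> \<open>The constant 0.52 is 1.04 / 2; in each coordinate 1/2 comes from the rates in
    \<open>log_lik\<close>, and less than 1/50 from the increment of
    \<open>log_lik_mean\<close>.\<close>
  have "(\<Sum>i\<in>UNIV. (log_lik_mean ((r $ i + s $ i) * l $ i) + ln (r $ i + s $ i) / 2)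
      - (log_lik_mean (r $ i * l $ i) + ln (r $ i) / 2)) < (\<Sum>i\<in>UNIV. 0.52 * ln ((r $ i + s $ i) / r $ i))"
  proof (rule sum_strict_mono)
    fix i :: 'n
    have p: "r $ i > 0" "s $ i > 0" "l $ i > 0" "r $ i + s $ i > 0" using r[of i] s[of i] l[of i] by simp_all
    have "log_lik_mean ((r $ i + s $ i) * l $ i) - log_lik_mean (r $ i * l $ i) <
        (ln ((r $ i + s $ i) * l $ i) - ln (r $ i * l $ i)) / 50"
      by (rule log_lik_mean_increment) (use p in auto)
    also have "ln ((r $ i + s $ i) * l $ i) - ln (r $ i * l $ i) = ln (r $ i + s $ i) - ln (r $ i)"
      using p by (simp only: ln_mult_pos)
    finally show "(log_lik_mean ((r $ i + s $ i) * l $ i) + ln (r $ i + s $ i) / 2)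
      - (log_lik_mean (r $ i * l $ i) + ln (r $ i) / 2) < 0.52 * ln ((r $ i + s $ i) / r $ i)"
      using p by (simp add: ln_div)
  qed auto
  then show ?thesis using infsumI[OF jeffreys_risk_has_sum] by (simp add: sum_distrib_left)
qed

end

section \<open>Domination and near minimaxity\<close>

text \<open>The distances to subspaces enter only through the two properties of \<open>G\<close>: it
  decreases under Gaussian averaging and is even in every coordinate.\<close>

lemma bayes_pred_super_mean_prior:
  fixes r s :: "real ^ 'n::finite" and G :: "real ^ 'n \<Rightarrow> real"
  assumes r: "\<And>i. r $ i > 0" and s: "\<And>i. s $ i > 0"
    and G: "super_mean G" "\<And>x. G (\<chi> i. \<bar>x $ i\<bar>) = G x"
  defines "q \<equiv> bayes_pred r s (\<lambda>l. G (theta_diff r s l) * jeffreys_prior l)"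
  shows "dominates r s q (bayes_pred r s jeffreys_prior) \<and> nearly_minimax r s q"
proof -
  define b where "b i = s $ i / r $ i" for i
  define g where "g i = 1 / r $ i - 1 / (r $ i + s $ i)" for i
  have R: "r $ i + s $ i > 0" for i using r[of i] s[of i] by simp
  interpret mixture_pair G b
    by unfold_locales (use G(1) r s in \<open>auto simp: b_def\<close>)
  have g: "g i > 0" for i using r[of i] s[of i] R[of i] by (simp add: g_def frac_less2)
  \<comment> \<open>The purpose of \<gamma> in \<open>theta_diff\<close>: with b = s / r both rates
    become those of the locale.\<close>
  have rg: "r $ i * g i = a i" and Rg: "(r $ i + s $ i) * g i = b i" for i
  proof -
    have nz: "r $ i \<noteq> 0" "r $ i + s $ i \<noteq> 0" using r[of i] R[of i] by auto
    have gi: "g i = s $ i / (r $ i * (r $ i + s $ i))" using nz by (simp add: g_def divide_simps)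
    show "r $ i * g i = a i" using nz by (simp add: gi a_def b_def divide_simps)
    show "(r $ i + s $ i) * g i = b i" using nz by (simp add: gi b_def)
  qed
  have q: "q = (\<lambda>x y. neg_binomial r s x y * H (\<lambda>i. x i + y i) / h x)"
  proof (intro ext)
    fix x y
    have "bayes_pred r s (\<lambda>l. G (\<chi> i. sqrt (l $ i / g i)) * jeffreys_prior l) x y =
        neg_binomial r s x y * H (\<lambda>i. x i + y i) / h x"
      by (rule bayes_pred_mixture[where G = G and g = g, OF Fm F_nonneg G(2) g r s])
         (simp_all only: rg Rg mixture_h mixture_H h_nonneg H_nonneg)
    then show "q x y = neg_binomial r s x y * H (\<lambda>i. x i + y i) / h x"
      by (simp add: q_def theta_diff_def g_def)
  qed
  have J: "bayes_pred r s jeffreys_prior = neg_binomial r s"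
    by (intro ext bayes_pred_jeffreys r s)
  have *: "KL_risk r s q l < KL_risk r s (neg_binomial r s) l"
      "KL_risk r s (neg_binomial r s) l < ereal (1.04 * (0.5 * (\<Sum>i\<in>UNIV. ln ((r $ i + s $ i) / r $ i))))"
    if "l \<in> pos_orthant" for l
  proof -
    interpret P: poisson_pair r s l
      by unfold_locales (use r s that in \<open>auto simp: pos_orthant_def\<close>)
    have S: "(\<lambda>p. P.joint p * ln (poisson_lik s l (snd p) / neg_binomial r s (fst p) (snd p))) summable_on UNIV"
      using P.jeffreys_risk_has_sum by (rule has_sum_imp_summable)
    have "\<rho> = P.share"
    proof
      fix i show "\<rho> i = P.share i"
        using r[of i] R[of i] by (simp add: \<rho>_def P.share_def b_def field_simps)
    qed
    then show "KL_risk r s q l < KL_risk r s (neg_binomial r s) l"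
      unfolding q using thinning_sum_le h_0_less_H_0
      by (intro P.risk_improvement P.neg_binomial_pos S h_pos H_pos log_linear_h log_linear_H) simp_all
    show "KL_risk r s (neg_binomial r s) l < ereal (1.04 * (0.5 * (\<Sum>i\<in>UNIV. ln ((r $ i + s $ i) / r $ i))))"
      using P.KL_risk_eq[OF P.neg_binomial_pos S] P.jeffreys_risk_less by simp
  qed
  have "(\<chi> i. 1) \<in> (pos_orthant :: (real ^ 'n) set)" by (simp add: pos_orthant_def)
  then show ?thesis
    unfolding dominates_def nearly_minimax_def J using * less_imp_le less_trans by blast
qed

theorem proposition3:
  fixes n :: nat
    and V :: "nat \<Rightarrow> (real ^ 'd::finite) set"
    and k :: "nat \<Rightarrow> nat"
    and \<alpha> :: "nat \<Rightarrow> real"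
  assumes "n \<ge> 1"
    and "\<And>j. j \<in> {1..n} \<Longrightarrow> subspace (V j)"
    and "\<And>j. j \<in> {1..n} \<Longrightarrow> dim (V j) = k j"
    and "\<And>j. j \<in> {1..n} \<Longrightarrow> 0 < \<alpha> j"
    and "\<And>j. j \<in> {1..n} \<Longrightarrow> \<alpha> j \<le> (real CARD('d) - real (k j) - 2) / 2"
  shows
    "(\<forall>(r0::real) (s0::real). 0 < r0 \<longrightarrow> 0 < s0 \<longrightarrow>
        (let r = (\<chi> i. r0); s = (\<chi> i. s0);
             q = bayes_pred r s (prior_fJ (shrink_f n V \<alpha>) theta_same)
         in dominates r s q (bayes_pred r s jeffreys_prior) \<and> nearly_minimax r s q)) \<and>
     (\<forall>r s :: real ^ 'd. (\<forall>i. 0 < r $ i) \<longrightarrow> (\<forall>i. 0 < s $ i) \<longrightarrow>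
        (let q = bayes_pred r s (prior_fJ (shrink_f n V \<alpha>) (theta_diff r s))
         in dominates r s q (bayes_pred r s jeffreys_prior) \<and> nearly_minimax r s q))"
proof -
  have sm: "super_mean (\<lambda>x. shrink_f n V \<alpha> (\<kappa> *\<^sub>R x))" if "\<kappa> > 0" for \<kappa>
    by (rule super_mean_shrink_f) (use assms that in auto)
  have abs: "shrink_f n V \<alpha> (\<kappa> *\<^sub>R (\<chi> i. \<bar>x $ i\<bar>)) = shrink_f n V \<alpha> (\<kappa> *\<^sub>R x)" if "\<kappa> > 0" for \<kappa> and x :: "real ^ 'd"
  proof -
    have "\<kappa> *\<^sub>R (\<chi> i. \<bar>x $ i\<bar>) = (\<chi> i. \<bar>(\<kappa> *\<^sub>R x) $ i\<bar>)"
      using that by (simp add: vec_eq_iff abs_mult)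
    then show ?thesis by (simp only: shrink_f_abs)
  qed
  have same: "dominates r s q (bayes_pred r s jeffreys_prior) \<and> nearly_minimax r s q"
    if "0 < r0" "0 < s0" "r = (\<chi> i. r0)" "s = (\<chi> i. s0)" "q = bayes_pred r s (prior_fJ (shrink_f n V \<alpha>) theta_same)"
    for r0 s0 :: real and r s :: "real ^ 'd" and q
  proof -
    define \<gamma> where "\<gamma> = 1 / r0 - 1 / (r0 + s0)"
    have \<gamma>: "\<gamma> > 0" using that(1,2) by (simp add: \<gamma>_def frac_less2)
    \<comment> \<open>For equal durations the two parametrisations differ by the scalar sqrt
      \<gamma>, hence the rescaled function with \<kappa> = sqrt \<gamma>.\<close>
    have "theta_same l = sqrt \<gamma> *\<^sub>R theta_diff r s l" for l :: "real ^ 'd"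
      using \<gamma> that(3,4) by (simp add: theta_same_def theta_diff_def vec_eq_iff real_sqrt_divide flip: \<gamma>_def)
    then have "prior_fJ (shrink_f n V \<alpha>) theta_same = (\<lambda>l. shrink_f n V \<alpha> (sqrt \<gamma> *\<^sub>R theta_diff r s l) * jeffreys_prior l)"
      by (simp add: prior_fJ_def fun_eq_iff)
    then show ?thesis
      using bayes_pred_super_mean_prior[of r s "\<lambda>x. shrink_f n V \<alpha> (sqrt \<gamma> *\<^sub>R x)"] sm[of "sqrt \<gamma>"] abs[of "sqrt \<gamma>"] \<gamma> that
      by simp
  qed
  have diff: "dominates r s q (bayes_pred r s jeffreys_prior) \<and> nearly_minimax r s q"
    if "\<forall>i. 0 < r $ i" "\<forall>i. 0 < s $ i" "q = bayes_pred r s (prior_fJ (shrink_f n V \<alpha>) (theta_diff r s))"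
    for r s :: "real ^ 'd" and q
    using bayes_pred_super_mean_prior[of r s "\<lambda>x. shrink_f n V \<alpha> (1 *\<^sub>R x)"] sm[of 1] abs[of 1] that
    by (simp add: prior_fJ_def[abs_def])
  show ?thesis unfolding Let_def using same diff by blast
qed

end
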